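(* Let $F\le T$ be Thompson's groups. The $C^*$-algebra $C^*_{\lambda_{T/F}}(T)$ generated by the quasi-regular representation of $T$ on $\ell^2(T/F)$ admits no traces and is simple.
   Context: Thompson's group $V$ is the group of right-continuous piecewise linear bijections of $[0,1)$ with finitely many points of non-differentiability, all dyadic rationals, and derivative a power of $2$ at each point of differentiability. $T$ is the subgroup of elements of $V$ with at most one point of discontinuity, and $F$ is the subgroup of elements of $V$ that are homeomorphisms of $[0,1)$ (equivalently $F=\{g\in T: g(0)=0\}$). A trace is a tracial state; simple means no nontrivial proper closed two-sided ideals. *)

theory Defs
  imports "HOL-Analysis.Analysis"
begin

definition dyadic_rat :: "real \<Rightarrow> bool" where
  "dyadic_rat x \<longleftrightarrow> (\<exists>m::int. \<exists>n::nat. x = of_int m / 2 ^ n)"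

definition thompsonV :: "(real \<Rightarrow> real) set" where
  "thompsonV = {g.
     bij_betw g {0..<1} {0..<1}
   \<and> (\<forall>x. x \<notin> {0..<1} \<longrightarrow> g x = x)
   \<and> (\<forall>x\<in>{0..<1}. continuous (at_right x) g)
   \<and> (\<exists>S. finite S \<and> (\<forall>a b. a < b \<longrightarrow> {a<..<b} \<subseteq> {0<..<1} - S \<longrightarrow>
                  (\<exists>m c. \<forall>x\<in>{a<..<b}. g x = m * x + c)))
   \<and> finite {x\<in>{0<..<1}. \<not> g differentiable (at x)}
   \<and> (\<forall>x\<in>{0<..<1}. \<not> g differentiable (at x) \<longrightarrow> dyadic_rat x)
   \<and> (\<forall>x\<in>{0<..<1}. g differentiable (at x) \<longrightarrow>
          (\<exists>k::int. (g has_real_derivative 2 powr of_int k) (at x)))}"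

definition thompsonT :: "(real \<Rightarrow> real) set" where
  "thompsonT = {g \<in> thompsonV.
     \<forall>x\<in>{0..<1}. \<forall>y\<in>{0..<1}.
        \<not> continuous (at x within {0..<1}) g \<longrightarrow>
        \<not> continuous (at y within {0..<1}) g \<longrightarrow> x = y}"

definition thompsonF :: "(real \<Rightarrow> real) set" where
  "thompsonF = {g \<in> thompsonT. g 0 = 0}"

definition lcoset :: "(real \<Rightarrow> real) \<Rightarrow> (real \<Rightarrow> real) set \<Rightarrow> (real \<Rightarrow> real) set" where
  "lcoset g H = (\<lambda>f. g \<circ> f) ` H"

definition TmodF :: "(real \<Rightarrow> real) set set" where
  "TmodF = {lcoset g thompsonF | g. g \<in> thompsonT}"

definition ell2 :: "'x set \<Rightarrow> ('x \<Rightarrow> complex) set" where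
  "ell2 X = {\<xi>. (\<forall>x. x \<notin> X \<longrightarrow> \<xi> x = 0) \<and> (\<lambda>x. (cmod (\<xi> x))^2) summable_on X}"

definition l2norm :: "'x set \<Rightarrow> ('x \<Rightarrow> complex) \<Rightarrow> real" where
  "l2norm X \<xi> = sqrt (infsum (\<lambda>x. (cmod (\<xi> x))^2) X)"

definition l2inner :: "'x set \<Rightarrow> ('x \<Rightarrow> complex) \<Rightarrow> ('x \<Rightarrow> complex) \<Rightarrow> complex" where
  "l2inner X \<xi> \<eta> = infsum (\<lambda>x. cnj (\<xi> x) * \<eta> x) X"

type_synonym 'x op = "('x \<Rightarrow> complex) \<Rightarrow> ('x \<Rightarrow> complex)"

text \<open>Bounded operators on l2(X), normalised to send non-l2 inputs to 0 so that
  operators are determined by their action on l2(X).\<close>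
definition bounded_op :: "'x set \<Rightarrow> 'x op \<Rightarrow> bool" where
  "bounded_op X A \<longleftrightarrow>
     (\<forall>\<xi>. \<xi> \<notin> ell2 X \<longrightarrow> A \<xi> = (\<lambda>_. 0))
   \<and> (\<forall>\<xi>\<in>ell2 X. A \<xi> \<in> ell2 X)
   \<and> (\<forall>\<xi>\<in>ell2 X. \<forall>\<eta>\<in>ell2 X. \<forall>a c.
        A (\<lambda>x. a * \<xi> x + c * \<eta> x) = (\<lambda>x. a * A \<xi> x + c * A \<eta> x))
   \<and> (\<exists>C. \<forall>\<xi>\<in>ell2 X. l2norm X (A \<xi>) \<le> C * l2norm X \<xi>)"

definition opnorm :: "'x set \<Rightarrow> 'x op \<Rightarrow> real" where
  "opnorm X A = Sup {l2norm X (A \<xi>) | \<xi>. \<xi> \<in> ell2 X \<and> l2norm X \<xi> \<le> 1}"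

definition op_zero :: "'x op" where
  "op_zero = (\<lambda>\<xi> x. 0)"

definition op_id :: "'x set \<Rightarrow> 'x op" where
  "op_id X = (\<lambda>\<xi>. if \<xi> \<in> ell2 X then \<xi> else (\<lambda>_. 0))"

definition op_lincomb :: "complex \<Rightarrow> 'x op \<Rightarrow> complex \<Rightarrow> 'x op \<Rightarrow> 'x op" where
  "op_lincomb a A b B = (\<lambda>\<xi> x. a * A \<xi> x + b * B \<xi> x)"

definition op_diff :: "'x op \<Rightarrow> 'x op \<Rightarrow> 'x op" where
  "op_diff A B = (\<lambda>\<xi> x. A \<xi> x - B \<xi> x)"

definition is_adjoint :: "'x set \<Rightarrow> 'x op \<Rightarrow> 'x op \<Rightarrow> bool" where
  "is_adjoint X A B \<longleftrightarrow>
     (\<forall>\<xi>\<in>ell2 X. \<forall>\<eta>\<in>ell2 X. l2inner X (A \<xi>) \<eta> = l2inner X \<xi> (B \<eta>))"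

definition tracial_state :: "'x set \<Rightarrow> 'x op set \<Rightarrow> ('x op \<Rightarrow> complex) \<Rightarrow> bool" where
  "tracial_state X \<A> \<tau> \<longleftrightarrow>
     (\<forall>A\<in>\<A>. \<forall>B\<in>\<A>. \<forall>a b. \<tau> (op_lincomb a A b B) = a * \<tau> A + b * \<tau> B)
   \<and> (\<forall>A\<in>\<A>. \<forall>B. bounded_op X B \<and> is_adjoint X A B \<longrightarrow>
         Im (\<tau> (B \<circ> A)) = 0 \<and> Re (\<tau> (B \<circ> A)) \<ge> 0)
   \<and> \<tau> (op_id X) = 1
   \<and> (\<forall>A\<in>\<A>. \<forall>B\<in>\<A>. \<tau> (A \<circ> B) = \<tau> (B \<circ> A))"

definition closed_ideal :: "'x set \<Rightarrow> 'x op set \<Rightarrow> 'x op set \<Rightarrow> bool" where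
  "closed_ideal X \<A> I \<longleftrightarrow>
     I \<subseteq> \<A> \<and> op_zero \<in> I
   \<and> (\<forall>A\<in>I. \<forall>B\<in>I. \<forall>a b. op_lincomb a A b B \<in> I)
   \<and> (\<forall>A\<in>\<A>. \<forall>J\<in>I. A \<circ> J \<in> I \<and> J \<circ> A \<in> I)
   \<and> (\<forall>A\<in>\<A>. (\<forall>\<epsilon>>0. \<exists>J\<in>I. opnorm X (op_diff A J) < \<epsilon>) \<longrightarrow> A \<in> I)"

definition simple_op_alg :: "'x set \<Rightarrow> 'x op set \<Rightarrow> bool" where
  "simple_op_alg X \<A> \<longleftrightarrow> (\<forall>I. closed_ideal X \<A> I \<longrightarrow> I = {op_zero} \<or> I = \<A>)"

definition quasireg :: "(real \<Rightarrow> real) \<Rightarrow> (real \<Rightarrow> real) set op" where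
  "quasireg g = (\<lambda>\<xi>. if \<xi> \<in> ell2 TmodF
      then (\<lambda>C. if C \<in> TmodF then \<xi> (lcoset (inv g) C) else 0)
      else (\<lambda>_. 0))"

definition group_alg_qr :: "(real \<Rightarrow> real) set op set" where
  "group_alg_qr = {A. \<exists>S c. finite S \<and> S \<subseteq> thompsonT \<and>
       A = (\<lambda>\<xi> C. \<Sum>g\<in>S. c g * quasireg g \<xi> C)}"

definition cstar_qr :: "(real \<Rightarrow> real) set op set" where
  "cstar_qr = {A. bounded_op TmodF A \<and>
       (\<forall>\<epsilon>>0. \<exists>B\<in>group_alg_qr. opnorm TmodF (op_diff A B) < \<epsilon>)}"

end

theory Submission
  imports Defs
begin

text \<open>
  The map \<open>g F \<mapsto> g 0\<close> identifies \<open>T/F\<close> with an orbit of points of the circle, so \<open>\<lambda>\<close> is a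
  permutation representation. For one element \<open>c \<in> F\<close> supported on three quarters of the circle,
  the four conjugates of \<open>c\<close> by quarter rotations have no common almost invariant vectors: \<open>c\<close>
  maps the first two quarters onto the first, so an almost \<open>c\<close>-invariant vector has almost no
  mass on the second quarter. Hence \<open>\<Sum>(2 - c\<^sub>k - c\<^sub>k\<^sup>-\<^sup>1)\<close> is invertible in the algebra.

  If \<open>\<tau>\<close> is a trace, then \<open>\<tau>(2 - f - f\<^sup>-\<^sup>1)\<close> is bounded, conjugation invariant and additive on products of
  elements with disjoint supports, hence vanishes on elements supported in an arc; by Cauchy--Schwarz
  and invertibility, \<open>\<tau>(1) = 0\<close>.

  A nonzero ideal contains some \<open>x\<close> with nonzero coefficient at the base point. Averaging matrix
  coefficients near the base point, where germs act as shifts, yields coefficients of \<open>x\<close> bounded below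
  on which approximants of \<open>x\<close> have constant germs. Compressing \<open>x\<close> to tiny arcs by elements \<open>1 - f\<close> with \<open>f\<close>
  supported there produces approximations to multiples of \<open>2 - f - f\<^sup>-\<^sup>1\<close> in the ideal; these can be conjugated
  back to the \<open>2 - c\<^sub>k - c\<^sub>k\<^sup>-\<^sup>1\<close>, so the ideal contains an invertible element.
\<close>

section \<open>Dyadic piecewise affine bijections\<close>

text \<open>Elements of F with different slopes at 0 all contribute to the coefficient at the base
  coset, and no arc at 0 separates them: after division by one of them, another neither fixes the
  arc nor moves it off itself. At the orbit points 2 powi (- n - 2) different slopes become
  different shifts, but a single coefficient there may vanish; only the sum over an n by n block is
  comparable with n times the base coefficient, the error being bounded independently of n and of
  the position of the block. The lower bound \<eta> obtained in this way belongs to the ideal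
  element itself. It is fixed before the approximant used for compression is chosen, since that
  approximant must be accurate relative to \<eta> and its germs are controlled only beyond a
  threshold of its own. The compressing element and the four generators behind the spectral gap are
  conjugates of the single element \<open>contr\<close>, so one approximation serves all four. The
  bound on the trace of 2 - f - f^-1 comes from the positivity of 2 + f + f^-1. The spectral gap is
  quantified as 1/16384, and the errors of the ideal element use up half of it.\<close>

lemma dyadic_rat_powi_iff: "dyadic_rat x \<longleftrightarrow> (\<exists>m k::int. x = of_int m * 2 powi k)"
proof
  assume "dyadic_rat x"
  then obtain m :: int and n :: nat where "x = of_int m / 2 ^ n"
    unfolding dyadic_rat_def by blast
  then have "x = of_int m * 2 powi (- int n)"
    by (simp add: power_int_minus divide_inverse)
  then show "\<exists>m k::int. x = of_int m * 2 powi k" by blast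
next
  assume "\<exists>m k::int. x = of_int m * 2 powi k"
  then obtain m k :: int where x: "x = of_int m * 2 powi k" by blast
  show "dyadic_rat x"
  proof (cases "k \<ge> 0")
    case True
    then have "x = of_int (m * 2 ^ nat k) / 2 ^ 0" using x by (simp add: power_int_def)
    then show ?thesis unfolding dyadic_rat_def by blast
  next
    case False
    then have "x = of_int m / 2 ^ nat (-k)" using x by (simp add: power_int_def field_simps)
    then show ?thesis unfolding dyadic_rat_def by blast
  qed
qed

lemma dyadic_rat_0 [simp]: "dyadic_rat 0"
  unfolding dyadic_rat_powi_iff by (intro exI[of _ 0]) simp

lemma dyadic_rat_1 [simp]: "dyadic_rat 1"
  unfolding dyadic_rat_powi_iff by (intro exI[of _ 1] exI[of _ 0]) simp

lemma dyadic_rat_add: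
  assumes "dyadic_rat x" "dyadic_rat y"
  shows "dyadic_rat (x + y)"
proof -
  obtain m m' :: int and n n' :: nat where xy: "x = of_int m / 2 ^ n" "y = of_int m' / 2 ^ n'"
    using assms unfolding dyadic_rat_def by blast
  have "x + y = of_int (m * 2 ^ n' + m' * 2 ^ n) / 2 ^ (n + n')"
    unfolding xy by (simp add: add_divide_distrib power_add)
  then show ?thesis unfolding dyadic_rat_def by blast
qed

lemma dyadic_rat_minus: "dyadic_rat x \<Longrightarrow> dyadic_rat (- x)"
  unfolding dyadic_rat_def by (metis minus_divide_left of_int_minus)

lemma dyadic_rat_diff: "dyadic_rat x \<Longrightarrow> dyadic_rat y \<Longrightarrow> dyadic_rat (x - y)"
  using dyadic_rat_add[of x "- y"] dyadic_rat_minus[of y] by simp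

lemma dyadic_rat_powi_mult: "dyadic_rat x \<Longrightarrow> dyadic_rat (2 powi k * x)"
  unfolding dyadic_rat_powi_iff
proof (elim exE)
  fix m j :: int
  assume "x = of_int m * 2 powi j"
  then have "2 powi k * x = of_int m * 2 powi (k + j)" by (simp add: power_int_add)
  then show "\<exists>m j. 2 powi k * x = of_int m * 2 powi j" by blast
qed

lemma dyadic_rat_powi_mult_iff [simp]: "dyadic_rat (2 powi k * x) \<longleftrightarrow> dyadic_rat x"
proof
  assume "dyadic_rat (2 powi k * x)"
  then have "dyadic_rat (2 powi (-k) * (2 powi k * x))" by (rule dyadic_rat_powi_mult)
  then show "dyadic_rat x" by (simp add: power_int_minus flip: mult.assoc)
qed (rule dyadic_rat_powi_mult)

text \<open>\<open>S\<close> contains the break points of \<open>g\<close>; pieces are closed on the left and open on the right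
  because elements of \<open>V\<close> are only right-continuous.\<close>
definition breaks :: "(real \<Rightarrow> real) \<Rightarrow> real set \<Rightarrow> bool" where
  "breaks g S \<longleftrightarrow> finite S \<and> 0 \<in> S \<and> S \<subseteq> {0..<1} \<and> (\<forall>s\<in>S. dyadic_rat s) \<and>
     (\<forall>x\<in>{0..<1}. \<exists>k::int. \<forall>y\<in>{x..<1}. S \<inter> {x<..y} = {} \<longrightarrow> g y = g x + 2 powi k * (y - x))"

lemma next_break:
  fixes x :: real
  assumes "finite S" "S \<subseteq> {0..<1}" "x < 1"
  obtains q where "x < q" "q \<le> 1" "S \<inter> {x<..<q} = {}" "q \<in> S \<or> q = 1"
proof -
  define q where "q = Min (insert 1 {s\<in>S. x < s})"
  have fin: "finite (insert 1 {s\<in>S. x < s})" using assms by auto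
  have "q \<in> insert 1 {s\<in>S. x < s}" unfolding q_def using fin by (intro Min_in) auto
  moreover have "q \<le> s" if "s \<in> insert 1 {s\<in>S. x < s}" for s
    unfolding q_def using fin that by (intro Min_le) auto
  ultimately show ?thesis using assms by (intro that[of q]) force+
qed

lemma prev_break:
  fixes x :: real
  assumes "finite S" "0 \<in> S" "0 \<le> x"
  obtains p where "p \<in> S" "p \<le> x" "S \<inter> {p<..x} = {}"
proof -
  define p where "p = Max {s\<in>S. s \<le> x}"
  have fin: "finite {s\<in>S. s \<le> x}" "{s\<in>S. s \<le> x} \<noteq> {}" using assms by auto
  have "p \<in> {s\<in>S. s \<le> x}" unfolding p_def using fin by (rule Max_in)
  moreover have "s \<le> p" if "s \<in> S" "s \<le> x" for s
    unfolding p_def using fin that by (intro Max_ge) auto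
  ultimately show ?thesis by (intro that[of p]) force+
qed

lemma breaks_affine:
  assumes "breaks g S" "0 \<le> x" "x < 1"
  obtains k :: int and q where "x < q" "q \<le> 1" "S \<inter> {x<..<q} = {}" "q \<in> S \<or> q = 1"
    "\<And>y. x \<le> y \<Longrightarrow> y < q \<Longrightarrow> g y = g x + 2 powi k * (y - x)"
proof -
  obtain q where q: "x < q" "q \<le> 1" "S \<inter> {x<..<q} = {}" "q \<in> S \<or> q = 1"
    using next_break assms unfolding breaks_def by metis
  obtain k :: int where k: "\<forall>y\<in>{x..<1}. S \<inter> {x<..y} = {} \<longrightarrow> g y = g x + 2 powi k * (y - x)"
    using assms unfolding breaks_def by force
  show ?thesis
  proof (rule that[OF q])
    fix y assume "x \<le> y" "y < q"
    moreover from this have "S \<inter> {x<..y} = {}" using q by force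
    ultimately show "g y = g x + 2 powi k * (y - x)" using bspec[OF k, of y] q by auto
  qed
qed

text \<open>\<open>w\<close> is the left limit of \<open>g\<close> at the end of an affine piece. If
  \<open>w\<close> were the value at a non-break \<open>z\<close>, then \<open>g\<close> would also
  be affine just to the left of \<open>z\<close>, so values slightly below \<open>w\<close> would be
  taken near \<open>z\<close> and near \<open>q\<close>; injectivity merges the two pieces and
  forces \<open>z = q\<close>.\<close>

lemma breaks_piece_end:
  assumes br: "breaks g S" and bij: "bij_betw g {0..<1} {0..<1}"
    and x: "0 \<le> x" "x < q" "q \<le> 1" "q \<in> S \<or> q = 1"
    and aff: "\<And>y. x \<le> y \<Longrightarrow> y < q \<Longrightarrow> g y = g x + 2 powi k * (y - x)"
  defines "w \<equiv> g x + 2 powi k * (q - x)"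
  shows "w \<le> 1" "w \<noteq> 1 \<Longrightarrow> w \<in> g ` S"
proof -
  have range: "g y \<in> {0..<1}" if "y \<in> {0..<1}" for y using bij that by (auto simp: bij_betw_def)
  have pos: "(2::real) powi k > 0" by simp
  show "w \<le> 1"
  proof (rule ccontr)
    assume "\<not> w \<le> 1"
    then have w: "w > 1" by simp
    \<comment> \<open>The point at which the affine formula reaches 1, a value outside the
      range.\<close>
    define y where "y = x + (1 - g x) / 2 powi k"
    have "g x < 1" using range[of x] x by auto
    then have "y \<ge> x" unfolding y_def by simp
    moreover have "y < q"
      using w pos unfolding w_def y_def by (simp add: field_simps)
    ultimately have "g y = 1" using aff[of y] pos unfolding y_def by simp
    then show False using range[of y] \<open>y \<ge> x\<close> \<open>y < q\<close> x by auto
  qed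
  show "w \<in> g ` S" if "w \<noteq> 1"
  proof -
    have gx: "0 \<le> g x" using range[of x] x by auto
    have "w \<in> {0..<1}" using \<open>w \<le> 1\<close> that gx x pos unfolding w_def by auto
    then obtain z where z: "z \<in> {0..<1}" "g z = w" using bij_betw_imp_surj_on[OF bij] by (metis imageE)
    have "z \<in> S"
    proof (rule ccontr)
      assume "z \<notin> S"
      obtain p where p: "p \<in> S" "p \<le> z" "S \<inter> {p<..z} = {}"
        using prev_break[of S z] br z unfolding breaks_def by auto
      then have "p < z" using \<open>z \<notin> S\<close> by (cases "p = z") auto
      have "0 \<le> p" "p < 1" using p br z unfolding breaks_def by auto
      then obtain j :: int where j: "\<forall>y\<in>{p..<1}. S \<inter> {p<..y} = {} \<longrightarrow> g y = g p + 2 powi j * (y - p)"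
        using br unfolding breaks_def by force
      have gz: "g (z - t) = w - 2 powi j * t" if "0 \<le> t" "t \<le> z - p" for t
      proof -
        have "S \<inter> {p<..z - t} = {}" using p that by force
        then have "g (z - t) = g p + 2 powi j * (z - t - p)"
          using bspec[OF j, of "z - t"] that z by auto
        moreover have "w = g p + 2 powi j * (z - p)" using bspec[OF j, of z] p z by auto
        ultimately show ?thesis by (simp add: algebra_simps)
      qed
      have gq: "g (q - s) = w - 2 powi k * s" if "0 < s" "s \<le> q - x" for s
        using aff[of "q - s"] that unfolding w_def by (simp add: algebra_simps)
      \<comment> \<open>Ratio of the slopes: \<open>g\<close> takes the same value at distance
        \<open>t\<close> to the left of \<open>z\<close> and at distance \<open>r * t\<close> to the
        left of \<open>q\<close>.\<close>
      define r :: real where "r = 2 powi j / 2 powi k"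
      have r: "r > 0" unfolding r_def by simp
      have eq: "z - t = q - r * t" if "0 < t" "t \<le> z - p" "r * t \<le> q - x" for t
      proof -
        have "g (z - t) = g (q - r * t)"
          using gz[of t] gq[of "r * t"] that r by (simp add: r_def)
        moreover have "r * t > 0" using that r by simp
        moreover have "z - t \<in> {0..<1}" using that z \<open>0 \<le> p\<close> by auto
        moreover have "q - r * t \<in> {0..<1}" using that x \<open>r * t > 0\<close> by auto
        ultimately show ?thesis using bij unfolding bij_betw_def inj_on_def by blast
      qed
      define t where "t = min (z - p) ((q - x) / r)"
      have t: "0 < t" "t \<le> z - p" "r * t \<le> q - x"
        using \<open>p < z\<close> x r by (auto simp: t_def min_def field_simps)
      \<comment> \<open>Twice the equation for \<open>t/2\<close> minus the equation for
        \<open>t\<close> eliminates \<open>r\<close> and leaves \<open>z = q\<close>.\<close>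
      have "z - t = q - r * t" using eq t by blast
      moreover have "z - t/2 = q - r * (t/2)" using eq[of "t/2"] t mult_pos_pos[OF r t(1)] by auto
      ultimately have "z = q" by (simp add: field_simps)
      then show False using x z \<open>z \<notin> S\<close> by auto
    qed
    then show ?thesis using z by auto
  qed
qed

text \<open>A least non-dyadic value \<open>g s\<close> would be the right end of the image of another piece, which has a dyadic
  left end and dyadic length.\<close>
lemma breaks_image_dyadic:
  assumes br: "breaks g S" and bij: "bij_betw g {0..<1} {0..<1}" and "s \<in> S"
  shows "dyadic_rat (g s)"
proof (rule ccontr)
  assume "\<not> dyadic_rat (g s)"
  have finS: "finite S" "0 \<in> S" "S \<subseteq> {0..<1}" and dy: "\<And>s. s \<in> S \<Longrightarrow> dyadic_rat s"
    using br unfolding breaks_def by auto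
  define B where "B = {u \<in> g ` S. \<not> dyadic_rat u}"
  have B: "finite B" "B \<noteq> {}" using finS \<open>s \<in> S\<close> \<open>\<not> dyadic_rat (g s)\<close> unfolding B_def by auto
  define u where "u = Min B"
  have uB: "u \<in> B" unfolding u_def using B by (rule Min_in)
  have umin: "dyadic_rat v" if "v \<in> g ` S" "v < u" for v
    using that Min_le[OF B(1), of v] unfolding u_def B_def by force
  obtain x where x: "x \<in> S" "u = g x" using uB unfolding B_def by auto
  have range: "g y \<in> {0..<1}" if "y \<in> {0..<1}" for y using bij that by (auto simp: bij_betw_def)
  have "u \<in> {0..<1}" using x range finS by blast
  moreover have "u \<noteq> 0" using uB unfolding B_def by (metis (mono_tags, lifting) dyadic_rat_0 mem_Collect_eq)
  ultimately have u0: "0 < u" "u < 1" by auto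
  \<comment> \<open>The piece through this point starts at a break whose value is below
    \<open>u\<close>, so the set \<open>A\<close> of smaller break values is not empty.\<close>
  obtain z where z: "z \<in> {0..<1}" "g z = u / 2"
    using bij_betw_imp_surj_on[OF bij] u0
    by (metis atLeastLessThan_iff field_sum_of_halves half_gt_zero imageE less_add_same_cancel1 less_eq_real_def order_less_trans)
  obtain p where p: "p \<in> S" "p \<le> z" "S \<inter> {p<..z} = {}"
    using prev_break[of S z] finS z by auto
  obtain j :: int where j: "\<forall>y\<in>{p..<1}. S \<inter> {p<..y} = {} \<longrightarrow> g y = g p + 2 powi j * (y - p)"
    using br p finS unfolding breaks_def by force
  have "g z = g p + 2 powi j * (z - p)" using bspec[OF j, of z] z p by auto
  moreover have "2 powi j * (z - p) \<ge> 0" using p by simp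
  ultimately have "g p < u" using z u0 by linarith
  define A where "A = {v \<in> g ` S. v < u}"
  have A: "finite A" "A \<noteq> {}" using finS p \<open>g p < u\<close> unfolding A_def by auto
  have "Max A \<in> A" using A by (rule Max_in)
  then obtain r where r: "r \<in> S" "g r = Max A" "g r < u" unfolding A_def by auto
  have rmax: "v \<le> g r" if "v \<in> g ` S" "v < u" for v
    unfolding r(2) using A that by (intro Max_ge) (auto simp: A_def)
  have r01: "0 \<le> r" "r < 1" using r finS by auto
  obtain k :: int and q where q: "r < q" "q \<le> 1" "S \<inter> {r<..<q} = {}" "q \<in> S \<or> q = 1"
    "\<And>y. r \<le> y \<Longrightarrow> y < q \<Longrightarrow> g y = g r + 2 powi k * (y - r)"
    using breaks_affine[OF br r01] by metis
  define w where "w = g r + 2 powi k * (q - r)"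
  have w: "w \<le> 1" "w \<noteq> 1 \<Longrightarrow> w \<in> g ` S"
    using breaks_piece_end[OF br bij r01(1) q(1,2,4,5)] unfolding w_def by auto
  have "w > g r" using q(1) by (simp add: w_def)
  \<comment> \<open>Overshooting \<open>u\<close> would place the break \<open>x\<close> strictly
    inside a piece; stopping short of \<open>u\<close> would make \<open>w\<close> a break value
    between \<open>g r\<close> and \<open>u\<close>. Hence the piece ends exactly at
    \<open>u\<close>.\<close>
  have "\<not> w > u"
  proof
    assume "w > u"
    define y where "y = r + (u - g r) / 2 powi k"
    have y: "r < y" "y < q" using \<open>w > u\<close> r q(1) unfolding y_def w_def by (auto simp: field_simps)
    have "g y = u" using q(5)[of y] y unfolding y_def by simp
    moreover have "y \<in> {0..<1}" using y r01 q(2) by auto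
    moreover have "x \<in> {0..<1}" using x finS by blast
    ultimately have "y = x" using bij_betw_imp_inj_on[OF bij] x by (metis inj_onD)
    then show False using q(3) x y by auto
  qed
  moreover have "\<not> w < u" using rmax[of w] w \<open>w > g r\<close> u0 by force
  ultimately have "u = g r + 2 powi k * (q - r)" unfolding w_def by simp
  moreover have "dyadic_rat (q - r)" using q(4) dy r by (auto intro!: dyadic_rat_diff)
  moreover have "dyadic_rat (g r)" using umin r by blast
  ultimately have "dyadic_rat u" by (simp add: dyadic_rat_add)
  then show False using uB unfolding B_def by simp
qed

text \<open>Needed for compositions: the break points of the outer map, pulled back through
  \<open>g\<close>, must again be dyadic.\<close>

lemma breaks_dyadic_iff:
  assumes br: "breaks g S" and bij: "bij_betw g {0..<1} {0..<1}" and x: "x \<in> {0..<1}"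
  shows "dyadic_rat (g x) \<longleftrightarrow> dyadic_rat x"
proof -
  have finS: "finite S" "0 \<in> S" "S \<subseteq> {0..<1}" "\<And>s. s \<in> S \<Longrightarrow> dyadic_rat s"
    using br unfolding breaks_def by auto
  obtain p where p: "p \<in> S" "p \<le> x" "S \<inter> {p<..x} = {}"
    using prev_break[of S x] finS x by auto
  obtain k :: int where k: "\<forall>y\<in>{p..<1}. S \<inter> {p<..y} = {} \<longrightarrow> g y = g p + 2 powi k * (y - p)"
    using br p finS unfolding breaks_def by force
  have gx: "g x = g p + 2 powi k * (x - p)" using bspec[OF k, of x] p x by auto
  have d: "dyadic_rat p" "dyadic_rat (g p)" using breaks_image_dyadic[OF br bij] p finS by auto
  have "dyadic_rat (g x) \<longleftrightarrow> dyadic_rat (2 powi k * (x - p))"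
    unfolding gx using d(2) dyadic_rat_add dyadic_rat_diff by (metis add_diff_cancel_left')
  also have "\<dots> \<longleftrightarrow> dyadic_rat x"
    using d(1) dyadic_rat_add dyadic_rat_diff by (metis diff_add_cancel dyadic_rat_powi_mult_iff)
  finally show ?thesis .
qed

section \<open>The Darboux property of derivatives, and the affine pieces of elements of V\<close>

lemma derivative_intermediate_value:
  fixes g D :: "real \<Rightarrow> real"
  assumes D: "\<And>x. x \<in> {u..v} \<Longrightarrow> (g has_real_derivative D x) (at x)"
    and "u < v" and c: "D u < c \<and> c < D v \<or> D v < c \<and> c < D u"
  shows "\<exists>z\<in>{u<..<v}. D z = c"
proof -
  \<comment> \<open>The sign reduces both orders of \<open>D u\<close> and \<open>D v\<close> to
    one: \<open>h\<close> decreases at \<open>u\<close> and increases at \<open>v\<close>, so its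
    minimum over the closed interval is attained inside.\<close>
  define e where "e = (if D u < c then 1 else -1 :: real)"
  define h where "h x = e * (g x - c * x)" for x
  have dh: "(h has_real_derivative e * (D x - c)) (at x)" if "x \<in> {u..v}" for x
    unfolding h_def using D[OF that] by (auto intro!: derivative_eq_intros)
  have neg: "e * (D u - c) < 0" and pos: "e * (D v - c) > 0"
    using c by (auto simp: e_def)
  have "continuous_on {u..v} h"
    using dh by (meson DERIV_isCont continuous_at_imp_continuous_on)
  then obtain z where z: "z \<in> {u..v}" "\<And>y. y \<in> {u..v} \<Longrightarrow> h z \<le> h y"
    using continuous_attains_inf[of "{u..v}" h] \<open>u < v\<close> by auto
  have "z \<noteq> u"
  proof
    assume "z = u"
    obtain d where d: "d > 0" "\<And>t. t > 0 \<Longrightarrow> t < d \<Longrightarrow> h (u + t) < h u"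
      using DERIV_neg_dec_right[OF dh neg] \<open>u < v\<close> by auto
    define t where "t = min (d / 2) (v - u)"
    have "t > 0" "t < d" "u + t \<in> {u..v}" using d(1) \<open>u < v\<close> by (auto simp: t_def)
    then show False using d(2)[of t] z(2)[of "u + t"] \<open>z = u\<close> by auto
  qed
  moreover have "z \<noteq> v"
  proof
    assume "z = v"
    obtain d where d: "d > 0" "\<And>t. t > 0 \<Longrightarrow> t < d \<Longrightarrow> h (v - t) < h v"
      using DERIV_pos_inc_left[OF dh pos] \<open>u < v\<close> by auto
    define t where "t = min (d / 2) (v - u)"
    have "t > 0" "t < d" "v - t \<in> {u..v}" using d(1) \<open>u < v\<close> by (auto simp: t_def)
    then show False using d(2)[of t] z(2)[of "v - t"] \<open>z = v\<close> by auto
  qed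
  ultimately have zuv: "z \<in> {u<..<v}" using z by auto
  have "e * (D z - c) = 0"
  proof (rule DERIV_local_min[OF dh[OF z(1)]])
    show "0 < min (z - u) (v - z)" using zuv by auto
    show "\<forall>y. \<bar>z - y\<bar> < min (z - u) (v - z) \<longrightarrow> h z \<le> h y"
      using z(2) by (auto simp: abs_less_iff)
  qed
  then show ?thesis using zuv by (intro bexI[of _ z]) (auto simp: e_def split: if_splits)
qed

text \<open>A derivative has the intermediate value property even where it is not known to be
  continuous, and consecutive powers of two are separated by gaps.\<close>

lemma derivative_power_of_two_constant:
  fixes D :: "real \<Rightarrow> real"
  assumes D: "\<And>x. x \<in> {u<..<v} \<Longrightarrow> (g has_real_derivative D x) (at x)"
    and pw: "\<And>x. x \<in> {u<..<v} \<Longrightarrow> \<exists>k::int. D x = 2 powi k"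
    and xy: "x \<in> {u<..<v}" "y \<in> {u<..<v}"
  shows "D x = D y"
proof -
  have less: False if st: "s \<in> {u<..<v}" "t \<in> {u<..<v}" "D s < D t" for s t
  proof -
    obtain i j :: int where ij: "D s = 2 powi i" "D t = 2 powi j" using pw[OF st(1)] pw[OF st(2)] by blast
    \<comment> \<open>strictly between \<open>2 powi (j - 1)\<close> and \<open>2 powi j\<close>, hence not a power of two\<close>
    define c :: real where "c = 3 * 2 powi (j - 2)"
    have "i < j"
    proof (rule ccontr)
      assume "\<not> i < j"
      then have "j \<le> i" by simp
      then have "(2::real) powi j \<le> 2 powi i" by (rule power_int_increasing) simp
      then show False using that(3) ij by simp
    qed
    then have "(2::real) powi i \<le> 2 powi (j - 1)" by (intro power_int_increasing) auto
    also have "\<dots> = 2 * 2 powi (j - 2)" using power_int_add[of "2::real" 1 "j - 2"] by simp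
    finally have "(2::real) powi i < c" unfolding c_def by (smt (verit) zero_less_power_int)
    moreover have "(2::real) powi j = 4 * 2 powi (j - 2)"
      using power_int_add[of "2::real" 2 "j - 2"] by simp
    then have "c < 2 powi j" unfolding c_def by (smt (verit) zero_less_power_int)
    moreover have "s \<noteq> t" using that by auto
    ultimately have c: "D s < c" "c < D t" "s < t \<or> t < s" using ij by auto
    have "\<exists>z\<in>{u<..<v}. D z = c"
    proof (cases "s < t")
      case True
      then have "\<exists>z\<in>{s<..<t}. D z = c"
        using D st c by (intro derivative_intermediate_value[of s t g]) auto
      then show ?thesis using st by force
    next
      case False
      then have "\<exists>z\<in>{t<..<s}. D z = c"
        using D st c by (intro derivative_intermediate_value[of t s g]) auto
      then show ?thesis using st by force
    qed
    then obtain z where z: "z \<in> {u<..<v}" "D z = c" by blast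
    obtain m :: int where m: "c = 2 powi m" using pw[of z] z by auto
    show False
    proof (cases "m \<ge> j")
      case True
      then have "(2::real) powi j \<le> 2 powi m" by (intro power_int_increasing) auto
      then show False using m \<open>c < 2 powi j\<close> by simp
    next
      case False
      then have "(2::real) powi m \<le> 2 powi (j - 1)" by (intro power_int_increasing) auto
      also have "\<dots> = 2 * 2 powi (j - 2)" using power_int_add[of "2::real" 1 "j - 2"] by simp
      also have "\<dots> < c" unfolding c_def by (smt (verit) zero_less_power_int)
      finally show False using m by simp
    qed
  qed
  show ?thesis
  proof (rule ccontr)
    assume "D x \<noteq> D y"
    then have "D x < D y \<or> D y < D x" by linarith
    then show False using less[OF xy] less[OF xy(2,1)] by blast
  qed
qed

lemma two_powr_of_int: "2 powr of_int k = (2::real) powi k"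
  by (simp add: powr_real_of_int' )

text \<open>Between neighbouring points of non-differentiability the slope is constant, and the mean
  value theorem makes \<open>g\<close> affine there. Right-continuity carries the formula to the
  left end \<open>x\<close>, which may itself be a break.\<close>

lemma thompsonV_breaks:
  assumes "g \<in> thompsonV"
  shows "\<exists>S. breaks g S"
proof -
  have right_cont: "\<And>x. x \<in> {0..<1} \<Longrightarrow> continuous (at_right x) g"
    and fin: "finite {x\<in>{0<..<1}. \<not> g differentiable (at x)}"
    and dy: "\<And>x. x \<in> {0<..<1} \<Longrightarrow> \<not> g differentiable (at x) \<Longrightarrow> dyadic_rat x"
    and slope: "\<And>x. x \<in> {0<..<1} \<Longrightarrow> g differentiable (at x) \<Longrightarrow>
      (\<exists>k::int. (g has_real_derivative 2 powr of_int k) (at x))"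
    using assms unfolding thompsonV_def by auto
  define S where "S = insert 0 {x\<in>{0<..<1}. \<not> g differentiable (at x)}"
  have "\<exists>k::int. \<forall>y\<in>{x..<1}. S \<inter> {x<..y} = {} \<longrightarrow> g y = g x + 2 powi k * (y - x)"
    if x: "x \<in> {0..<1}" for x
  proof -
    obtain q where q: "x < q" "q \<le> 1" "S \<inter> {x<..<q} = {}" "q \<in> S \<or> q = 1"
    proof (rule next_break[of S x])
      show "finite S" "S \<subseteq> {0..<1}" "x < 1" using fin x unfolding S_def by auto
    qed
    define D where "D = deriv g"
    have diff: "g differentiable (at y)" if "y \<in> {x<..<q}" for y
    proof (rule ccontr)
      assume "\<not> g differentiable (at y)"
      moreover have "y \<in> {0<..<1}" using that x q(2) by auto
      ultimately have "y \<in> S" unfolding S_def by blast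
      then show False using q(3) that by blast
    qed
    have D: "(g has_real_derivative D y) (at y)" "\<exists>k::int. D y = 2 powi k" if yq: "y \<in> {x<..<q}" for y
    proof -
      obtain k :: int where "(g has_real_derivative 2 powr of_int k) (at y)"
        using slope[of y] diff[OF yq] yq x q(2) by auto
      then show "(g has_real_derivative D y) (at y)" "\<exists>k::int. D y = 2 powi k"
        unfolding D_def two_powr_of_int by (auto simp: DERIV_imp_deriv)
    qed
    obtain k :: int where k: "D ((x + q) / 2) = 2 powi k" using D(2)[of "(x + q) / 2"] q(1) by auto
    have Dk: "D y = 2 powi k" if "y \<in> {x<..<q}" for y
      using derivative_power_of_two_constant[of x q g D y "(x + q) / 2"] D that q(1) k by auto
    have diff_eq: "g y = g z + 2 powi k * (y - z)" if "x < z" "z < y" "y < q" for y z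
    proof -
      have "\<exists>t>z. t < y \<and> g y - g z = (y - z) * D t"
        by (rule MVT2) (use D(1) that in auto)
      then obtain t where "t > z" "t < y" "g y - g z = (y - z) * D t" by blast
      then show ?thesis using Dk[of t] that by (simp add: algebra_simps)
    qed
    have aff: "g y = g x + 2 powi k * (y - x)" if y: "x < y" "y < q" for y
    proof -
      have "((\<lambda>z. g z + 2 powi k * (y - z)) \<longlongrightarrow> g x + 2 powi k * (y - x)) (at_right x)"
        using right_cont[OF x] by (auto intro!: tendsto_intros simp: continuous_within)
      moreover have "\<forall>\<^sub>F z in at_right x. g z + 2 powi k * (y - z) = g y"
        unfolding eventually_at_right_field using diff_eq y by (intro exI[of _ y]) auto
      ultimately have "((\<lambda>z. g y) \<longlongrightarrow> g x + 2 powi k * (y - x)) (at_right x)"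
        by (rule Lim_transform_eventually)
      then show ?thesis by (simp add: tendsto_const_iff)
    qed
    show ?thesis
    proof (intro exI[of _ k] ballI impI)
      fix y assume y: "y \<in> {x..<1}" "S \<inter> {x<..y} = {}"
      have "y < q" using q(4) q(1) y by force
      then show "g y = g x + 2 powi k * (y - x)" using aff[of y] y by (cases "y = x") auto
    qed
  qed
  then have "breaks g S"
    unfolding breaks_def using fin dy by (auto simp: S_def)
  then show ?thesis ..
qed

section \<open>Cyclic monotonicity and the group T\<close>

definition cyc :: "real \<Rightarrow> real \<Rightarrow> real \<Rightarrow> bool" where
  "cyc x y z \<longleftrightarrow> x < y \<and> y < z \<or> y < z \<and> z < x \<or> z < x \<and> x < y"

text \<open>Preservation of orientation on the circle. Having at most one discontinuity is not
  visibly stable under composition and inversion; preserving cyclic triples is, and for the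
  bijections considered here both conditions describe T (\<open>thompsonT_iff\<close>).\<close>

definition cyc_mono :: "(real \<Rightarrow> real) \<Rightarrow> bool" where
  "cyc_mono g \<longleftrightarrow>
     (\<forall>x\<in>{0..<1}. \<forall>y\<in>{0..<1}. \<forall>z\<in>{0..<1}. cyc x y z \<longrightarrow> cyc (g x) (g y) (g z))"

definition pl_circle :: "(real \<Rightarrow> real) \<Rightarrow> bool" where
  "pl_circle g \<longleftrightarrow> bij_betw g {0..<1} {0..<1} \<and> (\<forall>x. x \<notin> {0..<1} \<longrightarrow> g x = x) \<and>
     (\<exists>S. breaks g S) \<and> cyc_mono g"

lemma connected_disjoint_ordered:
  fixes A B :: "real set"
  assumes "connected A" "connected B" "A \<inter> B = {}"
  shows "(\<forall>a\<in>A. \<forall>b\<in>B. a < b) \<or> (\<forall>a\<in>A. \<forall>b\<in>B. b < a)"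
proof (rule ccontr)
  assume "\<not> ?thesis"
  then obtain a b a' b' where ab: "a \<in> A" "b \<in> B" "a' \<in> A" "b' \<in> B" "b \<le> a" "a' \<le> b'"
    by (meson not_less)
  show False
  proof (cases "b \<le> a'")
    case True
    then have "a' \<in> B" using connectedD_interval[OF assms(2) ab(2,4)] ab by blast
    then show False using assms ab by blast
  next
    case False
    then have "b \<in> A" using connectedD_interval[OF assms(1) ab(3,1)] ab by auto
    then show False using assms ab by blast
  qed
qed

text \<open>A continuous injection of an interval is monotone in one direction, and the positive
  slope just to the right of \<open>u\<close> excludes the decreasing one.\<close>

lemma breaks_strict_mono_on:
  assumes br: "breaks g S" and "inj_on g {u..<v}" and cont: "continuous_on {u..<v} g"
    and uv: "0 \<le> u" "v \<le> 1"
  shows "strict_mono_on {u..<v} g"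
proof (cases "u < v")
  case True
  have "is_interval {u..<v}" by (rule is_interval_co)
  then have "strict_mono_on {u..<v} g \<or> strict_antimono_on {u..<v} g"
    using injective_eq_monotone_map[OF _ cont] assms by blast
  moreover have "\<not> strict_antimono_on {u..<v} g"
  proof
    assume anti: "strict_antimono_on {u..<v} g"
    obtain k :: int and q where q: "u < q"
      "\<And>y. u \<le> y \<Longrightarrow> y < q \<Longrightarrow> g y = g u + 2 powi k * (y - u)"
      using breaks_affine[OF br uv(1)] uv True by (metis order_less_le_trans)
    define y where "y = (u + min q v) / 2"
    have y: "u < y" "y < q" "y < v" unfolding y_def using q(1) True by auto
    have "2 powi k * (y - u) > 0" using y by simp
    then have "g u < g y" using q(2)[of y] y by simp
    moreover have "g y < g u" using anti y unfolding monotone_on_def by auto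
    ultimately show False by simp
  qed
  ultimately show ?thesis by blast
qed (auto simp: monotone_on_def)

text \<open>The shape of a circle map that has been cut open at \<open>d\<close>: both branches
  increase, and the second one has wrapped around below the first.\<close>

lemma cyc_mono_two_pieces:
  assumes mono: "\<And>x y. 0 \<le> x \<Longrightarrow> x < y \<Longrightarrow> y < 1 \<Longrightarrow> y < d \<or> d \<le> x \<Longrightarrow> g x < g y"
    and dn: "\<And>x y. 0 \<le> x \<Longrightarrow> x < d \<Longrightarrow> d \<le> y \<Longrightarrow> y < 1 \<Longrightarrow> g y < g x"
  shows "cyc_mono g"
proof -
  have *: "cyc (g a) (g b) (g c)" if abc: "0 \<le> a" "a < b" "b < c" "c < 1" for a b c
  proof -
    consider "c < d" | "b < d" "d \<le> c" | "a < d" "d \<le> b" | "d \<le> a" by linarith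
    then show ?thesis
    proof cases
      case 1
      then have "g a < g b" "g b < g c" using mono abc by auto
      then show ?thesis by (simp add: cyc_def)
    next
      case 2
      then have "g a < g b" "g c < g a" using mono[of a b] dn[of a c] abc by auto
      then show ?thesis by (simp add: cyc_def)
    next
      case 3
      then have "g b < g c" "g c < g a" using mono[of b c] dn[of a c] abc by auto
      then show ?thesis by (simp add: cyc_def)
    next
      case 4
      then have "g a < g b" "g b < g c" using mono abc by auto
      then show ?thesis by (simp add: cyc_def)
    qed
  qed
  have rot: "cyc (g a) (g b) (g c) \<Longrightarrow> cyc (g b) (g c) (g a)" for a b c
    unfolding cyc_def by auto
  show ?thesis
    unfolding cyc_mono_def
  proof (intro ballI impI)
    fix x y z :: real
    assume xyz: "x \<in> {0..<1}" "y \<in> {0..<1}" "z \<in> {0..<1}" "cyc x y z"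
    then show "cyc (g x) (g y) (g z)"
      using *[of x y z] *[of y z x] *[of z x y] rot unfolding cyc_def[of x y z] by auto
  qed
qed

text \<open>Cut at the one possible discontinuity \<open>d\<close>. Both branches increase and their
  images are disjoint intervals, so one image lies entirely below the other; either arrangement
  preserves cyclic triples.\<close>

lemma thompsonT_cyc_mono:
  assumes g: "g \<in> thompsonT"
  shows "cyc_mono g"
proof -
  have gV: "g \<in> thompsonV" using g unfolding thompsonT_def by blast
  have bij: "bij_betw g {0..<1} {0..<1}"
    and rc: "\<And>x. x \<in> {0..<1} \<Longrightarrow> continuous (at_right x) g"
    using gV unfolding thompsonV_def by auto
  obtain S where br: "breaks g S" using thompsonV_breaks[OF gV] by blast
  obtain d where d: "d \<in> {0..<1}"
    and dc: "\<And>x. x \<in> {0..<1} \<Longrightarrow> x \<noteq> d \<Longrightarrow> continuous (at x within {0..<1}) g"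
  proof (cases "\<exists>d\<in>{0..<1}. \<not> continuous (at d within {0..<1}) g")
    case True
    then show ?thesis using that g unfolding thompsonT_def by blast
  next
    case False
    \<comment> \<open>Without a discontinuity the cut is made at 0, and the branch on
      \<open>{0..<d}\<close> is empty.\<close>
    then show ?thesis using that[of 0] by auto
  qed
  have c1: "continuous_on {0..<d} g"
    unfolding continuous_on_eq_continuous_within
  proof
    fix x assume "x \<in> {0..<d}"
    then show "continuous (at x within {0..<d}) g"
      using d by (intro continuous_within_subset[OF dc]) auto
  qed
  have c2: "continuous_on {d..<1} g"
    unfolding continuous_on_eq_continuous_within
  proof
    fix x assume x: "x \<in> {d..<1}"
    show "continuous (at x within {d..<1}) g"
    proof (cases "x = d")
      case True
      have "(g \<longlongrightarrow> g d) (at_right d)" using rc[OF d] by (simp add: continuous_within)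
      then have "(g \<longlongrightarrow> g d) (at d within {d..<1})"
        by (rule tendsto_mono[rotated])
          (unfold at_within_def, rule inf_mono, auto)
      then show ?thesis using True by (simp add: continuous_within)
    next
      case False
      then show ?thesis using d x by (intro continuous_within_subset[OF dc]) auto
    qed
  qed
  have inj: "inj_on g {0..<1}" using bij by (rule bij_betw_imp_inj_on)
  have "inj_on g {0..<d}" "inj_on g {d..<1}"
    using d by (auto intro: inj_on_subset[OF inj])
  then have m1: "strict_mono_on {0..<d} g" and m2: "strict_mono_on {d..<1} g"
    using breaks_strict_mono_on[OF br _ c1] breaks_strict_mono_on[OF br _ c2] d by simp_all
  have "connected (g ` {0..<d})" "connected (g ` {d..<1})"
    using c1 c2 by (auto intro!: connected_continuous_image)
  moreover have "g ` {0..<d} \<inter> g ` {d..<1} = {}"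
    using inj_on_image_Int[OF inj, of "{0..<d}" "{d..<1}"] d by auto
  ultimately have ord: "(\<forall>a\<in>g ` {0..<d}. \<forall>b\<in>g ` {d..<1}. a < b) \<or>
      (\<forall>a\<in>g ` {0..<d}. \<forall>b\<in>g ` {d..<1}. b < a)"
    by (rule connected_disjoint_ordered)
  have mono: "g x < g y" if "0 \<le> x" "x < y" "y < 1" "y < d \<or> d \<le> x" for x y
    using that m1 m2 by (auto simp: monotone_on_def)
  have ord': "(\<forall>x y. 0 \<le> x \<longrightarrow> x < d \<longrightarrow> d \<le> y \<longrightarrow> y < 1 \<longrightarrow> g x < g y) \<or>
      (\<forall>x y. 0 \<le> x \<longrightarrow> x < d \<longrightarrow> d \<le> y \<longrightarrow> y < 1 \<longrightarrow> g y < g x)"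
    using ord by auto
  show ?thesis
    unfolding cyc_mono_def
  proof (intro ballI impI)
    fix x y z :: real
    assume xyz: "x \<in> {0..<1}" "y \<in> {0..<1}" "z \<in> {0..<1}" "cyc x y z"
    show "cyc (g x) (g y) (g z)"
      using ord'
    proof
      assume up: "\<forall>x y. 0 \<le> x \<longrightarrow> x < d \<longrightarrow> d \<le> y \<longrightarrow> y < 1 \<longrightarrow> g x < g y"
      have "g a < g b" if "0 \<le> a" "a < b" "b < 1" for a b
        using that up mono[of a b] by (meson not_le)
      then show ?thesis using xyz unfolding cyc_def by auto
    next
      assume dn: "\<forall>x y. 0 \<le> x \<longrightarrow> x < d \<longrightarrow> d \<le> y \<longrightarrow> y < 1 \<longrightarrow> g y < g x"
      have "cyc_mono g" by (rule cyc_mono_two_pieces[of d]) (use mono dn in blast)+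
      then show ?thesis using xyz unfolding cyc_mono_def by blast
    qed
  qed
qed

lemma thompsonT_imp_pl_circle:
  assumes g: "g \<in> thompsonT"
  shows "pl_circle g"
proof -
  have gV: "g \<in> thompsonV" using g unfolding thompsonT_def by blast
  then show ?thesis using thompsonV_breaks[OF gV] thompsonT_cyc_mono[OF g]
    unfolding pl_circle_def thompsonV_def by blast
qed

section \<open>From piecewise affine, cyclically monotone bijections back to the analytic definition
  of T\<close>

lemma breaks_right_cont:
  assumes br: "breaks g S" and x: "x \<in> {0..<1}"
  shows "continuous (at_right x) g"
proof -
  obtain k :: int and q where q: "x < q"
      "\<And>y. x \<le> y \<Longrightarrow> y < q \<Longrightarrow> g y = g x + 2 powi k * (y - x)"
    using breaks_affine[OF br, of x] x by (metis atLeastLessThan_iff)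
  have "((\<lambda>y. g x + 2 powi k * (y - x)) \<longlongrightarrow> g x + 2 powi k * (x - x)) (at_right x)"
    by (intro tendsto_intros)
  moreover have "\<forall>\<^sub>F y in at_right x. g x + 2 powi k * (y - x) = g y"
    unfolding eventually_at_right_field
  proof (intro exI[of _ q] conjI allI impI q(1))
    fix y assume "x < y" "y < q"
    then show "g x + 2 powi k * (y - x) = g y" using q(2)[of y] by simp
  qed
  ultimately have "(g \<longlongrightarrow> g x + 2 powi k * (x - x)) (at_right x)"
    by (rule Lim_transform_eventually)
  then show ?thesis by (simp add: continuous_within)
qed

lemma breaks_differentiable:
  assumes br: "breaks g S" and x: "x \<in> {0<..<1}" "x \<notin> S"
  shows "g differentiable (at x)"
proof -
  have S: "finite S" "0 \<in> S" "S \<subseteq> {0..<1}" using br unfolding breaks_def by auto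
  obtain p where p: "p \<in> S" "p \<le> x" "S \<inter> {p<..x} = {}"
    using prev_break[of S x] S x by auto
  have p01: "0 \<le> p" "p < 1" using p S by auto
  obtain k :: int and q where q: "p < q" "q \<le> 1" "S \<inter> {p<..<q} = {}" "q \<in> S \<or> q = 1"
      "\<And>y. p \<le> y \<Longrightarrow> y < q \<Longrightarrow> g y = g p + 2 powi k * (y - p)"
    using breaks_affine[OF br p01] by metis
  have "p < x" using p x by (cases "p = x") auto
  have "x < q"
  proof (rule ccontr)
    assume "\<not> x < q"
    then have "q \<in> S \<inter> {p<..x}" using q(1,4) x by auto
    then show False using p(3) by blast
  qed
  have "((\<lambda>y. g p + 2 powi k * (y - p)) has_real_derivative 2 powi k) (at x)"
    by (auto intro!: derivative_eq_intros)
  then have "(g has_real_derivative 2 powi k) (at x)"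
  proof (rule has_field_derivative_transform_within_open[of _ _ _ "{p<..<q}"])
    show "g p + 2 powi k * (y - p) = g y" if "y \<in> {p<..<q}" for y
      using q(5)[of y] that by auto
  qed (use \<open>p < x\<close> \<open>x < q\<close> in auto)
  then show ?thesis using real_differentiable_def by blast
qed

text \<open>The derivative, where it exists, equals the right-hand slope, and this is a power of two
  at breaks as well; so breaks at which \<open>g\<close> happens to be differentiable need no
  separate treatment.\<close>

lemma breaks_derivative:
  assumes br: "breaks g S" and x: "x \<in> {0<..<1}" and diff: "g differentiable (at x)"
  shows "\<exists>k::int. (g has_real_derivative 2 powr of_int k) (at x)"
proof -
  obtain D where D: "(g has_real_derivative D) (at x)"
    using diff real_differentiable_def by blast
  obtain k :: int and q where q: "x < q"
      "\<And>y. x \<le> y \<Longrightarrow> y < q \<Longrightarrow> g y = g x + 2 powi k * (y - x)"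
    using breaks_affine[OF br, of x] x by (metis greaterThanLessThan_iff less_eq_real_def)
  have "((\<lambda>y. (g y - g x) / (y - x)) \<longlongrightarrow> D) (at_right x)"
    using D unfolding has_field_derivative_iff by (rule tendsto_mono[rotated]) (simp add: at_le)
  moreover have "\<forall>\<^sub>F y in at_right x. (g y - g x) / (y - x) = 2 powi k"
    unfolding eventually_at_right_field
  proof (intro exI[of _ q] conjI allI impI q(1))
    fix y assume "x < y" "y < q"
    then show "(g y - g x) / (y - x) = 2 powi k" using q(2)[of y] by simp
  qed
  ultimately have "((\<lambda>y. 2 powi k) \<longlongrightarrow> D) (at_right x)"
    by (rule Lim_transform_eventually)
  then have "D = 2 powi k" by (simp add: tendsto_const_iff)
  then show ?thesis using D by (auto simp: two_powr_of_int)
qed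

lemma breaks_piecewise_affine:
  assumes br: "breaks g S" and ab: "a < b" "{a<..<b} \<subseteq> {0<..<1} - S"
  shows "\<exists>m c. \<forall>x\<in>{a<..<b}. g x = m * x + c"
proof -
  have S: "finite S" "0 \<in> S" "S \<subseteq> {0..<1}" using br unfolding breaks_def by auto
  have "a \<ge> 0"
  proof (rule ccontr)
    assume "\<not> a \<ge> 0"
    then have "min (a/2) ((a + b) / 2) \<in> {a<..<b}" "min (a/2) ((a + b) / 2) < 0" using ab(1) by (auto simp: min_def)
    then show False using ab(2) by fastforce
  qed
  obtain p where p: "p \<in> S" "p \<le> a" "S \<inter> {p<..a} = {}"
    using prev_break[of S a] S \<open>a \<ge> 0\<close> by auto
  obtain j :: int where j: "\<forall>y\<in>{p..<1}. S \<inter> {p<..y} = {} \<longrightarrow> g y = g p + 2 powi j * (y - p)"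
    using br p S unfolding breaks_def by force
  show ?thesis
  proof (intro exI ballI)
    fix x assume x: "x \<in> {a<..<b}"
    have "S \<inter> {p<..x} = {}"
    proof -
      have "s \<le> a \<or> s \<in> {a<..<b}" if "s \<le> x" for s using x that by auto
      then show ?thesis using p(3) ab(2) by fastforce
    qed
    moreover have "x < 1" using x ab(2) by fastforce
    ultimately have "g x = g p + 2 powi j * (x - p)" using bspec[OF j, of x] x p by auto
    then show "g x = 2 powi j * x + (g p - 2 powi j * p)" by (simp add: algebra_simps)
  qed
qed

text \<open>A jump can occur only where the value wraps around to 0. Cyclic triples through
  \<open>e\<close> show that \<open>g\<close> increases on both sides of \<open>e\<close>;
  surjectivity makes the images of the two open branches open intervals, and a monotone map onto an
  open interval is continuous. At 0 continuity within \<open>{0..<1}\<close> is one-sided.\<close>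

lemma pl_circle_continuous:
  assumes g: "pl_circle g" and e: "e \<in> {0..<1}" "g e = 0" and x: "x \<in> {0..<1}" "x \<noteq> e"
  shows "continuous (at x within {0..<1}) g"
proof (cases "x = 0")
  case True
  obtain S where "breaks g S" using g unfolding pl_circle_def by blast
  then have "(g \<longlongrightarrow> g 0) (at_right 0)"
    using breaks_right_cont[of g S 0] by (simp add: continuous_within)
  then have "(g \<longlongrightarrow> g 0) (at 0 within {0..<1})"
    by (rule tendsto_mono[rotated])
          (unfold at_within_def, rule inf_mono, auto)
  then show ?thesis using True by (simp add: continuous_within)
next
  case False
  have bij: "bij_betw g {0..<1} {0..<1}" and cy: "cyc_mono g"
    using g unfolding pl_circle_def by auto
  have range: "0 \<le> g y \<and> g y < 1" if "0 \<le> y" "y < 1" for y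
    using bij_betwE[OF bij] that by auto
  have surj: "\<exists>y. 0 \<le> y \<and> y < 1 \<and> g y = w" if "0 \<le> w" "w < 1" for w
    using bij_betw_imp_surj_on[OF bij] that by (metis atLeastLessThan_iff imageE)
  have inj: "y = z" if "0 \<le> y" "y < 1" "0 \<le> z" "z < 1" "g y = g z" for y z
    using bij_betw_imp_inj_on[OF bij] that by (auto dest: inj_onD)
  have cyD: "cyc (g a) (g b) (g c)"
    if "0 \<le> a" "a < 1" "0 \<le> b" "b < 1" "0 \<le> c" "c < 1" "cyc a b c" for a b c
    using cy that unfolding cyc_mono_def by auto
  have pos: "0 < g y" if "0 \<le> y" "y < 1" "y \<noteq> e" for y
    using range[of y] inj[of y e] that e by force
  have m1: "g a < g b" if "0 \<le> a" "a < b" "b < e" for a b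
    using cyD[of e a b] that e pos[of a] pos[of b] unfolding cyc_def by auto
  have m2: "g a < g b" if "e < a" "a < b" "b < 1" for a b
    using cyD[of e a b] that e pos[of a] pos[of b] unfolding cyc_def by auto
  have m3: "g b < g a" if "0 \<le> a" "a < e" "e < b" "b < 1" for a b
    using cyD[of a e b] that e pos[of a] pos[of b] unfolding cyc_def by auto
  have eq1: "g ` {0<..<e} = {g 0<..<1}" if "e > 0"
  proof
    show "g ` {0<..<e} \<subseteq> {g 0<..<1}" using m1[of 0] range e by auto
    show "{g 0<..<1} \<subseteq> g ` {0<..<e}"
    proof
      fix w assume w: "w \<in> {g 0<..<1}"
      then obtain y where y: "0 \<le> y" "y < 1" "g y = w" using surj[of w] range[of 0] by force
      have "y \<noteq> 0" "y \<noteq> e" "\<not> e < y" using y w e range[of 0] m3[of 0 y] that by auto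
      then show "w \<in> g ` {0<..<e}" using y by auto
    qed
  qed
  have eq2: "g ` {e<..<1} = {0<..<(if e > 0 then g 0 else 1)}"
  proof
    show "g ` {e<..<1} \<subseteq> {0<..<(if e > 0 then g 0 else 1)}" using m3[of 0] pos range e by auto
    show "{0<..<(if e > 0 then g 0 else 1)} \<subseteq> g ` {e<..<1}"
    proof
      fix w assume w: "w \<in> {0<..<(if e > 0 then g 0 else 1)}"
      then have "w < 1" using range[of 0] by (auto split: if_splits)
      then obtain y where y: "0 \<le> y" "y < 1" "g y = w" using surj[of w] w by force
      have "y \<noteq> e" using y w e by auto
      moreover have "\<not> y < e" using y w m1[of 0 y] by (cases "y = 0") (auto split: if_splits)
      ultimately show "w \<in> g ` {e<..<1}" using y by auto
    qed
  qed
  have "isCont g x"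
  proof (cases "x < e")
    case True
    have "continuous_on {0<..<e} g"
      using eq1 True x m1 by (intro continuous_onI_mono) (auto simp: less_eq_real_def)
    then show ?thesis using True False x by (simp add: continuous_on_eq_continuous_at)
  next
    case False
    have "continuous_on {e<..<1} g"
      using eq2 m2 by (intro continuous_onI_mono) (auto simp: less_eq_real_def)
    then show ?thesis using False x by (simp add: continuous_on_eq_continuous_at)
  qed
  then show ?thesis by (rule continuous_at_imp_continuous_at_within)
qed

lemma pl_circle_imp_thompsonT:
  assumes g: "pl_circle g"
  shows "g \<in> thompsonT"
proof -
  have bij: "bij_betw g {0..<1} {0..<1}" and off: "\<forall>x. x \<notin> {0..<1} \<longrightarrow> g x = x"
    using g unfolding pl_circle_def by auto
  obtain S where br: "breaks g S" using g unfolding pl_circle_def by blast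
  have S: "finite S" "\<And>s. s \<in> S \<Longrightarrow> dyadic_rat s" using br unfolding breaks_def by auto
  have sub: "{x\<in>{0<..<1}. \<not> g differentiable (at x)} \<subseteq> S"
    using breaks_differentiable[OF br] by blast
  have "g \<in> thompsonV"
    unfolding thompsonV_def
  proof (intro CollectI conjI bij off)
    show "\<forall>x\<in>{0..<1}. continuous (at_right x) g" using breaks_right_cont[OF br] by blast
    show "\<exists>S. finite S \<and> (\<forall>a b. a < b \<longrightarrow> {a<..<b} \<subseteq> {0<..<1} - S \<longrightarrow>
        (\<exists>m c. \<forall>x\<in>{a<..<b}. g x = m * x + c))"
      using S(1) breaks_piecewise_affine[OF br] by blast
    show "finite {x\<in>{0<..<1}. \<not> g differentiable (at x)}" using sub S(1) by (rule finite_subset)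
    show "\<forall>x\<in>{0<..<1}. \<not> g differentiable (at x) \<longrightarrow> dyadic_rat x" using sub S(2) by blast
    show "\<forall>x\<in>{0<..<1}. g differentiable (at x) \<longrightarrow>
        (\<exists>k::int. (g has_real_derivative 2 powr of_int k) (at x))"
      using breaks_derivative[OF br] by blast
  qed
  moreover obtain e where e: "e \<in> {0..<1}" "g e = 0"
    using bij_betw_imp_surj_on[OF bij] by (metis atLeastLessThan_iff imageE order_refl zero_less_one)
  ultimately show ?thesis
    unfolding thompsonT_def using pl_circle_continuous[OF g e] by blast
qed

lemma thompsonT_iff: "g \<in> thompsonT \<longleftrightarrow> pl_circle g"
  using thompsonT_imp_pl_circle pl_circle_imp_thompsonT by blast

section \<open>The group structure of T\<close>

lemma bij_if_bij_betw_id_off: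
  assumes "bij_betw g A A" "\<forall>x. x \<notin> A \<longrightarrow> g x = x"
  shows "bij g"
proof -
  have "bij_betw g (- A) (- A)"
    using assms(2) bij_betw_cong[of "-A" g id "-A"] bij_betw_id[of "-A"] by (simp add: id_def)
  then have "bij_betw g (A \<union> - A) (A \<union> - A)"
    using assms(1) by (intro bij_betw_combine) auto
  then show ?thesis by simp
qed

lemma pl_circle_comp:
  assumes f: "pl_circle f" and g: "pl_circle g"
  shows "pl_circle (f \<circ> g)"
proof -
  have bf: "bij_betw f {0..<1} {0..<1}" and bg: "bij_betw g {0..<1} {0..<1}"
    using f g unfolding pl_circle_def by auto
  obtain A where A: "breaks f A" using f unfolding pl_circle_def by blast
  obtain B where B: "breaks g B" using g unfolding pl_circle_def by blast
  have Af: "finite A" "\<And>s. s \<in> A \<Longrightarrow> dyadic_rat s" using A unfolding breaks_def by auto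
  have Bf: "finite B" "0 \<in> B" "B \<subseteq> {0..<1}" "\<And>s. s \<in> B \<Longrightarrow> dyadic_rat s" using B unfolding breaks_def by auto
  have range: "g x \<in> {0..<1}" if "x \<in> {0..<1}" for x using bij_betwE[OF bg] that by blast
  define C where "C = B \<union> (g -` A \<inter> {0..<1})"
  have "breaks (f \<circ> g) C"
    unfolding breaks_def
  proof (intro conjI ballI)
    show "finite C" unfolding C_def using Af Bf bij_betw_imp_inj_on[OF bg] by (simp add: finite_vimage_IntI)
    show "0 \<in> C" "C \<subseteq> {0..<1}" using Bf unfolding C_def by auto
    fix s assume "s \<in> C"
    then show "dyadic_rat s"
      using Bf(4) Af(2) breaks_dyadic_iff[OF B bg] unfolding C_def by blast
  next
    fix x :: real assume x: "x \<in> {0..<1}"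
    obtain k :: int where k: "\<forall>y\<in>{x..<1}. B \<inter> {x<..y} = {} \<longrightarrow> g y = g x + 2 powi k * (y - x)"
      using B x unfolding breaks_def by blast
    obtain j :: int where j: "\<forall>z\<in>{g x..<1}. A \<inter> {g x<..z} = {} \<longrightarrow> f z = f (g x) + 2 powi j * (z - g x)"
      using A range[OF x] unfolding breaks_def by blast
    show "\<exists>k::int. \<forall>y\<in>{x..<1}. C \<inter> {x<..y} = {} \<longrightarrow> (f \<circ> g) y = (f \<circ> g) x + 2 powi k * (y - x)"
    proof (intro exI[of _ "j + k"] ballI impI)
      fix y assume y: "y \<in> {x..<1}" "C \<inter> {x<..y} = {}"
      have aff: "g t = g x + 2 powi k * (t - x)" if "x \<le> t" "t \<le> y" for t
      proof -
        have "B \<inter> {x<..t} = {}" using y that unfolding C_def by force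
        then show ?thesis using bspec[OF k, of t] that y by auto
      qed
      have gy: "g y = g x + 2 powi k * (y - x)" using aff[of y] y by auto
      then have "g x \<le> g y" using y by auto
      \<comment> \<open>On this interval \<open>g\<close> is affine and takes every value between
        \<open>g x\<close> and \<open>g y\<close>, so a break of \<open>f\<close> there would pull
        back to a point of \<open>C\<close> in \<open>{x<..y}\<close>.\<close>
      have "A \<inter> {g x<..g y} = {}"
      proof (rule ccontr)
        assume "A \<inter> {g x<..g y} \<noteq> {}"
        then obtain a where a: "a \<in> A" "g x < a" "a \<le> g y" by auto
        define t where "t = x + (a - g x) / 2 powi k"
        have t: "x < t" "t \<le> y" using a gy unfolding t_def by (auto simp: field_simps)
        have "g t = a" using aff[of t] t unfolding t_def by simp
        then have "t \<in> C" using a t x y unfolding C_def by auto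
        then show False using y t by auto
      qed
      then have "f (g y) = f (g x) + 2 powi j * (g y - g x)"
        using bspec[OF j, of "g y"] \<open>g x \<le> g y\<close> range[of y] x y by auto
      then show "(f \<circ> g) y = (f \<circ> g) x + 2 powi (j + k) * (y - x)"
        using gy by (simp add: power_int_add)
    qed
  qed
  moreover have "cyc_mono (f \<circ> g)"
    using f g range unfolding pl_circle_def cyc_mono_def comp_def by blast
  moreover have "bij_betw (f \<circ> g) {0..<1} {0..<1}" using bg bf by (rule bij_betw_trans)
  moreover have "\<forall>x. x \<notin> {0..<1} \<longrightarrow> (f \<circ> g) x = x"
    using f g unfolding pl_circle_def by auto
  ultimately show ?thesis unfolding pl_circle_def by blast
qed

text \<open>Three distinct points have exactly two cyclic orders; if \<open>h\<close> produced the
  wrong one, applying \<open>g\<close> would reverse the order of \<open>x\<close>,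
  \<open>y\<close>, \<open>z\<close>.\<close>

lemma cyc_mono_inverse:
  assumes bij: "bij_betw g {0..<1} {0..<1}" and cy: "cyc_mono g"
    and h: "\<And>y. y \<in> {0..<1} \<Longrightarrow> h y \<in> {0..<1} \<and> g (h y) = y"
  shows "cyc_mono h"
  unfolding cyc_mono_def
proof (intro ballI impI)
  fix x y z :: real
  assume xyz: "x \<in> {0..<1}" "y \<in> {0..<1}" "z \<in> {0..<1}" "cyc x y z"
  have "x \<noteq> y" "y \<noteq> z" "x \<noteq> z" using xyz(4) unfolding cyc_def by auto
  then have ne: "h x \<noteq> h y" "h y \<noteq> h z" "h x \<noteq> h z" using h xyz by metis+
  show "cyc (h x) (h y) (h z)"
  proof (rule ccontr)
    assume "\<not> cyc (h x) (h y) (h z)"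
    then have "cyc (h x) (h z) (h y)" using ne unfolding cyc_def by linarith
    then have "cyc (g (h x)) (g (h z)) (g (h y))"
      using cy h xyz unfolding cyc_mono_def by blast
    then have "cyc x z y" using h xyz by simp
    then show False using xyz(4) unfolding cyc_def by linarith
  qed
qed

text \<open>The inverse of an affine piece is affine, and by \<open>breaks_piece_end\<close> the
  image of a piece ends at 1 or at the image of a break. So the images of the breaks, with 0 added,
  serve as breaks of the inverse.\<close>

lemma pl_circle_inv:
  assumes g: "pl_circle g"
  shows "pl_circle (inv g)"
proof -
  have bg: "bij_betw g {0..<1} {0..<1}" and off: "\<forall>x. x \<notin> {0..<1} \<longrightarrow> g x = x" and cy: "cyc_mono g"
    using g unfolding pl_circle_def by auto
  obtain S where S: "breaks g S" using g unfolding pl_circle_def by blast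
  have Sf: "finite S" "S \<subseteq> {0..<1}" using S unfolding breaks_def by auto
  have bij: "bij g" using bij_if_bij_betw_id_off[OF bg off] .
  have inv1: "inv g (g x) = x" for x using bij by (simp add: bij_is_inj)
  have inv2: "g (inv g x) = x" for x using bij by (simp add: bij_is_surj surj_f_inv_f)
  have range: "g x \<in> {0..<1}" if "x \<in> {0..<1}" for x using bij_betwE[OF bg] that by blast
  have irange: "inv g x \<in> {0..<1}" if "x \<in> {0..<1}" for x
    using bij_betw_imp_surj_on[OF bg] that inv1 by (metis imageE)
  have bi: "bij_betw (inv g) {0..<1} {0..<1}"
    using range irange inv1 inv2 by (intro bij_betw_byWitness[where f' = g]) auto
  define C where "C = insert 0 (g ` S)"
  have "breaks (inv g) C"
    unfolding breaks_def
  proof (intro conjI ballI)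
    show "finite C" "0 \<in> C" "C \<subseteq> {0..<1}" using Sf range unfolding C_def by auto
    fix s assume "s \<in> C"
    then show "dyadic_rat s" using breaks_image_dyadic[OF S bg] unfolding C_def by auto
  next
    fix y :: real assume y: "y \<in> {0..<1}"
    define x where "x = inv g y"
    have x: "0 \<le> x" "x < 1" "g x = y" using irange[OF y] inv2 unfolding x_def by auto
    obtain k :: int and q where q: "x < q" "q \<le> 1" "q \<in> S \<or> q = 1"
      "\<And>t. x \<le> t \<Longrightarrow> t < q \<Longrightarrow> g t = g x + 2 powi k * (t - x)"
      using breaks_affine[OF S x(1,2)] by metis
    define w where "w = g x + 2 powi k * (q - x)"
    have w: "w \<le> 1" "w \<noteq> 1 \<Longrightarrow> w \<in> g ` S"
      using breaks_piece_end[OF S bg x(1) q] unfolding w_def by blast+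
    have "y < w" using x(3) q(1) unfolding w_def by simp
    show "\<exists>k::int. \<forall>z\<in>{y..<1}. C \<inter> {y<..z} = {} \<longrightarrow> inv g z = inv g y + 2 powi k * (z - y)"
    proof (intro exI[of _ "-k"] ballI impI)
      fix z assume z: "z \<in> {y..<1}" "C \<inter> {y<..z} = {}"
      have "z < w"
      proof (rule ccontr)
        assume "\<not> z < w"
        then have "w \<in> C \<inter> {y<..z}" using w z \<open>y < w\<close> unfolding C_def by auto
        then show False using z by blast
      qed
      define t where "t = x + (z - y) / 2 powi k"
      have "x \<le> t" using z unfolding t_def by auto
      moreover have "t < q" using \<open>z < w\<close> x(3) unfolding t_def w_def by (simp add: field_simps)
      ultimately have "g t = z" using q(4)[of t] x(3) unfolding t_def by simp
      then have "inv g z = t" using inv1 by blast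
      then show "inv g z = inv g y + 2 powi - k * (z - y)"
        unfolding t_def x_def by (simp add: power_int_minus field_simps)
    qed
  qed
  moreover have "cyc_mono (inv g)" using cyc_mono_inverse[OF bg cy] irange inv2 by blast
  moreover have "\<forall>x. x \<notin> {0..<1} \<longrightarrow> inv g x = x" using off inv1 by metis
  ultimately show ?thesis using bi unfolding pl_circle_def by blast
qed

lemma thompsonT_comp: "f \<in> thompsonT \<Longrightarrow> g \<in> thompsonT \<Longrightarrow> f \<circ> g \<in> thompsonT"
  using pl_circle_comp by (simp add: thompsonT_iff)

lemma thompsonT_inv: "g \<in> thompsonT \<Longrightarrow> inv g \<in> thompsonT"
  using pl_circle_inv by (simp add: thompsonT_iff)

lemma thompsonT_bij: "g \<in> thompsonT \<Longrightarrow> bij g"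
  using bij_if_bij_betw_id_off unfolding thompsonT_iff pl_circle_def by blast

lemma thompsonT_range: "g \<in> thompsonT \<Longrightarrow> x \<in> {0..<1} \<Longrightarrow> g x \<in> {0..<1}"
  unfolding thompsonT_iff pl_circle_def using bij_betwE by blast

lemma thompsonT_right_affine:
  assumes "g \<in> thompsonT" "x \<in> {0..<1}"
  obtains k :: int and d where "d > 0" "x + d \<le> 1"
    "\<And>y. x \<le> y \<Longrightarrow> y < x + d \<Longrightarrow> g y = g x + 2 powi k * (y - x)"
proof -
  obtain S where "breaks g S" using assms unfolding thompsonT_iff pl_circle_def by blast
  then obtain k :: int and q where q: "x < q" "q \<le> 1"
      "\<And>y. x \<le> y \<Longrightarrow> y < q \<Longrightarrow> g y = g x + 2 powi k * (y - x)"
    using breaks_affine[of g S x] assms(2) by (metis atLeastLessThan_iff)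
  show ?thesis
  proof (rule that[of "q - x" k])
    show "g y = g x + 2 powi k * (y - x)" if "x \<le> y" "y < x + (q - x)" for y
      using q(3)[OF that(1)] that(2) by auto
  qed (use q(1,2) in auto)
qed

lemma thompsonT_id: "id \<in> thompsonT"
proof -
  have "breaks id {0}"
    unfolding breaks_def by (auto intro!: exI[of _ "0::int"])
  then show ?thesis unfolding thompsonT_iff pl_circle_def cyc_mono_def by auto
qed

section \<open>The quarter rotation and one contracting element of F\<close>

definition rot :: "real \<Rightarrow> real" where
  "rot x = (if 0 \<le> x \<and> x < 3/4 then x + 1/4 else if 3/4 \<le> x \<and> x < 1 then x - 3/4 else x)"

text \<open>The slopes are 1/2, 2 and 1. Halving on \<open>{0..<1/2}\<close> makes powers contract
  towards 0; fixing the last quarter confines the support to a proper arc, which conjugation can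
  make arbitrarily short.\<close>

definition contr :: "real \<Rightarrow> real" where
  "contr x = (if 0 \<le> x \<and> x < 1/2 then x / 2 else if 1/2 \<le> x \<and> x < 3/4 then 2 * x - 3/4 else x)"

lemma dyadic_half: "dyadic_rat (1/2)"
  unfolding dyadic_rat_def by (intro exI[of _ 1] exI[of _ 1]) simp

lemma dyadic_three_quarters: "dyadic_rat (3/4)"
  unfolding dyadic_rat_def by (intro exI[of _ 3] exI[of _ 2]) simp

lemma rot_thompsonT: "rot \<in> thompsonT"
proof -
  have "bij_betw rot {0..<1} {0..<1}"
    by (rule bij_betw_byWitness[where f' = "\<lambda>x. if x < 1/4 then x + 3/4 else x - 1/4"])
      (auto simp: rot_def)
  moreover have "breaks rot {0, 3/4}"
    unfolding breaks_def
  proof (intro conjI ballI)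
    fix x :: real assume x: "x \<in> {0..<1}"
    show "\<exists>k::int. \<forall>y\<in>{x..<1}. {0, 3/4} \<inter> {x<..y} = {} \<longrightarrow> rot y = rot x + 2 powi k * (y - x)"
      using x by (intro exI[of _ 0]) (auto simp: rot_def)
  next
    fix s :: real assume "s \<in> {0, 3/4}"
    then show "dyadic_rat s" using dyadic_three_quarters dyadic_rat_0 by blast
  qed auto
  moreover have "cyc_mono rot"
    by (rule cyc_mono_two_pieces[of "3/4"]) (auto simp: rot_def)
  moreover have "\<forall>x. x \<notin> {0..<1} \<longrightarrow> rot x = x" by (auto simp: rot_def)
  ultimately show ?thesis unfolding thompsonT_iff pl_circle_def by blast
qed

lemma contr_thompsonT: "contr \<in> thompsonT"
proof -
  have "bij_betw contr {0..<1} {0..<1}"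
    by (rule bij_betw_byWitness[where f' = "\<lambda>x. if x < 1/4 then 2 * x else if x < 3/4 then x / 2 + 3/8 else x"])
      (auto simp: contr_def field_simps)
  moreover have "breaks contr {0, 1/2, 3/4}"
    unfolding breaks_def
  proof (intro conjI ballI)
    fix x :: real assume x: "x \<in> {0..<1}"
    show "\<exists>k::int. \<forall>y\<in>{x..<1}. {0, 1/2, 3/4} \<inter> {x<..y} = {} \<longrightarrow> contr y = contr x + 2 powi k * (y - x)"
      using x by (intro exI[of _ "if x < 1/2 then -1 else if x < 3/4 then 1 else 0"])
        (auto simp: contr_def field_simps)
  next
    fix s :: real assume "s \<in> {0, 1/2, 3/4}"
    then show "dyadic_rat s" using dyadic_three_quarters dyadic_half dyadic_rat_0 by blast
  qed auto
  moreover have "cyc_mono contr"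
  proof -
    have "contr x < contr y" if "0 \<le> x" "x < y" "y < 1" for x y
      using that unfolding contr_def by auto
    then show ?thesis unfolding cyc_mono_def cyc_def by auto
  qed
  moreover have "\<forall>x. x \<notin> {0..<1} \<longrightarrow> contr x = x" by (auto simp: contr_def)
  ultimately show ?thesis unfolding thompsonT_iff pl_circle_def by blast
qed

section \<open>Square-summable families and bounded operators\<close>

text \<open>Vectors are also restricted to sets of cosets outside of which they do not vanish, so
  that membership in \<open>ell2 E\<close> would ask too much.\<close>

abbreviation square_summable :: "'x set \<Rightarrow> ('x \<Rightarrow> complex) \<Rightarrow> bool" where
  "square_summable E f \<equiv> (\<lambda>x. (cmod (f x))\<^sup>2) summable_on E"

lemma l2norm_nonneg [simp]: "0 \<le> l2norm E f"
  unfolding l2norm_def by (simp add: infsum_nonneg)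

lemma l2norm_sq: "(l2norm E f)\<^sup>2 = infsum (\<lambda>x. (cmod (f x))\<^sup>2) E"
  unfolding l2norm_def by (simp add: infsum_nonneg)

lemma sum_squares_le_l2norm:
  assumes "square_summable E f" "finite F" "F \<subseteq> E"
  shows "(\<Sum>x\<in>F. (cmod (f x))\<^sup>2) \<le> (l2norm E f)\<^sup>2"
  unfolding l2norm_sq using assms by (intro finite_sum_le_infsum) auto

lemma L2_set_le_l2norm:
  assumes "square_summable E f" "finite F" "F \<subseteq> E"
  shows "L2_set (\<lambda>x. cmod (f x)) F \<le> l2norm E f"
  unfolding L2_set_def using sum_squares_le_l2norm[OF assms] by (simp add: real_sqrt_le_iff real_le_lsqrt sum_nonneg)

text \<open>Bounds over finite subsets give summability and the norm bound at once; inequalities for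
  \<open>L2_set\<close> transfer to infinite families in this way.\<close>

lemma l2norm_leI:
  assumes "0 \<le> c" and F: "\<And>F. finite F \<Longrightarrow> F \<subseteq> E \<Longrightarrow> L2_set (\<lambda>x. cmod (f x)) F \<le> c"
  shows "square_summable E f" "l2norm E f \<le> c"
proof -
  have F': "(\<Sum>x\<in>F. (cmod (f x))\<^sup>2) \<le> c\<^sup>2" if "finite F" "F \<subseteq> E" for F
  proof -
    have "(L2_set (\<lambda>x. cmod (f x)) F)\<^sup>2 \<le> c\<^sup>2" using F[OF that] by (intro power_mono) auto
    then show ?thesis by (simp add: L2_set_def sum_nonneg)
  qed
  show s: "square_summable E f"
    by (rule nonneg_bdd_above_summable_on) (auto intro!: bdd_aboveI[of _ "c\<^sup>2"] F')
  have "infsum (\<lambda>x. (cmod (f x))\<^sup>2) E \<le> c\<^sup>2"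
    using s F' by (intro infsum_le_finite_sums) auto
  then show "l2norm E f \<le> c"
    unfolding l2norm_def using \<open>0 \<le> c\<close> by (simp add: real_le_lsqrt)
qed

lemma l2norm_triangle:
  assumes "square_summable E f" "square_summable E g"
  shows "square_summable E (\<lambda>x. f x + g x)" "l2norm E (\<lambda>x. f x + g x) \<le> l2norm E f + l2norm E g"
proof -
  have *: "L2_set (\<lambda>x. cmod (f x + g x)) F \<le> l2norm E f + l2norm E g" if F: "finite F" "F \<subseteq> E" for F
  proof -
    have "L2_set (\<lambda>x. cmod (f x + g x)) F \<le> L2_set (\<lambda>x. cmod (f x) + cmod (g x)) F"
      by (intro L2_set_mono norm_triangle_ineq) auto
    also have "\<dots> \<le> L2_set (\<lambda>x. cmod (f x)) F + L2_set (\<lambda>x. cmod (g x)) F"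
      by (rule L2_set_triangle_ineq)
    finally show ?thesis using L2_set_le_l2norm[OF assms(1) F] L2_set_le_l2norm[OF assms(2) F] by simp
  qed
  show "square_summable E (\<lambda>x. f x + g x)" "l2norm E (\<lambda>x. f x + g x) \<le> l2norm E f + l2norm E g"
    by (rule l2norm_leI[of "l2norm E f + l2norm E g"]; use * in simp)+
qed

lemma square_summable_scale: "square_summable E f \<Longrightarrow> square_summable E (\<lambda>x. c * f x)"
  by (simp add: norm_mult power_mult_distrib summable_on_cmult_right)

lemma l2norm_scale: "l2norm E (\<lambda>x. c * f x) = cmod c * l2norm E f"
  unfolding l2norm_def by (simp add: norm_mult power_mult_distrib infsum_cmult_right' real_sqrt_mult)

lemma ell2_square_summable: "\<xi> \<in> ell2 X \<Longrightarrow> square_summable X \<xi>"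
  unfolding ell2_def by simp

lemma ell2_zero [simp]: "(\<lambda>_. 0) \<in> ell2 X"
  unfolding ell2_def by simp

lemma l2norm_zero [simp]: "l2norm X (\<lambda>_. 0) = 0"
  unfolding l2norm_def by simp

lemma ell2_add:
  assumes "\<xi> \<in> ell2 X" "\<eta> \<in> ell2 X"
  shows "(\<lambda>x. \<xi> x + \<eta> x) \<in> ell2 X"
  using assms l2norm_triangle(1)[where E = X and f = \<xi> and g = \<eta>] unfolding ell2_def by auto

lemma ell2_scale:
  assumes "\<xi> \<in> ell2 X"
  shows "(\<lambda>x. c * \<xi> x) \<in> ell2 X"
  using assms square_summable_scale[where E = X and f = \<xi> and c = c] unfolding ell2_def by auto

lemma l2norm_add:
  assumes "\<xi> \<in> ell2 X" "\<eta> \<in> ell2 X"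
  shows "l2norm X (\<lambda>x. \<xi> x + \<eta> x) \<le> l2norm X \<xi> + l2norm X \<eta>"
  using assms l2norm_triangle(2)[where E = X and f = \<xi> and g = \<eta>] ell2_square_summable by blast

lemma ell2_diff:
  assumes "\<xi> \<in> ell2 X" "\<eta> \<in> ell2 X"
  shows "(\<lambda>x. \<xi> x - \<eta> x) \<in> ell2 X" "l2norm X (\<lambda>x. \<xi> x - \<eta> x) \<le> l2norm X \<xi> + l2norm X \<eta>"
  using ell2_add[OF assms(1) ell2_scale[OF assms(2), of "-1"]]
    l2norm_add[OF assms(1) ell2_scale[OF assms(2), of "-1"]] l2norm_scale[of X "-1" \<eta>] by auto

lemma ell2_sum:
  assumes "finite I" "\<And>i. i \<in> I \<Longrightarrow> \<xi> i \<in> ell2 X"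
  shows "(\<lambda>x. \<Sum>i\<in>I. \<xi> i x) \<in> ell2 X" "l2norm X (\<lambda>x. \<Sum>i\<in>I. \<xi> i x) \<le> (\<Sum>i\<in>I. l2norm X (\<xi> i))"
  using assms
proof (induction I rule: finite_induct)
  case (insert i I)
  {
    case 1
    then show ?case using insert ell2_add[of "\<xi> i" X] by auto
  next
    case 2
    then show ?case using insert l2norm_add[of "\<xi> i" X "\<lambda>x. \<Sum>i\<in>I. \<xi> i x"] by force
  }
qed auto

lemma ell2_coordinate: "\<xi> \<in> ell2 X \<Longrightarrow> cmod (\<xi> x) \<le> l2norm X \<xi>"
proof (cases "x \<in> X")
  case True
  assume "\<xi> \<in> ell2 X"
  then have "L2_set (\<lambda>x. cmod (\<xi> x)) {x} \<le> l2norm X \<xi>"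
    using True by (intro L2_set_le_l2norm ell2_square_summable) auto
  then show ?thesis by simp
qed (auto simp: ell2_def)

lemma ell2_eq_zero_iff: "\<xi> \<in> ell2 X \<Longrightarrow> l2norm X \<xi> = 0 \<longleftrightarrow> \<xi> = (\<lambda>_. 0)"
  using ell2_coordinate[of \<xi> X] by fastforce

lemma l2norm_parallelogram:
  assumes "\<xi> \<in> ell2 X" "\<eta> \<in> ell2 X"
  shows "(l2norm X (\<lambda>x. \<xi> x + \<eta> x))\<^sup>2 + (l2norm X (\<lambda>x. \<xi> x - \<eta> x))\<^sup>2 =
    2 * (l2norm X \<xi>)\<^sup>2 + 2 * (l2norm X \<eta>)\<^sup>2"
proof -
  have s: "square_summable X \<xi>" "square_summable X \<eta>"
    "square_summable X (\<lambda>x. \<xi> x + \<eta> x)" "square_summable X (\<lambda>x. \<xi> x - \<eta> x)"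
    using assms ell2_add ell2_diff(1) ell2_square_summable by blast+
  have pt: "(cmod (a + b))\<^sup>2 + (cmod (a - b))\<^sup>2 = 2 * (cmod a)\<^sup>2 + 2 * (cmod b)\<^sup>2" for a b :: complex
    unfolding cmod_power2 by (simp add: power2_eq_square algebra_simps)
  have "(\<Sum>\<^sub>\<infinity>x\<in>X. (cmod (\<xi> x + \<eta> x))\<^sup>2) + (\<Sum>\<^sub>\<infinity>x\<in>X. (cmod (\<xi> x - \<eta> x))\<^sup>2)
      = (\<Sum>\<^sub>\<infinity>x\<in>X. (cmod (\<xi> x + \<eta> x))\<^sup>2 + (cmod (\<xi> x - \<eta> x))\<^sup>2)"
    using s by (intro infsum_add[symmetric]) auto
  also have "\<dots> = (\<Sum>\<^sub>\<infinity>x\<in>X. 2 * (cmod (\<xi> x))\<^sup>2 + 2 * (cmod (\<eta> x))\<^sup>2)"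
    by (simp only: pt)
  also have "\<dots> = (\<Sum>\<^sub>\<infinity>x\<in>X. 2 * (cmod (\<xi> x))\<^sup>2) + (\<Sum>\<^sub>\<infinity>x\<in>X. 2 * (cmod (\<eta> x))\<^sup>2)"
    using s by (intro infsum_add summable_on_cmult_right) auto
  finally show ?thesis by (simp add: l2norm_sq infsum_cmult_right')
qed

definition delta :: "'x \<Rightarrow> 'x \<Rightarrow> complex" where
  "delta a = (\<lambda>x. if x = a then 1 else 0)"

lemma square_summable_finite_support:
  assumes "finite F" "\<And>x. x \<notin> F \<Longrightarrow> f x = 0"
  shows "square_summable E f"
proof -
  have "square_summable (F \<inter> E) f" using assms by (intro summable_on_finite) auto
  then show ?thesis
    using assms by (subst summable_on_cong_neutral[of "F \<inter> E" E _ "\<lambda>x. (cmod (f x))\<^sup>2"]) auto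
qed

lemma ell2_finite_support:
  assumes "finite F" "F \<subseteq> X" "\<And>x. x \<notin> F \<Longrightarrow> f x = 0"
  shows "f \<in> ell2 X" "(l2norm X f)\<^sup>2 = (\<Sum>x\<in>F. (cmod (f x))\<^sup>2)"
proof -
  show "f \<in> ell2 X" using square_summable_finite_support[where F = F and f = f and E = X] assms unfolding ell2_def by auto
  have "infsum (\<lambda>x. (cmod (f x))\<^sup>2) X = infsum (\<lambda>x. (cmod (f x))\<^sup>2) F"
    using assms by (intro infsum_cong_neutral) auto
  then show "(l2norm X f)\<^sup>2 = (\<Sum>x\<in>F. (cmod (f x))\<^sup>2)"
    unfolding l2norm_sq using assms by simp
qed

lemma delta_ell2: "a \<in> X \<Longrightarrow> delta a \<in> ell2 X"
  using ell2_finite_support(1)[of "{a}" X "delta a"] by (simp add: delta_def)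

lemma l2norm_delta: "a \<in> X \<Longrightarrow> l2norm X (delta a) = 1"
  using ell2_finite_support(2)[of "{a}" X "delta a"] l2norm_nonneg[of X "delta a"]
  by (auto simp: delta_def power2_eq_1_iff simp del: l2norm_nonneg)

lemma inner_abs_summable:
  assumes "\<xi> \<in> ell2 X" "\<eta> \<in> ell2 X"
  shows "(\<lambda>x. norm (cnj (\<xi> x) * \<eta> x)) summable_on X" "cmod (l2inner X \<xi> \<eta>) \<le> l2norm X \<xi> * l2norm X \<eta>"
proof -
  have F: "(\<Sum>x\<in>F. cmod (cnj (\<xi> x) * \<eta> x)) \<le> l2norm X \<xi> * l2norm X \<eta>" if "finite F" "F \<subseteq> X" for F
  proof -
    have "(\<Sum>x\<in>F. cmod (cnj (\<xi> x) * \<eta> x)) = (\<Sum>x\<in>F. \<bar>cmod (\<xi> x)\<bar> * \<bar>cmod (\<eta> x)\<bar>)"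
      by (simp add: norm_mult)
    also have "\<dots> \<le> L2_set (\<lambda>x. cmod (\<xi> x)) F * L2_set (\<lambda>x. cmod (\<eta> x)) F" by (rule L2_set_mult_ineq)
    also have "\<dots> \<le> l2norm X \<xi> * l2norm X \<eta>"
      using assms that by (intro mult_mono L2_set_le_l2norm ell2_square_summable) auto
    finally show ?thesis .
  qed
  show s: "(\<lambda>x. norm (cnj (\<xi> x) * \<eta> x)) summable_on X"
    by (rule nonneg_bdd_above_summable_on)
      (use F in \<open>auto intro!: bdd_aboveI[of _ "l2norm X \<xi> * l2norm X \<eta>"]\<close>)
  have "cmod (l2inner X \<xi> \<eta>) \<le> infsum (\<lambda>x. cmod (cnj (\<xi> x) * \<eta> x)) X"
    unfolding l2inner_def using s by (intro norm_infsum_bound)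
  also have "\<dots> \<le> l2norm X \<xi> * l2norm X \<eta>" using s F by (intro infsum_le_finite_sums) auto
  finally show "cmod (l2inner X \<xi> \<eta>) \<le> l2norm X \<xi> * l2norm X \<eta>" .
qed

lemma inner_summable:
  "\<xi> \<in> ell2 X \<Longrightarrow> \<eta> \<in> ell2 X \<Longrightarrow> (\<lambda>x. cnj (\<xi> x) * \<eta> x) summable_on X"
  by (rule abs_summable_summable[OF inner_abs_summable(1)])

lemma l2inner_lincomb_right:
  assumes "\<xi> \<in> ell2 X" "\<eta> \<in> ell2 X" "\<zeta> \<in> ell2 X"
  shows "l2inner X \<xi> (\<lambda>x. a * \<eta> x + b * \<zeta> x) = a * l2inner X \<xi> \<eta> + b * l2inner X \<xi> \<zeta>"
proof -
  have "l2inner X \<xi> (\<lambda>x. a * \<eta> x + b * \<zeta> x) = (\<Sum>\<^sub>\<infinity>x\<in>X. a * (cnj (\<xi> x) * \<eta> x) + b * (cnj (\<xi> x) * \<zeta> x))"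
    unfolding l2inner_def by (intro infsum_cong) (simp add: algebra_simps)
  also have "\<dots> = (\<Sum>\<^sub>\<infinity>x\<in>X. a * (cnj (\<xi> x) * \<eta> x)) + (\<Sum>\<^sub>\<infinity>x\<in>X. b * (cnj (\<xi> x) * \<zeta> x))"
    using assms by (intro infsum_add summable_on_cmult_right inner_summable)
  finally show ?thesis unfolding l2inner_def by (simp add: infsum_cmult_right')
qed

lemma l2inner_commute: "l2inner X \<xi> \<eta> = cnj (l2inner X \<eta> \<xi>)"
  unfolding l2inner_def by (simp add: mult.commute flip: infsum_cnj)

lemma l2inner_lincomb_left:
  assumes "\<xi> \<in> ell2 X" "\<eta> \<in> ell2 X" "\<zeta> \<in> ell2 X"
  shows "l2inner X (\<lambda>x. a * \<eta> x + b * \<zeta> x) \<xi> = cnj a * l2inner X \<eta> \<xi> + cnj b * l2inner X \<zeta> \<xi>"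
  using l2inner_lincomb_right[OF assms, of a b] l2inner_commute[of X "\<lambda>x. a * \<eta> x + b * \<zeta> x" \<xi>]
    l2inner_commute[of X \<eta> \<xi>] l2inner_commute[of X \<zeta> \<xi>] by simp

text \<open>Estimates are carried by explicit bounds, because the supremum in \<open>opnorm\<close>
  would require a boundedness argument at each use; \<open>opnorm_le\<close> and
  \<open>op_bound_opnorm\<close> translate between the two.\<close>

definition op_bound :: "'x set \<Rightarrow> 'x op \<Rightarrow> real \<Rightarrow> bool" where
  "op_bound X A c \<longleftrightarrow> 0 \<le> c \<and> (\<forall>\<xi>\<in>ell2 X. l2norm X (A \<xi>) \<le> c * l2norm X \<xi>)"

lemma op_boundD: "op_bound X A c \<Longrightarrow> \<xi> \<in> ell2 X \<Longrightarrow> l2norm X (A \<xi>) \<le> c * l2norm X \<xi>"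
  unfolding op_bound_def by blast

lemma op_bound_nonneg: "op_bound X A c \<Longrightarrow> 0 \<le> c"
  unfolding op_bound_def by blast

lemma op_bound_mono: "op_bound X A c \<Longrightarrow> c \<le> d \<Longrightarrow> op_bound X A d"
  unfolding op_bound_def by (meson l2norm_nonneg mult_right_mono order_trans)

lemma bounded_op_ell2: "bounded_op X A \<Longrightarrow> A \<xi> \<in> ell2 X"
  unfolding bounded_op_def by (metis ell2_zero)

lemma bounded_op_off: "bounded_op X A \<Longrightarrow> \<xi> \<notin> ell2 X \<Longrightarrow> A \<xi> = (\<lambda>_. 0)"
  unfolding bounded_op_def by blast

lemma bounded_op_lincomb_arg:
  "bounded_op X A \<Longrightarrow> \<xi> \<in> ell2 X \<Longrightarrow> \<eta> \<in> ell2 X \<Longrightarrow>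
    A (\<lambda>x. a * \<xi> x + c * \<eta> x) = (\<lambda>x. a * A \<xi> x + c * A \<eta> x)"
  unfolding bounded_op_def by blast

lemma bounded_op_scale_arg:
  assumes "bounded_op X A" "\<xi> \<in> ell2 X"
  shows "A (\<lambda>x. c * \<xi> x) = (\<lambda>x. c * A \<xi> x)"
  using bounded_op_lincomb_arg[OF assms ell2_zero, of c 0] by simp

lemma bounded_op_zero_arg: "bounded_op X A \<Longrightarrow> A (\<lambda>_. 0) = (\<lambda>_. 0)"
  using bounded_op_scale_arg[of X A "\<lambda>_. 0" 0] by simp

lemma bounded_op_diff_arg:
  assumes "bounded_op X A" "\<xi> \<in> ell2 X" "\<eta> \<in> ell2 X"
  shows "A (\<lambda>x. \<xi> x - \<eta> x) = (\<lambda>x. A \<xi> x - A \<eta> x)"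
  using bounded_op_lincomb_arg[OF assms, of 1 "-1"] by simp

lemma bounded_op_sum_arg:
  assumes "bounded_op X A" "finite I" "\<And>i. i \<in> I \<Longrightarrow> \<xi> i \<in> ell2 X"
  shows "A (\<lambda>x. \<Sum>i\<in>I. c i * \<xi> i x) = (\<lambda>x. \<Sum>i\<in>I. c i * A (\<xi> i) x)"
  using assms(2,3)
proof (induction I rule: finite_induct)
  case (insert i I)
  have "(\<lambda>x. \<Sum>i\<in>I. c i * \<xi> i x) \<in> ell2 X"
    using insert by (intro ell2_sum ell2_scale) auto
  then show ?case
    using bounded_op_lincomb_arg[OF assms(1), of "\<xi> i" "\<lambda>x. \<Sum>i\<in>I. c i * \<xi> i x" "c i" 1] insert by simp
qed (simp add: bounded_op_zero_arg[OF assms(1)])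

lemma bounded_opI:
  assumes "\<And>\<xi>. \<xi> \<notin> ell2 X \<Longrightarrow> A \<xi> = (\<lambda>_. 0)" "\<And>\<xi>. \<xi> \<in> ell2 X \<Longrightarrow> A \<xi> \<in> ell2 X"
    "\<And>\<xi> \<eta> a c. \<xi> \<in> ell2 X \<Longrightarrow> \<eta> \<in> ell2 X \<Longrightarrow>
      A (\<lambda>x. a * \<xi> x + c * \<eta> x) = (\<lambda>x. a * A \<xi> x + c * A \<eta> x)"
    "op_bound X A d"
  shows "bounded_op X A"
  unfolding bounded_op_def using assms unfolding op_bound_def by blast

lemma bounded_op_bound: "bounded_op X A \<Longrightarrow> \<exists>c. op_bound X A c"
proof -
  assume "bounded_op X A"
  then obtain C where C: "\<And>\<xi>. \<xi> \<in> ell2 X \<Longrightarrow> l2norm X (A \<xi>) \<le> C * l2norm X \<xi>"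
    unfolding bounded_op_def by blast
  have "op_bound X A \<bar>C\<bar>"
    unfolding op_bound_def
  proof (intro conjI ballI)
    fix \<xi> assume "\<xi> \<in> ell2 X"
    have "C * l2norm X \<xi> \<le> \<bar>C\<bar> * l2norm X \<xi>" by (intro mult_right_mono) auto
    then show "l2norm X (A \<xi>) \<le> \<bar>C\<bar> * l2norm X \<xi>" using C[OF \<open>\<xi> \<in> ell2 X\<close>] by linarith
  qed simp
  then show ?thesis ..
qed

lemma bounded_op_eqI:
  assumes "bounded_op X A" "bounded_op X B" "\<And>\<xi>. \<xi> \<in> ell2 X \<Longrightarrow> A \<xi> = B \<xi>"
  shows "A = B"
  using assms bounded_op_off by (metis ext)

lemma opnorm_le: "op_bound X A c \<Longrightarrow> opnorm X A \<le> c"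
  unfolding opnorm_def
proof (rule cSup_least)
  show "{l2norm X (A \<xi>) |\<xi>. \<xi> \<in> ell2 X \<and> l2norm X \<xi> \<le> 1} \<noteq> {}"
    using ell2_zero[of X] l2norm_zero[of X] zero_le_one by (metis (mono_tags, lifting) empty_Collect_eq)
  fix t assume A: "op_bound X A c" and "t \<in> {l2norm X (A \<xi>) |\<xi>. \<xi> \<in> ell2 X \<and> l2norm X \<xi> \<le> 1}"
  then obtain \<xi> where "t = l2norm X (A \<xi>)" "\<xi> \<in> ell2 X" "l2norm X \<xi> \<le> 1" by blast
  then show "t \<le> c"
    using op_boundD[OF A, of \<xi>] mult_left_mono[of "l2norm X \<xi>" 1 c] op_bound_nonneg[OF A] by simp
qed

lemma op_bound_opnorm:
  assumes A: "bounded_op X A"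
  shows "op_bound X A (opnorm X A)"
proof -
  obtain c where c: "op_bound X A c" using bounded_op_bound[OF A] by blast
  define W where "W = {l2norm X (A \<xi>) |\<xi>. \<xi> \<in> ell2 X \<and> l2norm X \<xi> \<le> 1}"
  have bdd: "bdd_above W"
  proof (rule bdd_aboveI[of _ c])
    fix t assume "t \<in> W"
    then obtain \<xi> where "t = l2norm X (A \<xi>)" "\<xi> \<in> ell2 X" "l2norm X \<xi> \<le> 1" unfolding W_def by blast
    then show "t \<le> c"
      using op_boundD[OF c, of \<xi>] mult_left_mono[of "l2norm X \<xi>" 1 c] op_bound_nonneg[OF c] by simp
  qed
  have le: "l2norm X (A \<xi>) \<le> opnorm X A" if "\<xi> \<in> ell2 X" "l2norm X \<xi> \<le> 1" for \<xi>
    unfolding opnorm_def W_def[symmetric] using that by (intro cSup_upper bdd) (auto simp: W_def)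
  show ?thesis
    unfolding op_bound_def
  proof (intro conjI ballI)
    show "0 \<le> opnorm X A"
      by (rule order_trans[OF l2norm_nonneg le[OF ell2_zero]]) simp
    fix \<xi> assume \<xi>: "\<xi> \<in> ell2 X"
    show "l2norm X (A \<xi>) \<le> opnorm X A * l2norm X \<xi>"
    proof (cases "l2norm X \<xi> = 0")
      case True
      then have "\<xi> = (\<lambda>_. 0)" using ell2_eq_zero_iff \<xi> by blast
      then show ?thesis using bounded_op_zero_arg[OF A] by simp
    next
      case False
      then have pos: "l2norm X \<xi> > 0" using l2norm_nonneg[of X \<xi>] by linarith
      define t where "t = complex_of_real (1 / l2norm X \<xi>)"
      have t: "cmod t = 1 / l2norm X \<xi>" using pos by (simp add: t_def norm_divide)
      have "l2norm X (\<lambda>x. t * \<xi> x) \<le> 1" unfolding l2norm_scale t using pos by simp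
      then have "l2norm X (A (\<lambda>x. t * \<xi> x)) \<le> opnorm X A" by (intro le ell2_scale \<xi>)
      then have "1 / l2norm X \<xi> * l2norm X (A \<xi>) \<le> opnorm X A"
        unfolding bounded_op_scale_arg[OF A \<xi>] l2norm_scale t .
      then show ?thesis using pos by (simp add: field_simps)
    qed
  qed
qed

lemma op_bound_lincomb:
  assumes "bounded_op X A" "bounded_op X B" "op_bound X A c" "op_bound X B d"
  shows "op_bound X (op_lincomb a A b B) (cmod a * c + cmod b * d)"
  unfolding op_bound_def
proof (intro conjI ballI)
  show "0 \<le> cmod a * c + cmod b * d" using assms op_bound_nonneg by (intro add_nonneg_nonneg mult_nonneg_nonneg) auto
  fix \<xi> assume \<xi>: "\<xi> \<in> ell2 X"
  have "l2norm X (op_lincomb a A b B \<xi>) \<le> cmod a * l2norm X (A \<xi>) + cmod b * l2norm X (B \<xi>)"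
    unfolding op_lincomb_def
    using l2norm_add[OF ell2_scale[OF bounded_op_ell2[OF assms(1)]] ell2_scale[OF bounded_op_ell2[OF assms(2)]], of a \<xi> b \<xi>]
    by (simp add: l2norm_scale)
  also have "\<dots> \<le> cmod a * (c * l2norm X \<xi>) + cmod b * (d * l2norm X \<xi>)"
    using assms \<xi> by (intro add_mono mult_left_mono op_boundD) auto
  finally show "l2norm X (op_lincomb a A b B \<xi>) \<le> (cmod a * c + cmod b * d) * l2norm X \<xi>"
    by (simp add: algebra_simps)
qed

lemma bounded_op_lincomb:
  assumes A: "bounded_op X A" and B: "bounded_op X B"
  shows "bounded_op X (op_lincomb a A b B)"
proof -
  obtain c d where "op_bound X A c" "op_bound X B d" using bounded_op_bound A B by meson
  then have "op_bound X (op_lincomb a A b B) (cmod a * c + cmod b * d)"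
    using A B by (intro op_bound_lincomb)
  then show ?thesis
  proof (rule bounded_opI[rotated 3])
    show "op_lincomb a A b B \<xi> = (\<lambda>_. 0)" if "\<xi> \<notin> ell2 X" for \<xi>
      using that bounded_op_off[OF A] bounded_op_off[OF B] by (simp add: op_lincomb_def)
    show "op_lincomb a A b B \<xi> \<in> ell2 X" for \<xi>
      unfolding op_lincomb_def using A B by (intro ell2_add ell2_scale bounded_op_ell2)
    show "op_lincomb a A b B (\<lambda>x. s * \<xi> x + t * \<eta> x) =
        (\<lambda>x. s * op_lincomb a A b B \<xi> x + t * op_lincomb a A b B \<eta> x)"
      if "\<xi> \<in> ell2 X" "\<eta> \<in> ell2 X" for \<xi> \<eta> s t
      unfolding op_lincomb_def bounded_op_lincomb_arg[OF A that] bounded_op_lincomb_arg[OF B that]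
      by (simp add: algebra_simps)
  qed
qed

lemma op_diff_lincomb: "op_diff A B = op_lincomb 1 A (-1) B"
  unfolding op_diff_def op_lincomb_def by (simp add: fun_eq_iff)

lemma bounded_op_diff: "bounded_op X A \<Longrightarrow> bounded_op X B \<Longrightarrow> bounded_op X (op_diff A B)"
  unfolding op_diff_lincomb by (rule bounded_op_lincomb)

lemma op_bound_comp:
  assumes "bounded_op X B" "op_bound X A c" "op_bound X B d"
  shows "op_bound X (A \<circ> B) (c * d)"
  unfolding op_bound_def
proof (intro conjI ballI)
  show "0 \<le> c * d" using assms op_bound_nonneg by (intro mult_nonneg_nonneg)
  fix \<xi> assume \<xi>: "\<xi> \<in> ell2 X"
  have "l2norm X (A (B \<xi>)) \<le> c * l2norm X (B \<xi>)"
    using assms by (intro op_boundD bounded_op_ell2)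
  also have "\<dots> \<le> c * (d * l2norm X \<xi>)"
    using assms \<xi> op_bound_nonneg by (intro mult_left_mono op_boundD)
  finally show "l2norm X ((A \<circ> B) \<xi>) \<le> c * d * l2norm X \<xi>" by simp
qed

lemma bounded_op_comp:
  assumes A: "bounded_op X A" and B: "bounded_op X B"
  shows "bounded_op X (A \<circ> B)"
proof -
  obtain c d where "op_bound X A c" "op_bound X B d" using bounded_op_bound A B by meson
  then have "op_bound X (A \<circ> B) (c * d)" using B by (intro op_bound_comp)
  then show ?thesis
  proof (rule bounded_opI[rotated 3])
    show "(A \<circ> B) \<xi> = (\<lambda>_. 0)" if "\<xi> \<notin> ell2 X" for \<xi>
      using that bounded_op_zero_arg[OF A] bounded_op_off[OF B] by simp
    show "(A \<circ> B) \<xi> \<in> ell2 X" for \<xi> using bounded_op_ell2[OF A] by simp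
    show "(A \<circ> B) (\<lambda>x. s * \<xi> x + t * \<eta> x) = (\<lambda>x. s * (A \<circ> B) \<xi> x + t * (A \<circ> B) \<eta> x)"
      if "\<xi> \<in> ell2 X" "\<eta> \<in> ell2 X" for \<xi> \<eta> s t
      using bounded_op_lincomb_arg[OF B that] bounded_op_lincomb_arg[OF A] bounded_op_ell2[OF B] by simp
  qed
qed

lemma op_bound_id: "op_bound X (op_id X) 1"
  unfolding op_bound_def op_id_def by simp

lemma bounded_op_id: "bounded_op X (op_id X)"
  by (rule bounded_opI[OF _ _ _ op_bound_id]) (auto simp: op_id_def ell2_add ell2_scale)

lemma bounded_op_zero: "bounded_op X op_zero"
  by (rule bounded_opI[of _ _ 0]) (auto simp: op_zero_def op_bound_def)

lemma op_id_comp: "bounded_op X A \<Longrightarrow> op_id X \<circ> A = A" "bounded_op X A \<Longrightarrow> A \<circ> op_id X = A"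
  using bounded_op_ell2[of X A] bounded_op_off[of X A] bounded_op_zero_arg[of X A]
  by (auto simp: op_id_def fun_eq_iff)

text \<open>The series is summed coordinatewise. Letting the number of terms grow in the bounds over
  a finite set of coordinates yields both membership in \<open>ell2 X\<close> and the norm
  estimate.\<close>

lemma ell2_series:
  fixes \<zeta> :: "nat \<Rightarrow> 'x \<Rightarrow> complex"
  assumes \<zeta>: "\<And>k. \<zeta> k \<in> ell2 X" "\<And>k. l2norm X (\<zeta> k) \<le> b k" and b: "summable b"
  shows "summable (\<lambda>k. \<zeta> k x)" "(\<lambda>x. \<Sum>k. \<zeta> k x) \<in> ell2 X" "l2norm X (\<lambda>x. \<Sum>k. \<zeta> k x) \<le> suminf b"
proof -
  have b0: "0 \<le> b k" for k using \<zeta>(2)[of k] l2norm_nonneg order_trans by blast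
  show s: "summable (\<lambda>k. \<zeta> k x)" for x
    using b ell2_coordinate[OF \<zeta>(1)] \<zeta>(2) by (intro summable_comparison_test'[OF b, of 0]) (meson order_trans)
  have F: "L2_set (\<lambda>x. cmod (\<Sum>k. \<zeta> k x)) F \<le> suminf b" if "finite F" "F \<subseteq> X" for F
  proof (rule LIMSEQ_le_const2)
    show "(\<lambda>m. L2_set (\<lambda>x. cmod (\<Sum>k<m. \<zeta> k x)) F) \<longlonglongrightarrow> L2_set (\<lambda>x. cmod (\<Sum>k. \<zeta> k x)) F"
      unfolding L2_set_def by (intro tendsto_intros summable_LIMSEQ s)
    have "L2_set (\<lambda>x. cmod (\<Sum>k<m. \<zeta> k x)) F \<le> suminf b" for m
    proof -
      have "L2_set (\<lambda>x. cmod (\<Sum>k<m. \<zeta> k x)) F \<le> l2norm X (\<lambda>x. \<Sum>k<m. \<zeta> k x)"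
        using \<zeta>(1) that by (intro L2_set_le_l2norm ell2_square_summable ell2_sum) auto
      also have "\<dots> \<le> (\<Sum>k<m. l2norm X (\<zeta> k))" using \<zeta>(1) by (intro ell2_sum) auto
      also have "\<dots> \<le> (\<Sum>k<m. b k)" using \<zeta>(2) by (intro sum_mono)
      also have "\<dots> \<le> suminf b" using b b0 by (intro sum_le_suminf) auto
      finally show ?thesis .
    qed
    then show "\<exists>N. \<forall>n\<ge>N. L2_set (\<lambda>x. cmod (\<Sum>k<n. \<zeta> k x)) F \<le> suminf b" by blast
  qed
  have "0 \<le> suminf b" using b b0 by (rule suminf_nonneg)
  from l2norm_leI[OF this F]
  have "square_summable X (\<lambda>x. \<Sum>k. \<zeta> k x)" "l2norm X (\<lambda>x. \<Sum>k. \<zeta> k x) \<le> suminf b" by auto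
  moreover have "(\<Sum>k. \<zeta> k x) = 0" if "x \<notin> X" for x
    using \<zeta>(1) that unfolding ell2_def by simp
  ultimately show "(\<lambda>x. \<Sum>k. \<zeta> k x) \<in> ell2 X" "l2norm X (\<lambda>x. \<Sum>k. \<zeta> k x) \<le> suminf b"
    unfolding ell2_def by auto
qed

section \<open>The Neumann series of a strict contraction\<close>

lemma bounded_op_funpow: "bounded_op X M \<Longrightarrow> \<xi> \<in> ell2 X \<Longrightarrow> (M ^^ k) \<xi> \<in> ell2 X"
  by (induction k) (auto intro: bounded_op_ell2)

lemma funpow_bound:
  assumes "bounded_op X M" "op_bound X M r" "\<xi> \<in> ell2 X"
  shows "l2norm X ((M ^^ k) \<xi>) \<le> r ^ k * l2norm X \<xi>"
proof (induction k)
  case (Suc k)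
  have "l2norm X (M ((M ^^ k) \<xi>)) \<le> r * l2norm X ((M ^^ k) \<xi>)"
    using assms by (intro op_boundD bounded_op_funpow)
  also have "\<dots> \<le> r * (r ^ k * l2norm X \<xi>)"
    using Suc op_bound_nonneg[OF assms(2)] by (intro mult_left_mono)
  finally show ?case by simp
qed simp

lemma funpow_lincomb:
  assumes "bounded_op X M" "\<xi> \<in> ell2 X" "\<eta> \<in> ell2 X"
  shows "(M ^^ k) (\<lambda>x. a * \<xi> x + c * \<eta> x) = (\<lambda>x. a * (M ^^ k) \<xi> x + c * (M ^^ k) \<eta> x)"
proof (induction k)
  case (Suc k)
  show ?case
    using bounded_op_lincomb_arg[OF assms(1) bounded_op_funpow[OF assms(1,2)] bounded_op_funpow[OF assms(1,3)]] Suc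
    by simp
qed simp

definition neumann :: "'x set \<Rightarrow> 'x op \<Rightarrow> 'x op" where
  "neumann X M = (\<lambda>\<xi>. if \<xi> \<in> ell2 X then (\<lambda>x. \<Sum>k. (M ^^ k) \<xi> x) else (\<lambda>_. 0))"

text \<open>Horner form of the partial sums: they stay in any algebra containing \<open>M\<close>
  and the identity by closure under composition and linear combination.\<close>

primrec neumann_partial :: "'x set \<Rightarrow> 'x op \<Rightarrow> nat \<Rightarrow> 'x op" where
  "neumann_partial X M 0 = op_zero"
| "neumann_partial X M (Suc n) = op_lincomb 1 (op_id X) 1 (M \<circ> neumann_partial X M n)"

context
  fixes X :: "'x set" and M :: "'x op" and r :: real
  assumes M: "bounded_op X M" and r: "op_bound X M r" "r < 1"
begin

lemma neumann_summable: "summable (\<lambda>k. r ^ k * c)"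
  using r op_bound_nonneg[OF r(1)] by (intro summable_mult2 summable_geometric) auto

lemma neumann_series:
  assumes "\<xi> \<in> ell2 X"
  shows "summable (\<lambda>k. (M ^^ k) \<xi> x)"
  using ell2_series(1)[of "\<lambda>k. (M ^^ k) \<xi>" X "\<lambda>k. r ^ k * l2norm X \<xi>" x]
    bounded_op_funpow[OF M assms] funpow_bound[OF M r(1) assms] neumann_summable by blast

lemma neumann_partial_sum:
  assumes "\<xi> \<in> ell2 X"
  shows "neumann_partial X M n \<xi> = (\<lambda>x. \<Sum>k<n. (M ^^ k) \<xi> x)"
proof (induction n)
  case (Suc n)
  have "M (\<lambda>x. \<Sum>k<n. 1 * (M ^^ k) \<xi> x) = (\<lambda>x. \<Sum>k<n. 1 * M ((M ^^ k) \<xi>) x)"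
    using bounded_op_funpow[OF M assms] by (intro bounded_op_sum_arg[OF M]) auto
  then show ?case
    using Suc assms by (simp add: op_lincomb_def op_id_def sum.lessThan_Suc_shift del: sum.lessThan_Suc)
qed (simp add: op_zero_def)

lemma neumann_tail:
  assumes \<xi>: "\<xi> \<in> ell2 X"
  shows "op_diff (neumann X M) (neumann_partial X M n) \<xi> \<in> ell2 X"
    "l2norm X (op_diff (neumann X M) (neumann_partial X M n) \<xi>) \<le> r ^ n / (1 - r) * l2norm X \<xi>"
proof -
  have eq: "op_diff (neumann X M) (neumann_partial X M n) \<xi> = (\<lambda>x. \<Sum>k. (M ^^ (k + n)) \<xi> x)"
  proof
    fix x
    show "op_diff (neumann X M) (neumann_partial X M n) \<xi> x = (\<Sum>k. (M ^^ (k + n)) \<xi> x)"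
      unfolding op_diff_def neumann_partial_sum[OF \<xi>] neumann_def
      using \<xi> suminf_split_initial_segment[OF neumann_series[OF \<xi>, of x], where k = n] by simp
  qed
  have s: "(\<lambda>k. r ^ (k + n) * l2norm X \<xi>) sums (r ^ n / (1 - r) * l2norm X \<xi>)"
  proof -
    have "(\<lambda>k. r ^ k) sums (1 / (1 - r))" using r op_bound_nonneg[OF r(1)] by (intro geometric_sums) auto
    from sums_mult2[OF this, of "r ^ n * l2norm X \<xi>"] show ?thesis by (simp add: power_add mult.assoc)
  qed
  show "op_diff (neumann X M) (neumann_partial X M n) \<xi> \<in> ell2 X"
    "l2norm X (op_diff (neumann X M) (neumann_partial X M n) \<xi>) \<le> r ^ n / (1 - r) * l2norm X \<xi>"
    unfolding eq
    using ell2_series(2,3)[of "\<lambda>k. (M ^^ (k + n)) \<xi>" X "\<lambda>k. r ^ (k + n) * l2norm X \<xi>"]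
      bounded_op_funpow[OF M \<xi>] funpow_bound[OF M r(1) \<xi>] s sums_unique[OF s] sums_summable[OF s] by auto
qed

lemma neumann_bounded: "bounded_op X (neumann X M)"
proof (rule bounded_opI[of _ _ "1 / (1 - r)"])
  have eq: "op_diff (neumann X M) (neumann_partial X M 0) \<xi> = neumann X M \<xi>" for \<xi>
    by (simp add: op_diff_def op_zero_def)
  show "neumann X M \<xi> \<in> ell2 X" if "\<xi> \<in> ell2 X" for \<xi> using neumann_tail(1)[OF that, of 0] eq by simp
  show "op_bound X (neumann X M) (1 / (1 - r))"
    using neumann_tail(2)[of _ 0] eq r unfolding op_bound_def by simp
  show "neumann X M (\<lambda>x. a * \<xi> x + c * \<eta> x) = (\<lambda>x. a * neumann X M \<xi> x + c * neumann X M \<eta> x)"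
    if "\<xi> \<in> ell2 X" "\<eta> \<in> ell2 X" for \<xi> \<eta> a c
  proof -
    have "(\<lambda>x. a * \<xi> x + c * \<eta> x) \<in> ell2 X" using that by (intro ell2_add ell2_scale)
    then show ?thesis
      using that by (simp add: neumann_def funpow_lincomb[OF M] neumann_series suminf_mult summable_mult
          flip: suminf_add)
  qed
qed (simp add: neumann_def)

lemma neumann_approx: "op_bound X (op_diff (neumann X M) (neumann_partial X M n)) (r ^ n / (1 - r))"
  using neumann_tail(2) r op_bound_nonneg[OF r(1)] unfolding op_bound_def by simp

text \<open>Applied to \<xi> - M \<xi> the series telescopes, and the powers of \<open>M\<close> at
  \<xi> tend to 0 in each coordinate.\<close>

lemma neumann_inverse: "neumann X M \<circ> op_lincomb 1 (op_id X) (-1) M = op_id X"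
proof (rule bounded_op_eqI[OF bounded_op_comp[OF neumann_bounded bounded_op_lincomb[OF bounded_op_id M]] bounded_op_id])
  fix \<xi> :: "'x \<Rightarrow> complex"
  assume \<xi>: "\<xi> \<in> ell2 X"
  define \<eta> where "\<eta> = (\<lambda>x. 1 * \<xi> x + (-1) * M \<xi> x)"
  have \<eta>: "\<eta> \<in> ell2 X" unfolding \<eta>_def by (intro ell2_add ell2_scale \<xi> bounded_op_ell2[OF M])
  have tele: "(M ^^ k) \<eta> x = (M ^^ k) \<xi> x - (M ^^ Suc k) \<xi> x" for k x
    unfolding \<eta>_def funpow_lincomb[OF M \<xi> bounded_op_ell2[OF M]] by (simp add: funpow_swap1)
  have "(\<lambda>k. (M ^^ k) \<eta> x) sums \<xi> x" for x
  proof -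
    have "(\<lambda>k. (M ^^ k) \<xi> x) \<longlonglongrightarrow> 0" using neumann_series[OF \<xi>] by (rule summable_LIMSEQ_zero)
    from telescope_sums'[OF this] show ?thesis unfolding tele by simp
  qed
  then have "(\<Sum>k. (M ^^ k) \<eta> x) = \<xi> x" for x by (metis sums_unique)
  then show "(neumann X M \<circ> op_lincomb 1 (op_id X) (-1) M) \<xi> = op_id X \<xi>"
    using \<xi> \<eta> by (simp add: neumann_def op_lincomb_def op_id_def \<eta>_def)
qed

text \<open>The partial sums commute with \<open>M\<close>, which makes them self-adjoint, and the
  geometric tail bound lets inner products pass to the limit. A self-adjoint inverse is what the
  Cauchy-Schwarz argument for traces works with.\<close>

lemma neumann_self_adjoint:
  assumes adj: "is_adjoint X M M"
  shows "is_adjoint X (neumann X M) (neumann X M)"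
  unfolding is_adjoint_def
proof (intro ballI)
  fix \<xi> \<eta> :: "'x \<Rightarrow> complex"
  assume \<xi>: "\<xi> \<in> ell2 X" and \<eta>: "\<eta> \<in> ell2 X"
  have pow: "l2inner X ((M ^^ k) \<xi>) \<eta> = l2inner X \<xi> ((M ^^ k) \<eta>)" if "\<xi> \<in> ell2 X" "\<eta> \<in> ell2 X" for k \<xi> \<eta>
    using that
  proof (induction k arbitrary: \<eta>)
    case (Suc k)
    have "l2inner X (M ((M ^^ k) \<xi>)) \<eta> = l2inner X ((M ^^ k) \<xi>) (M \<eta>)"
      using adj Suc.prems bounded_op_funpow[OF M] unfolding is_adjoint_def by blast
    also have "\<dots> = l2inner X \<xi> ((M ^^ k) (M \<eta>))" using Suc bounded_op_ell2[OF M] by blast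
    finally show ?case by (simp add: funpow_swap1)
  qed simp
  have part: "bounded_op X (neumann_partial X M n)" for n
    by (induction n) (auto intro!: bounded_op_zero bounded_op_lincomb bounded_op_id bounded_op_comp M)
  define S where "S n = neumann_partial X M n" for n
  have Sell: "S n \<zeta> \<in> ell2 X" for n \<zeta> unfolding S_def using bounded_op_ell2[OF part] .
  have Sadj: "l2inner X (S n \<xi>) \<eta> = l2inner X \<xi> (S n \<eta>)" if "\<xi> \<in> ell2 X" "\<eta> \<in> ell2 X" for n \<xi> \<eta>
    using that
  proof (induction n arbitrary: \<eta>)
    case 0
    then show ?case by (simp add: S_def op_zero_def l2inner_def)
  next
    case (Suc n)
    have S1: "S (Suc n) \<zeta> = (\<lambda>x. 1 * \<zeta> x + 1 * M (S n \<zeta>) x)" if "\<zeta> \<in> ell2 X" for \<zeta>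
      using that by (simp add: S_def op_lincomb_def op_id_def)
    have comm: "S n (M \<zeta>) = M (S n \<zeta>)" if "\<zeta> \<in> ell2 X" for \<zeta>
    proof -
      have "S n (M \<zeta>) = (\<lambda>x. \<Sum>k<n. 1 * (M ^^ k) (M \<zeta>) x)"
        unfolding S_def neumann_partial_sum[OF bounded_op_ell2[OF M]] by simp
      also have "\<dots> = M (\<lambda>x. \<Sum>k<n. 1 * (M ^^ k) \<zeta> x)"
        using bounded_op_funpow[OF M that]
        by (subst bounded_op_sum_arg[OF M]) (auto simp: funpow_swap1)
      finally show ?thesis unfolding S_def neumann_partial_sum[OF that] by simp
    qed
    have "l2inner X (S (Suc n) \<xi>) \<eta> = l2inner X \<xi> \<eta> + l2inner X (M (S n \<xi>)) \<eta>"
      unfolding S1[OF Suc.prems(1)]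
      using l2inner_lincomb_left[OF Suc.prems(2,1) bounded_op_ell2[OF M], of 1 1 "S n \<xi>"] by simp
    also have "l2inner X (M (S n \<xi>)) \<eta> = l2inner X (S n \<xi>) (M \<eta>)"
      using adj Sell Suc.prems unfolding is_adjoint_def by blast
    also have "\<dots> = l2inner X \<xi> (S n (M \<eta>))" using Suc bounded_op_ell2[OF M] by blast
    also have "S n (M \<eta>) = M (S n \<eta>)" using comm Suc.prems by blast
    also have "l2inner X \<xi> \<eta> + l2inner X \<xi> (M (S n \<eta>)) = l2inner X \<xi> (S (Suc n) \<eta>)"
      unfolding S1[OF Suc.prems(2)]
      using l2inner_lincomb_right[OF Suc.prems bounded_op_ell2[OF M], of 1 1 "S n \<eta>"] by simp
    finally show ?case .
  qed
  define R where "R = neumann X M"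
  have Rell: "R \<zeta> \<in> ell2 X" for \<zeta> unfolding R_def using bounded_op_ell2[OF neumann_bounded] .
  have lim: "(\<lambda>n. l2inner X \<zeta> (S n \<eta>)) \<longlonglongrightarrow> l2inner X \<zeta> (R \<eta>)" if "\<zeta> \<in> ell2 X" "\<eta> \<in> ell2 X" for \<zeta> \<eta>
  proof (rule Lim_null_comparison[THEN LIM_zero_cancel])
    show "\<forall>\<^sub>F n in sequentially. norm (l2inner X \<zeta> (S n \<eta>) - l2inner X \<zeta> (R \<eta>)) \<le>
        l2norm X \<zeta> * (r ^ n / (1 - r) * l2norm X \<eta>)"
    proof (intro always_eventually allI)
      fix n
      have "l2inner X \<zeta> (op_diff R (S n) \<eta>) = l2inner X \<zeta> (R \<eta>) - l2inner X \<zeta> (S n \<eta>)"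
        using l2inner_lincomb_right[OF that(1) Rell Sell, of 1 \<eta> "-1" n \<eta>] by (simp add: op_diff_def)
      then have "norm (l2inner X \<zeta> (S n \<eta>) - l2inner X \<zeta> (R \<eta>)) = norm (l2inner X \<zeta> (op_diff R (S n) \<eta>))"
        by (simp add: norm_minus_commute)
      also have "\<dots> \<le> l2norm X \<zeta> * l2norm X (op_diff R (S n) \<eta>)"
        using neumann_tail(1)[OF that(2), of n] that(1) unfolding R_def S_def by (intro inner_abs_summable(2))
      also have "\<dots> \<le> l2norm X \<zeta> * (r ^ n / (1 - r) * l2norm X \<eta>)"
        using neumann_tail(2)[OF that(2), of n] unfolding R_def S_def by (intro mult_left_mono) auto
      finally show "norm (l2inner X \<zeta> (S n \<eta>) - l2inner X \<zeta> (R \<eta>)) \<le>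
        l2norm X \<zeta> * (r ^ n / (1 - r) * l2norm X \<eta>)" .
    qed
    have "(\<lambda>n. r ^ n) \<longlonglongrightarrow> 0" using r op_bound_nonneg[OF r(1)] by (intro LIMSEQ_power_zero) auto
    then have "(\<lambda>n. l2norm X \<zeta> * (r ^ n / (1 - r) * l2norm X \<eta>)) \<longlonglongrightarrow> l2norm X \<zeta> * (0 / (1 - r) * l2norm X \<eta>)"
      by (intro tendsto_mult tendsto_divide tendsto_const) (use r in auto)
    then show "(\<lambda>n. l2norm X \<zeta> * (r ^ n / (1 - r) * l2norm X \<eta>)) \<longlonglongrightarrow> 0" by simp
  qed
  have "(\<lambda>n. l2inner X \<xi> (S n \<eta>)) \<longlonglongrightarrow> l2inner X \<xi> (R \<eta>)" using lim[OF \<xi> \<eta>] .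
  moreover have "(\<lambda>n. l2inner X \<xi> (S n \<eta>)) \<longlonglongrightarrow> l2inner X (R \<xi>) \<eta>"
  proof -
    have "(\<lambda>n. cnj (l2inner X \<eta> (S n \<xi>))) \<longlonglongrightarrow> cnj (l2inner X \<eta> (R \<xi>))"
      by (intro tendsto_intros lim \<xi> \<eta>)
    then show ?thesis
      using Sadj[OF \<xi> \<eta>] l2inner_commute[of X "R \<xi>" \<eta>] l2inner_commute[of X "S _ \<xi>" \<eta>] by simp
  qed
  ultimately show "l2inner X (neumann X M \<xi>) \<eta> = l2inner X \<xi> (neumann X M \<eta>)"
    unfolding R_def using LIMSEQ_unique by blast
qed

end

section \<open>Cosets and the quasi-regular representation\<close>

definition coset :: "(real \<Rightarrow> real) \<Rightarrow> (real \<Rightarrow> real) set" where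
  "coset g = lcoset g thompsonF"

text \<open>The orbit point of a coset; the representative is immaterial because elements of
  \<open>thompsonF\<close> fix 0.\<close>

definition pt :: "(real \<Rightarrow> real) set \<Rightarrow> real" where
  "pt C = (SOME f. f \<in> C) 0"

lemma thompsonF_id: "id \<in> thompsonF"
  unfolding thompsonF_def using thompsonT_id by simp

lemma lcoset_comp: "lcoset g (lcoset h C) = lcoset (g \<circ> h) C"
  unfolding lcoset_def by (simp add: image_image comp_assoc)

lemma lcoset_id [simp]: "lcoset id C = C"
  unfolding lcoset_def by simp

lemma lcoset_coset: "lcoset g (coset h) = coset (g \<circ> h)"
  unfolding coset_def by (rule lcoset_comp)

lemma coset_TmodF: "g \<in> thompsonT \<Longrightarrow> coset g \<in> TmodF"
  unfolding TmodF_def coset_def by blast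

lemma TmodF_E:
  assumes "C \<in> TmodF" obtains g where "g \<in> thompsonT" "C = coset g"
  using assms unfolding TmodF_def coset_def by blast

lemma pt_coset [simp]: "pt (coset g) = g 0"
proof -
  have "coset g \<noteq> {}" unfolding coset_def lcoset_def using thompsonF_id by blast
  then have "(SOME f. f \<in> coset g) \<in> coset g" by (simp add: some_in_eq)
  then show ?thesis unfolding pt_def unfolding coset_def lcoset_def thompsonF_def by auto
qed

lemma thompsonT_inv_cancel:
  assumes "g \<in> thompsonT"
  shows "inv g \<circ> g = id" "g \<circ> inv g = id" "inv g (g x) = x" "g (inv g x) = x"
  using thompsonT_bij[OF assms] by (auto simp: bij_is_inj bij_is_surj surj_f_inv_f fun_eq_iff)

lemma thompsonT_inv_inv: "g \<in> thompsonT \<Longrightarrow> inv (inv g) = g"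
  using thompsonT_bij inv_inv_eq by blast

text \<open>If \<open>g\<close> and \<open>h\<close> agree at 0, then \<open>inv h \<circ> g\<close>
  lies in the stabiliser F of 0. This makes \<open>pt\<close> injective on the cosets.\<close>

lemma coset_eqI:
  assumes g: "g \<in> thompsonT" and h: "h \<in> thompsonT" and eq: "g 0 = h 0"
  shows "coset g = coset h"
proof -
  have sub: "coset g \<subseteq> coset h" if g: "g \<in> thompsonT" and h: "h \<in> thompsonT" and eq: "g 0 = h 0" for g h
  proof
    fix x assume "x \<in> coset g"
    then obtain f where f: "f \<in> thompsonT" "f 0 = 0" "x = g \<circ> f"
      unfolding coset_def lcoset_def thompsonF_def by blast
    have "inv h \<circ> (g \<circ> f) \<in> thompsonF"
      unfolding thompsonF_def using f g h eq thompsonT_inv_cancel(3)[OF h, of 0]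
      by (auto intro!: thompsonT_comp thompsonT_inv)
    moreover have "x = h \<circ> (inv h \<circ> (g \<circ> f))"
      unfolding f(3) using thompsonT_inv_cancel(4)[OF h] by (simp add: fun_eq_iff)
    ultimately show "x \<in> coset h" unfolding coset_def lcoset_def by blast
  qed
  show ?thesis using sub[OF g h eq] sub[OF h g eq[symmetric]] by blast
qed

lemma TmodF_eqI:
  assumes "C \<in> TmodF" "D \<in> TmodF" "pt C = pt D"
  shows "C = D"
proof -
  obtain g h where "g \<in> thompsonT" "C = coset g" "h \<in> thompsonT" "D = coset h"
    using assms TmodF_E by metis
  then show ?thesis using coset_eqI[of g h] assms(3) by simp
qed

lemma lcoset_TmodF: "g \<in> thompsonT \<Longrightarrow> C \<in> TmodF \<Longrightarrow> lcoset g C \<in> TmodF"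
  by (elim TmodF_E) (simp add: lcoset_coset coset_TmodF thompsonT_comp)

lemma pt_lcoset: "C \<in> TmodF \<Longrightarrow> pt (lcoset g C) = g (pt C)"
  by (elim TmodF_E) (simp add: lcoset_coset)

lemma pt_range: "C \<in> TmodF \<Longrightarrow> 0 \<le> pt C \<and> pt C < 1"
  using thompsonT_range[of _ 0] by (elim TmodF_E) force

lemma lcoset_inv_cancel:
  assumes "g \<in> thompsonT"
  shows "lcoset (inv g) (lcoset g C) = C" "lcoset g (lcoset (inv g) C) = C"
  using assms by (simp_all add: lcoset_comp thompsonT_inv_cancel)

lemma lcoset_bij_betw:
  assumes "g \<in> thompsonT" shows "bij_betw (lcoset g) TmodF TmodF"
  using assms by (intro bij_betw_byWitness[where f' = "lcoset (inv g)"])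
    (auto simp: lcoset_inv_cancel intro: lcoset_TmodF thompsonT_inv)

lemma quasireg_apply:
  "\<xi> \<in> ell2 TmodF \<Longrightarrow> C \<in> TmodF \<Longrightarrow> quasireg g \<xi> C = \<xi> (lcoset (inv g) C)"
  unfolding quasireg_def by simp

lemma quasireg_notin: "C \<notin> TmodF \<Longrightarrow> quasireg g \<xi> C = 0"
  unfolding quasireg_def by simp

lemma quasireg_ell2:
  assumes g: "g \<in> thompsonT" and \<xi>: "\<xi> \<in> ell2 TmodF"
  shows "quasireg g \<xi> \<in> ell2 TmodF" "l2norm TmodF (quasireg g \<xi>) = l2norm TmodF \<xi>"
proof -
  have bij: "bij_betw (lcoset (inv g)) TmodF TmodF" using lcoset_bij_betw thompsonT_inv[OF g] by blast
  have "square_summable TmodF (quasireg g \<xi>) \<longleftrightarrow> square_summable TmodF (\<lambda>C. \<xi> (lcoset (inv g) C))"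
    using \<xi> by (intro summable_on_cong) (simp add: quasireg_apply)
  also have "\<dots> \<longleftrightarrow> square_summable TmodF \<xi>"
    using summable_on_reindex_bij_betw[OF bij, of "\<lambda>C. (cmod (\<xi> C))\<^sup>2"] .
  finally show "quasireg g \<xi> \<in> ell2 TmodF"
    using \<xi> quasireg_notin unfolding ell2_def by blast
  have "infsum (\<lambda>C. (cmod (quasireg g \<xi> C))\<^sup>2) TmodF = infsum (\<lambda>C. (cmod (\<xi> (lcoset (inv g) C)))\<^sup>2) TmodF"
    using \<xi> by (intro infsum_cong) (simp add: quasireg_apply)
  also have "\<dots> = infsum (\<lambda>C. (cmod (\<xi> C))\<^sup>2) TmodF"
    using infsum_reindex_bij_betw[OF bij, of "\<lambda>C. (cmod (\<xi> C))\<^sup>2"] .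
  finally show "l2norm TmodF (quasireg g \<xi>) = l2norm TmodF \<xi>" unfolding l2norm_def by simp
qed

lemma quasireg_bound: "g \<in> thompsonT \<Longrightarrow> op_bound TmodF (quasireg g) 1"
  unfolding op_bound_def using quasireg_ell2(2) by simp

lemma quasireg_bounded:
  assumes g: "g \<in> thompsonT"
  shows "bounded_op TmodF (quasireg g)"
proof (rule bounded_opI[OF _ _ _ quasireg_bound[OF g]])
  show "quasireg g \<xi> = (\<lambda>_. 0)" if "\<xi> \<notin> ell2 TmodF" for \<xi> using that by (simp add: quasireg_def)
  show "quasireg g \<xi> \<in> ell2 TmodF" if "\<xi> \<in> ell2 TmodF" for \<xi> using quasireg_ell2(1)[OF g that] .
  show "quasireg g (\<lambda>x. a * \<xi> x + c * \<eta> x) = (\<lambda>x. a * quasireg g \<xi> x + c * quasireg g \<eta> x)"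
    if "\<xi> \<in> ell2 TmodF" "\<eta> \<in> ell2 TmodF" for \<xi> \<eta> a c
  proof -
    have "(\<lambda>x. a * \<xi> x + c * \<eta> x) \<in> ell2 TmodF" using that by (intro ell2_add ell2_scale)
    then show ?thesis using that by (simp add: quasireg_def fun_eq_iff)
  qed
qed

lemma quasireg_comp:
  assumes g: "g \<in> thompsonT" and h: "h \<in> thompsonT"
  shows "quasireg g \<circ> quasireg h = quasireg (g \<circ> h)"
proof (rule bounded_op_eqI[of TmodF])
  show "bounded_op TmodF (quasireg g \<circ> quasireg h)" "bounded_op TmodF (quasireg (g \<circ> h))"
    using g h by (auto intro!: bounded_op_comp quasireg_bounded thompsonT_comp)
  fix \<xi> :: "(real \<Rightarrow> real) set \<Rightarrow> complex" assume \<xi>: "\<xi> \<in> ell2 TmodF"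
  have inv: "inv (g \<circ> h) = inv h \<circ> inv g" using g h thompsonT_bij by (simp add: o_inv_distrib)
  show "(quasireg g \<circ> quasireg h) \<xi> = quasireg (g \<circ> h) \<xi>"
  proof
    fix C
    show "(quasireg g \<circ> quasireg h) \<xi> C = quasireg (g \<circ> h) \<xi> C"
    proof (cases "C \<in> TmodF")
      case True
      then show ?thesis
        using \<xi> quasireg_ell2(1)[OF h \<xi>] lcoset_TmodF[OF thompsonT_inv[OF g] True]
        by (simp add: quasireg_apply inv lcoset_comp)
    qed (simp add: quasireg_notin)
  qed
qed

lemma quasireg_id: "quasireg id = op_id TmodF"
proof (rule bounded_op_eqI[OF quasireg_bounded[OF thompsonT_id] bounded_op_id])
  fix \<xi> :: "(real \<Rightarrow> real) set \<Rightarrow> complex" assume \<xi>: "\<xi> \<in> ell2 TmodF"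
  then show "quasireg id \<xi> = op_id TmodF \<xi>"
    unfolding quasireg_def op_id_def by (auto simp: ell2_def fun_eq_iff)
qed

lemma quasireg_inv_comp:
  assumes "g \<in> thompsonT"
  shows "quasireg g \<circ> quasireg (inv g) = op_id TmodF" "quasireg (inv g) \<circ> quasireg g = op_id TmodF"
  using assms by (simp_all add: quasireg_comp thompsonT_inv thompsonT_inv_cancel quasireg_id[unfolded id_def] quasireg_id)

lemma quasireg_adjoint:
  assumes g: "g \<in> thompsonT"
  shows "is_adjoint TmodF (quasireg g) (quasireg (inv g))"
  unfolding is_adjoint_def
proof (intro ballI)
  fix \<xi> \<eta> :: "(real \<Rightarrow> real) set \<Rightarrow> complex"
  assume \<xi>: "\<xi> \<in> ell2 TmodF" and \<eta>: "\<eta> \<in> ell2 TmodF"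
  have bij: "bij_betw (lcoset g) TmodF TmodF" using lcoset_bij_betw g by blast
  have "l2inner TmodF (quasireg g \<xi>) \<eta> = infsum (\<lambda>C. cnj (quasireg g \<xi> (lcoset g C)) * \<eta> (lcoset g C)) TmodF"
    unfolding l2inner_def
    using infsum_reindex_bij_betw[OF bij, of "\<lambda>C. cnj (quasireg g \<xi> C) * \<eta> C"] by simp
  also have "\<dots> = infsum (\<lambda>C. cnj (\<xi> C) * quasireg (inv g) \<eta> C) TmodF"
    using \<xi> \<eta> g lcoset_TmodF[OF g]
    by (intro infsum_cong) (simp add: quasireg_apply lcoset_inv_cancel thompsonT_inv_inv)
  finally show "l2inner TmodF (quasireg g \<xi>) \<eta> = l2inner TmodF \<xi> (quasireg (inv g) \<eta>)"
    unfolding l2inner_def .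
qed

lemma quasireg_delta:
  assumes g: "g \<in> thompsonT" and C: "C \<in> TmodF"
  shows "quasireg g (delta C) = delta (lcoset g C)"
proof
  fix D
  show "quasireg g (delta C) D = delta (lcoset g C) D"
  proof (cases "D \<in> TmodF")
    case True
    have "lcoset (inv g) D = C \<longleftrightarrow> D = lcoset g C" using g lcoset_inv_cancel by metis
    then show ?thesis using True quasireg_apply[OF delta_ell2[OF C] True] by (simp add: delta_def)
  next
    case False
    then show ?thesis using lcoset_TmodF[OF g C] by (auto simp: quasireg_notin delta_def)
  qed
qed

section \<open>The group algebra and its norm closure\<close>

lemma group_alg_quasireg: "g \<in> thompsonT \<Longrightarrow> quasireg g \<in> group_alg_qr"
  unfolding group_alg_qr_def by (intro CollectI exI[of _ "{g}"] exI[of _ "\<lambda>_. 1"]) simp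

lemma group_alg_zero: "op_zero \<in> group_alg_qr"
  unfolding group_alg_qr_def op_zero_def by (intro CollectI exI[of _ "{}"]) simp

lemma group_alg_lincomb:
  assumes "A \<in> group_alg_qr" "B \<in> group_alg_qr"
  shows "op_lincomb a A b B \<in> group_alg_qr"
proof -
  obtain S c where A: "finite S" "S \<subseteq> thompsonT" "A = (\<lambda>\<xi> C. \<Sum>g\<in>S. c g * quasireg g \<xi> C)"
    using assms(1) unfolding group_alg_qr_def by blast
  obtain S' c' where B: "finite S'" "S' \<subseteq> thompsonT" "B = (\<lambda>\<xi> C. \<Sum>g\<in>S'. c' g * quasireg g \<xi> C)"
    using assms(2) unfolding group_alg_qr_def by blast
  define d where "d g = a * (if g \<in> S then c g else 0) + b * (if g \<in> S' then c' g else 0)" for g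
  have "(\<Sum>g\<in>S \<union> S'. d g * quasireg g \<xi> C) = a * A \<xi> C + b * B \<xi> C" for \<xi> C
  proof -
    have "(\<Sum>g\<in>S \<union> S'. (if g \<in> S then c g else 0) * quasireg g \<xi> C) = A \<xi> C"
      unfolding A(3) using A(1) B(1) by (intro sum.mono_neutral_cong_right) auto
    moreover have "(\<Sum>g\<in>S \<union> S'. (if g \<in> S' then c' g else 0) * quasireg g \<xi> C) = B \<xi> C"
      unfolding B(3) using A(1) B(1) by (intro sum.mono_neutral_cong_right) auto
    ultimately show ?thesis
      unfolding d_def by (simp add: distrib_right sum.distrib mult.assoc flip: sum_distrib_left)
  qed
  then have "op_lincomb a A b B = (\<lambda>\<xi> C. \<Sum>g\<in>S \<union> S'. d g * quasireg g \<xi> C)"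
    unfolding op_lincomb_def by (simp add: fun_eq_iff)
  then show ?thesis
    unfolding group_alg_qr_def using A B by (intro CollectI exI[of _ "S \<union> S'"] exI[of _ d]) auto
qed

lemma group_alg_sum:
  assumes "finite I" "\<And>i. i \<in> I \<Longrightarrow> A i \<in> group_alg_qr"
  shows "(\<lambda>\<xi> C. \<Sum>i\<in>I. c i * A i \<xi> C) \<in> group_alg_qr"
  using assms
proof (induction I rule: finite_induct)
  case empty
  then show ?case using group_alg_zero by (simp add: op_zero_def)
next
  case (insert i I)
  then have "op_lincomb (c i) (A i) 1 (\<lambda>\<xi> C. \<Sum>i\<in>I. c i * A i \<xi> C) \<in> group_alg_qr"
    by (intro group_alg_lincomb) auto
  then show ?case using insert by (simp add: op_lincomb_def)
qed

lemma group_alg_bounded: "A \<in> group_alg_qr \<Longrightarrow> bounded_op TmodF A"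
proof -
  assume "A \<in> group_alg_qr"
  then obtain S c where A: "finite S" "S \<subseteq> thompsonT" "A = (\<lambda>\<xi> C. \<Sum>g\<in>S. c g * quasireg g \<xi> C)"
    unfolding group_alg_qr_def by blast
  have "bounded_op TmodF (\<lambda>\<xi> C. \<Sum>g\<in>S. c g * quasireg g \<xi> C)"
    using A(1,2)
  proof (induction S rule: finite_induct)
    case empty
    then show ?case using bounded_op_zero by (simp add: op_zero_def)
  next
    case (insert g S)
    then have "bounded_op TmodF (op_lincomb (c g) (quasireg g) 1 (\<lambda>\<xi> C. \<Sum>g\<in>S. c g * quasireg g \<xi> C))"
      by (intro bounded_op_lincomb quasireg_bounded) auto
    then show ?case using insert by (simp add: op_lincomb_def)
  qed
  then show ?thesis using A by simp
qed

lemma group_alg_comp: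
  assumes "A \<in> group_alg_qr" "B \<in> group_alg_qr"
  shows "A \<circ> B \<in> group_alg_qr"
proof -
  have 1: "quasireg g \<circ> B \<in> group_alg_qr" if g: "g \<in> thompsonT" for g
  proof -
    obtain S c where B: "finite S" "S \<subseteq> thompsonT" "B = (\<lambda>\<xi> C. \<Sum>g\<in>S. c g * quasireg g \<xi> C)"
      using assms(2) unfolding group_alg_qr_def by blast
    have "(\<lambda>\<xi> C. \<Sum>h\<in>S. c h * quasireg (g \<circ> h) \<xi> C) \<in> group_alg_qr"
      using B g by (intro group_alg_sum group_alg_quasireg thompsonT_comp) auto
    moreover have "quasireg g \<circ> B = (\<lambda>\<xi> C. \<Sum>h\<in>S. c h * quasireg (g \<circ> h) \<xi> C)"
    proof
      fix \<xi>
      have q: "quasireg h \<xi> \<in> ell2 TmodF" if "h \<in> S" for h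
        using B that quasireg_bounded bounded_op_ell2 by blast
      have "quasireg g (\<lambda>C. \<Sum>h\<in>S. c h * quasireg h \<xi> C) = (\<lambda>C. \<Sum>h\<in>S. c h * quasireg g (quasireg h \<xi>) C)"
        using quasireg_bounded[OF g] B(1) q by (rule bounded_op_sum_arg)
      moreover have "quasireg g (quasireg h \<xi>) = quasireg (g \<circ> h) \<xi>" if "h \<in> S" for h
        using quasireg_comp[OF g, of h] B(2) that by (metis comp_apply subsetD)
      ultimately show "(quasireg g \<circ> B) \<xi> = (\<lambda>C. \<Sum>h\<in>S. c h * quasireg (g \<circ> h) \<xi> C)"
        unfolding B(3) by simp
    qed
    ultimately show ?thesis by simp
  qed
  obtain S c where A: "finite S" "S \<subseteq> thompsonT" "A = (\<lambda>\<xi> C. \<Sum>g\<in>S. c g * quasireg g \<xi> C)"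
    using assms(1) unfolding group_alg_qr_def by blast
  have "(\<lambda>\<xi> C. \<Sum>g\<in>S. c g * (quasireg g \<circ> B) \<xi> C) \<in> group_alg_qr"
    using A(1,2) 1 by (intro group_alg_sum) blast+
  then show ?thesis unfolding A(3) by (simp add: comp_def)
qed

lemma cstar_qr_iff:
  "A \<in> cstar_qr \<longleftrightarrow> bounded_op TmodF A \<and>
    (\<forall>\<epsilon>>0. \<exists>B\<in>group_alg_qr. op_bound TmodF (op_diff A B) \<epsilon>)"
proof
  assume A: "A \<in> cstar_qr"
  then have b: "bounded_op TmodF A" unfolding cstar_qr_def by blast
  have "\<exists>B\<in>group_alg_qr. op_bound TmodF (op_diff A B) \<epsilon>" if pos: "\<epsilon> > 0" for \<epsilon>
  proof -
    obtain B where B: "B \<in> group_alg_qr" "opnorm TmodF (op_diff A B) < \<epsilon>"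
      using A pos unfolding cstar_qr_def by blast
    then have "op_bound TmodF (op_diff A B) \<epsilon>"
      using op_bound_opnorm[OF bounded_op_diff[OF b group_alg_bounded]] op_bound_mono by (metis less_imp_le)
    then show ?thesis using B by blast
  qed
  then show "bounded_op TmodF A \<and> (\<forall>\<epsilon>>0. \<exists>B\<in>group_alg_qr. op_bound TmodF (op_diff A B) \<epsilon>)" using b by blast
next
  assume A: "bounded_op TmodF A \<and> (\<forall>\<epsilon>>0. \<exists>B\<in>group_alg_qr. op_bound TmodF (op_diff A B) \<epsilon>)"
  have "\<exists>B\<in>group_alg_qr. opnorm TmodF (op_diff A B) < \<epsilon>" if pos: "\<epsilon> > 0" for \<epsilon>
  proof -
    obtain B where "B \<in> group_alg_qr" "op_bound TmodF (op_diff A B) (\<epsilon> / 2)"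
      using A pos by (meson half_gt_zero)
    then show ?thesis using opnorm_le[of TmodF "op_diff A B" "\<epsilon> / 2"] pos by force
  qed
  then show "A \<in> cstar_qr" unfolding cstar_qr_def using A by blast
qed

lemma cstar_bounded: "A \<in> cstar_qr \<Longrightarrow> bounded_op TmodF A"
  unfolding cstar_qr_def by blast

lemma group_alg_cstar: "A \<in> group_alg_qr \<Longrightarrow> A \<in> cstar_qr"
  unfolding cstar_qr_iff using group_alg_bounded
  by (auto intro!: bexI[of _ A] simp: op_diff_def op_bound_def)

lemma quasireg_cstar: "g \<in> thompsonT \<Longrightarrow> quasireg g \<in> cstar_qr"
  by (intro group_alg_cstar group_alg_quasireg)

lemma op_id_cstar: "op_id TmodF \<in> cstar_qr"
  using quasireg_cstar[OF thompsonT_id] quasireg_id by simp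

lemma op_zero_cstar: "op_zero \<in> cstar_qr"
  by (intro group_alg_cstar group_alg_zero)

lemma cstar_lincomb:
  assumes A: "A \<in> cstar_qr" and B: "B \<in> cstar_qr"
  shows "op_lincomb a A b B \<in> cstar_qr"
  unfolding cstar_qr_iff
proof (intro conjI allI impI)
  show "bounded_op TmodF (op_lincomb a A b B)" using A B by (intro bounded_op_lincomb cstar_bounded)
  fix \<epsilon> :: real assume "\<epsilon> > 0"
  define \<delta> where "\<delta> = \<epsilon> / (cmod a + cmod b + 1)"
  have pos: "cmod a + cmod b + 1 > 0" by (simp add: add_nonneg_pos)
  then have "\<delta> > 0" unfolding \<delta>_def using \<open>\<epsilon> > 0\<close> by simp
  obtain A' where A': "A' \<in> group_alg_qr" "op_bound TmodF (op_diff A A') \<delta>"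
    using A \<open>\<delta> > 0\<close> unfolding cstar_qr_iff by blast
  obtain B' where B': "B' \<in> group_alg_qr" "op_bound TmodF (op_diff B B') \<delta>"
    using B \<open>\<delta> > 0\<close> unfolding cstar_qr_iff by blast
  have eq: "op_diff (op_lincomb a A b B) (op_lincomb a A' b B') = op_lincomb a (op_diff A A') b (op_diff B B')"
    unfolding op_diff_def op_lincomb_def by (simp add: algebra_simps)
  have "op_bound TmodF (op_lincomb a (op_diff A A') b (op_diff B B')) (cmod a * \<delta> + cmod b * \<delta>)"
    using A B A' B' by (intro op_bound_lincomb bounded_op_diff cstar_bounded group_alg_bounded)
  moreover have "cmod a * \<delta> + cmod b * \<delta> \<le> \<epsilon>"
  proof -
    have "(cmod a + cmod b + 1) * \<delta> = \<epsilon>" unfolding \<delta>_def using pos by simp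
    then show ?thesis using \<open>\<delta> > 0\<close> by (simp add: algebra_simps)
  qed
  ultimately have "op_bound TmodF (op_diff (op_lincomb a A b B) (op_lincomb a A' b B')) \<epsilon>"
    unfolding eq by (rule op_bound_mono)
  then show "\<exists>C\<in>group_alg_qr. op_bound TmodF (op_diff (op_lincomb a A b B) C) \<epsilon>"
    using group_alg_lincomb[OF A'(1) B'(1)] by blast
qed

lemma cstar_comp:
  assumes A: "A \<in> cstar_qr" and B: "B \<in> cstar_qr"
  shows "A \<circ> B \<in> cstar_qr"
  unfolding cstar_qr_iff
proof (intro conjI allI impI)
  have bA: "bounded_op TmodF A" and bB: "bounded_op TmodF B" using A B by (auto intro: cstar_bounded)
  show "bounded_op TmodF (A \<circ> B)" using bA bB by (rule bounded_op_comp)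
  fix \<epsilon> :: real assume "\<epsilon> > 0"
  obtain b where b: "op_bound TmodF B b" using bounded_op_bound[OF bB] by blast
  have b0: "0 \<le> b" using b by (rule op_bound_nonneg)
  define \<delta> where "\<delta> = \<epsilon> / (2 * (b + 1))"
  have "\<delta> > 0" unfolding \<delta>_def using \<open>\<epsilon> > 0\<close> b0 by simp
  obtain A' where A': "A' \<in> group_alg_qr" "op_bound TmodF (op_diff A A') \<delta>"
    using A \<open>\<delta> > 0\<close> unfolding cstar_qr_iff by blast
  obtain a where a: "op_bound TmodF A' a" using bounded_op_bound[OF group_alg_bounded[OF A'(1)]] by blast
  have a0: "0 \<le> a" using a by (rule op_bound_nonneg)
  \<comment> \<open>The tolerance for \<open>B\<close> is set only now, because it depends on the
    bound \<open>a\<close> of the approximant \<open>A'\<close>.\<close>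
  define \<delta>' where "\<delta>' = \<epsilon> / (2 * (a + 1))"
  have "\<delta>' > 0" unfolding \<delta>'_def using \<open>\<epsilon> > 0\<close> a0 by simp
  obtain B' where B': "B' \<in> group_alg_qr" "op_bound TmodF (op_diff B B') \<delta>'"
    using B \<open>\<delta>' > 0\<close> unfolding cstar_qr_iff by blast
  have bA': "bounded_op TmodF A'" and bB': "bounded_op TmodF B'" using A' B' group_alg_bounded by auto
  have eq: "op_diff (A \<circ> B) (A' \<circ> B') = op_lincomb 1 (op_diff A A' \<circ> B) 1 (A' \<circ> op_diff B B')"
    using bounded_op_diff_arg[OF bA' bounded_op_ell2[OF bB] bounded_op_ell2[OF bB']]
    unfolding op_diff_def op_lincomb_def by (simp add: fun_eq_iff)
  have "op_bound TmodF (op_lincomb 1 (op_diff A A' \<circ> B) 1 (A' \<circ> op_diff B B')) (cmod 1 * (\<delta> * b) + cmod 1 * (a * \<delta>'))"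
    using bA bB bA' bB' A' B' a b
    by (intro op_bound_lincomb op_bound_comp bounded_op_comp bounded_op_diff)
  moreover have "cmod 1 * (\<delta> * b) + cmod 1 * (a * \<delta>') \<le> \<epsilon>"
  proof -
    have "2 * (b + 1) * \<delta> = \<epsilon>" "2 * (a + 1) * \<delta>' = \<epsilon>" unfolding \<delta>_def \<delta>'_def using a0 b0 by auto
    then have "2 * (\<delta> * b) \<le> \<epsilon>" "2 * (a * \<delta>') \<le> \<epsilon>" using \<open>\<delta> > 0\<close> \<open>\<delta>' > 0\<close> by (auto simp: algebra_simps)
    then show ?thesis by simp
  qed
  ultimately have "op_bound TmodF (op_diff (A \<circ> B) (A' \<circ> B')) \<epsilon>"
    unfolding eq by (rule op_bound_mono)
  then show "\<exists>C\<in>group_alg_qr. op_bound TmodF (op_diff (A \<circ> B) C) \<epsilon>"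
    using group_alg_comp[OF A'(1) B'(1)] by blast
qed

lemma cstar_limit:
  assumes R: "bounded_op TmodF R" and lim: "\<And>\<epsilon>. \<epsilon> > 0 \<Longrightarrow> \<exists>A\<in>cstar_qr. op_bound TmodF (op_diff R A) \<epsilon>"
  shows "R \<in> cstar_qr"
  unfolding cstar_qr_iff
proof (intro conjI R allI impI)
  fix \<epsilon> :: real assume "\<epsilon> > 0"
  then obtain A where A: "A \<in> cstar_qr" "op_bound TmodF (op_diff R A) (\<epsilon> / 2)"
    using lim[of "\<epsilon> / 2"] by auto
  obtain B where B: "B \<in> group_alg_qr" "op_bound TmodF (op_diff A B) (\<epsilon> / 2)"
    using A(1) \<open>\<epsilon> > 0\<close> unfolding cstar_qr_iff by (meson half_gt_zero)
  have eq: "op_diff R B = op_lincomb 1 (op_diff R A) 1 (op_diff A B)"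
    unfolding op_diff_def op_lincomb_def by (simp add: fun_eq_iff)
  have "op_bound TmodF (op_diff R B) (cmod 1 * (\<epsilon> / 2) + cmod 1 * (\<epsilon> / 2))"
    unfolding eq
    by (intro op_bound_lincomb bounded_op_diff R cstar_bounded[OF A(1)] group_alg_bounded[OF B(1)] A(2) B(2))
  then show "\<exists>B\<in>group_alg_qr. op_bound TmodF (op_diff R B) \<epsilon>" using B(1) by auto
qed

section \<open>A spectral gap on the coset space\<close>

text \<open>Group elements permute coordinates, so the mass on \<open>E\<close> is carried along
  with \<open>E\<close>. Geometry on the circle becomes norm inequalities through this
  transport.\<close>

lemma l2norm_image_quasireg:
  assumes g: "g \<in> thompsonT" and E: "E \<subseteq> TmodF" and \<xi>: "\<xi> \<in> ell2 TmodF"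
  shows "l2norm (lcoset g ` E) (quasireg g \<xi>) = l2norm E \<xi>"
proof -
  have "bij_betw (lcoset g) E (lcoset g ` E)"
    using lcoset_bij_betw[OF g] E by (meson bij_betw_subset)
  then have "infsum (\<lambda>C. (cmod (quasireg g \<xi> C))\<^sup>2) (lcoset g ` E) = infsum (\<lambda>C. (cmod (quasireg g \<xi> (lcoset g C)))\<^sup>2) E"
    using infsum_reindex_bij_betw[of "lcoset g" E "lcoset g ` E" "\<lambda>C. (cmod (quasireg g \<xi> C))\<^sup>2"] by simp
  also have "\<dots> = infsum (\<lambda>C. (cmod (\<xi> C))\<^sup>2) E"
    using E \<xi> lcoset_TmodF[OF g] by (intro infsum_cong) (auto simp: quasireg_apply lcoset_inv_cancel[OF g])
  finally show ?thesis unfolding l2norm_def by simp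
qed

definition sector :: "real set \<Rightarrow> (real \<Rightarrow> real) set set" where
  "sector K = {C \<in> TmodF. pt C \<in> K}"

lemma sector_subset: "sector K \<subseteq> TmodF"
  unfolding sector_def by blast

lemma square_summable_subset: "\<xi> \<in> ell2 X \<Longrightarrow> E \<subseteq> X \<Longrightarrow> square_summable E \<xi>"
  using summable_on_subset_banach ell2_square_summable by blast

lemma l2norm_mono_set: "\<xi> \<in> ell2 X \<Longrightarrow> E \<subseteq> X \<Longrightarrow> l2norm E \<xi> \<le> l2norm X \<xi>"
  unfolding l2norm_def
  by (intro real_sqrt_le_mono infsum_mono2 square_summable_subset[of \<xi> X] ell2_square_summable) auto

lemma l2norm_sq_Un:
  assumes "\<xi> \<in> ell2 X" "A \<subseteq> X" "B \<subseteq> X" "A \<inter> B = {}"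
  shows "(l2norm (A \<union> B) \<xi>)\<^sup>2 = (l2norm A \<xi>)\<^sup>2 + (l2norm B \<xi>)\<^sup>2"
  unfolding l2norm_sq using assms square_summable_subset by (intro infsum_Un_disjoint) auto

lemma contr_image_sector: "lcoset contr ` sector {0..<1/2} = sector {0..<1/4}"
proof
  show "lcoset contr ` sector {0..<1/2} \<subseteq> sector {0..<1/4}"
    using lcoset_TmodF[OF contr_thompsonT] by (auto simp: sector_def pt_lcoset contr_def)
  show "sector {0..<1/4} \<subseteq> lcoset contr ` sector {0..<1/2}"
  proof
    fix C assume C: "C \<in> sector {0..<1/4}"
    define D where "D = lcoset (inv contr) C"
    have D: "D \<in> TmodF" "lcoset contr D = C"
      using C lcoset_TmodF thompsonT_inv[OF contr_thompsonT] lcoset_inv_cancel[OF contr_thompsonT]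
      unfolding D_def sector_def by auto
    have "contr (pt D) \<in> {0..<1/4}" using C D pt_lcoset unfolding sector_def by force
    then have "pt D \<in> {0..<1/2}" using pt_range[OF D(1)] by (auto simp: contr_def split: if_splits)
    then show "C \<in> lcoset contr ` sector {0..<1/2}" using D unfolding sector_def by blast
  qed
qed

text \<open>Transport of the mass on the first half into the first quarter gives s \<le> t + e, so
  the mass in between is s^2 - t^2 \<le> e (2 t + e). The factor 4 comes from bounding t by the norm
  of \<xi> and e by twice that norm.\<close>

lemma contr_mass_bound:
  assumes \<xi>: "\<xi> \<in> ell2 TmodF"
  shows "(l2norm (sector {1/4..<1/2}) \<xi>)\<^sup>2 \<le> 4 * l2norm TmodF (\<lambda>C. quasireg contr \<xi> C - \<xi> C) * l2norm TmodF \<xi>"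
proof -
  define e where "e = l2norm TmodF (\<lambda>C. quasireg contr \<xi> C - \<xi> C)"
  define s where "s = l2norm (sector {0..<1/2}) \<xi>"
  define t where "t = l2norm (sector {0..<1/4}) \<xi>"
  have c\<xi>: "quasireg contr \<xi> \<in> ell2 TmodF" "l2norm TmodF (quasireg contr \<xi>) = l2norm TmodF \<xi>"
    using quasireg_ell2[OF contr_thompsonT \<xi>] by auto
  have d: "(\<lambda>C. quasireg contr \<xi> C - \<xi> C) \<in> ell2 TmodF" using c\<xi>(1) \<xi> by (rule ell2_diff(1))
  have "s = l2norm (sector {0..<1/4}) (quasireg contr \<xi>)"
    unfolding s_def using l2norm_image_quasireg[OF contr_thompsonT sector_subset \<xi>] contr_image_sector by metis
  also have "\<dots> = l2norm (sector {0..<1/4}) (\<lambda>C. \<xi> C + (quasireg contr \<xi> C - \<xi> C))" by simp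
  also have "\<dots> \<le> t + l2norm (sector {0..<1/4}) (\<lambda>C. quasireg contr \<xi> C - \<xi> C)"
    unfolding t_def using \<xi> d by (intro l2norm_triangle square_summable_subset[OF _ sector_subset])
  also have "l2norm (sector {0..<1/4}) (\<lambda>C. quasireg contr \<xi> C - \<xi> C) \<le> e"
    unfolding e_def using d sector_subset by (rule l2norm_mono_set)
  finally have st: "s \<le> t + e" by simp
  have tn: "t \<le> l2norm TmodF \<xi>" unfolding t_def using \<xi> sector_subset by (rule l2norm_mono_set)
  have en: "e \<le> 2 * l2norm TmodF \<xi>" unfolding e_def using ell2_diff(2)[OF c\<xi>(1) \<xi>] c\<xi>(2) by simp
  have nn: "0 \<le> e" "0 \<le> t" "0 \<le> s" unfolding e_def t_def s_def by auto
  have "sector {0..<1/2} = sector {0..<1/4} \<union> sector {1/4..<1/2}" "sector {0..<1/4} \<inter> sector {1/4..<1/2} = {}"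
    unfolding sector_def by auto
  then have "(l2norm (sector {1/4..<1/2}) \<xi>)\<^sup>2 = s\<^sup>2 - t\<^sup>2"
    unfolding s_def t_def using l2norm_sq_Un[OF \<xi> sector_subset sector_subset] by simp
  also have "\<dots> \<le> (t + e)\<^sup>2 - t\<^sup>2" using st nn by (simp add: power_mono)
  also have "\<dots> = e * (2 * t + e)" by (simp add: power2_eq_square algebra_simps)
  also have "\<dots> \<le> e * (4 * l2norm TmodF \<xi>)" using tn en nn by (intro mult_left_mono) auto
  finally show ?thesis unfolding e_def by (simp add: algebra_simps)
qed

section \<open>Conjugates of \<open>contr\<close> by quarter rotations\<close>

definition conjugate :: "(real \<Rightarrow> real) \<Rightarrow> (real \<Rightarrow> real) \<Rightarrow> real \<Rightarrow> real" where
  "conjugate u f = u \<circ> f \<circ> inv u"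

lemma conjugate_thompsonT: "u \<in> thompsonT \<Longrightarrow> f \<in> thompsonT \<Longrightarrow> conjugate u f \<in> thompsonT"
  unfolding conjugate_def by (intro thompsonT_comp thompsonT_inv)

lemma inv_conjugate:
  assumes "u \<in> thompsonT" "f \<in> thompsonT"
  shows "inv (conjugate u f) = conjugate u (inv f)"
  unfolding conjugate_def using assms thompsonT_bij thompsonT_comp thompsonT_inv
  by (simp add: o_inv_distrib thompsonT_inv_inv comp_assoc)

lemma quasireg_conjugate:
  assumes "u \<in> thompsonT" "f \<in> thompsonT"
  shows "quasireg (conjugate u f) = quasireg u \<circ> quasireg f \<circ> quasireg (inv u)"
  using assms by (simp add: conjugate_def quasireg_comp thompsonT_comp thompsonT_inv)

lemma rot_pow_thompsonT: "rot ^^ k \<in> thompsonT"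
proof (induction k)
  case (Suc k)
  then show ?case unfolding funpow.simps by (intro thompsonT_comp rot_thompsonT)
qed (simp add: thompsonT_id[unfolded id_def] thompsonT_id)

definition contr_rot :: "nat \<Rightarrow> real \<Rightarrow> real" where
  "contr_rot k = conjugate (inv (rot ^^ k)) contr"

lemma contr_rot_thompsonT: "contr_rot k \<in> thompsonT"
  unfolding contr_rot_def by (intro conjugate_thompsonT thompsonT_inv rot_pow_thompsonT contr_thompsonT)

text \<open>With n the norm of \<xi> and e_k its k-th displacement, each quarter carries mass at
  most 4 e_k n. Adding the quarters gives n^2 \<le> 4 (e_0 + e_1 + e_2 + e_3) n, so the largest e_k
  is at least n/16.\<close>

lemma contr_rot_displacement:
  assumes \<xi>: "\<xi> \<in> ell2 TmodF"
  shows "\<exists>k<4. l2norm TmodF \<xi> \<le> 16 * l2norm TmodF (\<lambda>C. \<xi> C - quasireg (contr_rot k) \<xi> C)"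
proof (cases "l2norm TmodF \<xi> = 0")
  case True
  then show ?thesis by (intro exI[of _ 0]) simp
next
  case False
  define n where "n = l2norm TmodF \<xi>"
  have n: "n > 0" unfolding n_def using False l2norm_nonneg[of TmodF \<xi>] by linarith
  define \<eta> where "\<eta> k = quasireg (rot ^^ k) \<xi>" for k
  have \<eta>: "\<eta> k \<in> ell2 TmodF" "l2norm TmodF (\<eta> k) = n" for k
    unfolding \<eta>_def n_def using quasireg_ell2[OF rot_pow_thompsonT \<xi>] by auto
  define e where "e k = l2norm TmodF (\<lambda>C. \<xi> C - quasireg (contr_rot k) \<xi> C)" for k
  \<comment> \<open>The rotation acts isometrically, so moving \<xi> by the conjugate costs as much
    as moving the rotated vector \<open>\<eta> k\<close> by \<open>contr\<close>.\<close>
  have e: "l2norm TmodF (\<lambda>C. quasireg contr (\<eta> k) C - \<eta> k C) = e k" for k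
  proof -
    let ?u = "rot ^^ k"
    have bd: "bounded_op TmodF (quasireg (inv ?u))" by (intro quasireg_bounded thompsonT_inv rot_pow_thompsonT)
    have "quasireg (contr_rot k) \<xi> = quasireg (inv ?u) (quasireg contr (\<eta> k))"
      unfolding contr_rot_def \<eta>_def
      by (simp add: quasireg_conjugate thompsonT_inv rot_pow_thompsonT contr_thompsonT thompsonT_inv_inv)
    moreover have "\<xi> = quasireg (inv ?u) (\<eta> k)"
      using quasireg_inv_comp(2)[OF rot_pow_thompsonT[of k]] \<xi> unfolding \<eta>_def
      by (metis comp_apply op_id_def)
    ultimately have "(\<lambda>C. \<xi> C - quasireg (contr_rot k) \<xi> C) =
        quasireg (inv ?u) (\<lambda>C. \<eta> k C - quasireg contr (\<eta> k) C)"
      using bounded_op_diff_arg[OF bd \<eta>(1) quasireg_ell2(1)[OF contr_thompsonT \<eta>(1)], of k k] by simp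
    then have "e k = l2norm TmodF (\<lambda>C. \<eta> k C - quasireg contr (\<eta> k) C)"
      unfolding e_def using quasireg_ell2(2)[OF thompsonT_inv[OF rot_pow_thompsonT]
        ell2_diff(1)[OF \<eta>(1) quasireg_ell2(1)[OF contr_thompsonT \<eta>(1)]]] by simp
    also have "\<dots> = l2norm TmodF (\<lambda>C. quasireg contr (\<eta> k) C - \<eta> k C)"
      unfolding l2norm_def by (simp add: norm_minus_commute)
    finally show ?thesis by simp
  qed
  have m: "(l2norm (sector {x. (rot ^^ k) x \<in> {1/4..<1/2}}) \<xi>)\<^sup>2 \<le> 4 * e k * n" for k
  proof -
    have "lcoset (rot ^^ k) ` sector {x. (rot ^^ k) x \<in> {1/4..<1/2}} = sector {1/4..<1/2}"
    proof
      show "lcoset (rot ^^ k) ` sector {x. (rot ^^ k) x \<in> {1/4..<1/2}} \<subseteq> sector {1/4..<1/2}"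
        using lcoset_TmodF[OF rot_pow_thompsonT] unfolding sector_def by (auto simp: pt_lcoset)
      show "sector {1/4..<1/2} \<subseteq> lcoset (rot ^^ k) ` sector {x. (rot ^^ k) x \<in> {1/4..<1/2}}"
      proof
        fix C assume C: "C \<in> sector {1/4..<1/2}"
        define D where "D = lcoset (inv (rot ^^ k)) C"
        have D: "D \<in> TmodF" "lcoset (rot ^^ k) D = C"
          using C lcoset_TmodF[OF thompsonT_inv[OF rot_pow_thompsonT]] lcoset_inv_cancel[OF rot_pow_thompsonT]
          unfolding D_def sector_def by auto
        then have "D \<in> sector {x. (rot ^^ k) x \<in> {1/4..<1/2}}" using C pt_lcoset[OF D(1), of "rot ^^ k"] unfolding sector_def by auto
        then show "C \<in> lcoset (rot ^^ k) ` sector {x. (rot ^^ k) x \<in> {1/4..<1/2}}" using D by blast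
      qed
    qed
    then have "l2norm (sector {x. (rot ^^ k) x \<in> {1/4..<1/2}}) \<xi> = l2norm (sector {1/4..<1/2}) (\<eta> k)"
      using l2norm_image_quasireg[OF rot_pow_thompsonT sector_subset \<xi>] unfolding \<eta>_def by metis
    then show ?thesis using contr_mass_bound[OF \<eta>(1), of k] unfolding e \<eta>(2) by simp
  qed
  have ceq: "sector {x. (rot ^^ k) x \<in> {1/4..<1/2}} = sector K"
    if "\<And>x. 0 \<le> x \<Longrightarrow> x < 1 \<Longrightarrow> (rot ^^ k) x \<in> {1/4..<1/2} \<longleftrightarrow> x \<in> K" for k K
    unfolding sector_def using that pt_range by auto
  \<comment> \<open>The preimages of the second quarter under the four rotations are the four
    quarters, which cover the circle.\<close>
  have s: "sector {x. (rot ^^ 0) x \<in> {1/4..<1/2}} = sector {1/4..<1/2}"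
    "sector {x. (rot ^^ 1) x \<in> {1/4..<1/2}} = sector {0..<1/4}"
    "sector {x. (rot ^^ 2) x \<in> {1/4..<1/2}} = sector {3/4..<1}"
    "sector {x. (rot ^^ 3) x \<in> {1/4..<1/2}} = sector {1/2..<3/4}"
    by (rule ceq; auto simp: rot_def numeral_2_eq_2 numeral_3_eq_3)+
  have "TmodF = (sector {0..<1/4} \<union> sector {1/4..<1/2}) \<union> (sector {1/2..<3/4} \<union> sector {3/4..<1})"
    using pt_range unfolding sector_def by auto
  moreover have "(l2norm ((sector {0..<1/4} \<union> sector {1/4..<1/2}) \<union> (sector {1/2..<3/4} \<union> sector {3/4..<1})) \<xi>)\<^sup>2 =
      ((l2norm (sector {0..<1/4}) \<xi>)\<^sup>2 + (l2norm (sector {1/4..<1/2}) \<xi>)\<^sup>2) +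
      ((l2norm (sector {1/2..<3/4}) \<xi>)\<^sup>2 + (l2norm (sector {3/4..<1}) \<xi>)\<^sup>2)"
    by (subst l2norm_sq_Un[OF \<xi>]; (subst l2norm_sq_Un[OF \<xi>])?; (subst l2norm_sq_Un[OF \<xi>])?; auto simp: sector_def)
  ultimately have "n\<^sup>2 \<le> 4 * (e 0 + e 1 + e 2 + e 3) * n"
    unfolding n_def[symmetric] using m[of 0] m[of 1] m[of 2] m[of 3] unfolding s
    by (simp add: algebra_simps n_def)
  then have "n \<le> 4 * (e 0 + e 1 + e 2 + e 3)" using n by (simp add: power2_eq_square)
  then have "n \<le> 16 * e 0 \<or> n \<le> 16 * e 1 \<or> n \<le> 16 * e 2 \<or> n \<le> 16 * e 3"
    by (smt (verit, best))
  then show ?thesis unfolding n_def e_def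
    by (elim disjE) (rule exI[of _ 0] exI[of _ 1] exI[of _ 2] exI[of _ 3]; simp)+
qed

section \<open>Finite sums of operators and their adjoints\<close>

definition op_sum :: "'i set \<Rightarrow> ('i \<Rightarrow> complex) \<Rightarrow> ('i \<Rightarrow> 'x op) \<Rightarrow> 'x op" where
  "op_sum I c A = (\<lambda>\<xi> x. \<Sum>i\<in>I. c i * A i \<xi> x)"

lemma op_sum_empty: "op_sum {} c A = op_zero"
  unfolding op_sum_def op_zero_def by simp

lemma op_sum_insert:
  "finite I \<Longrightarrow> i \<notin> I \<Longrightarrow> op_sum (insert i I) c A = op_lincomb (c i) (A i) 1 (op_sum I c A)"
  unfolding op_sum_def op_lincomb_def by simp

lemma cstar_sum:
  assumes "finite I" "\<And>i. i \<in> I \<Longrightarrow> A i \<in> cstar_qr"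
  shows "op_sum I c A \<in> cstar_qr"
  using assms by (induction I rule: finite_induct)
    (auto simp: op_sum_empty op_sum_insert intro: op_zero_cstar cstar_lincomb)

lemma comp_lincomb_right:
  assumes "bounded_op X R" "bounded_op X A" "bounded_op X B"
  shows "R \<circ> op_lincomb a A b B = op_lincomb a (R \<circ> A) b (R \<circ> B)"
  using bounded_op_lincomb_arg[OF assms(1) bounded_op_ell2[OF assms(2)] bounded_op_ell2[OF assms(3)]]
  unfolding op_lincomb_def by (simp add: fun_eq_iff)

lemma comp_lincomb_left: "op_lincomb a A b B \<circ> R = op_lincomb a (A \<circ> R) b (B \<circ> R)"
  unfolding op_lincomb_def by (simp add: fun_eq_iff)

lemma comp_op_sum:
  assumes "bounded_op X R" "finite I" "\<And>i. i \<in> I \<Longrightarrow> bounded_op X (A i)"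
  shows "R \<circ> op_sum I c A = op_sum I c (\<lambda>i. R \<circ> A i)"
proof
  fix \<xi>
  show "(R \<circ> op_sum I c A) \<xi> = op_sum I c (\<lambda>i. R \<circ> A i) \<xi>"
    using bounded_op_sum_arg[OF assms(1,2), of "\<lambda>i. A i \<xi>" c] bounded_op_ell2[OF assms(3)]
    unfolding op_sum_def by simp
qed

lemma adjoint_lincomb:
  assumes "bounded_op X A" "bounded_op X A'" "bounded_op X B" "bounded_op X B'"
    and "is_adjoint X A A'" "is_adjoint X B B'"
  shows "is_adjoint X (op_lincomb a A b B) (op_lincomb (cnj a) A' (cnj b) B')"
  unfolding is_adjoint_def
proof (intro ballI)
  fix \<xi> \<eta> :: "'a \<Rightarrow> complex" assume \<xi>: "\<xi> \<in> ell2 X" and \<eta>: "\<eta> \<in> ell2 X"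
  have "l2inner X (op_lincomb a A b B \<xi>) \<eta> = cnj a * l2inner X (A \<xi>) \<eta> + cnj b * l2inner X (B \<xi>) \<eta>"
    unfolding op_lincomb_def
    by (rule l2inner_lincomb_left[OF \<eta> bounded_op_ell2[OF assms(1)] bounded_op_ell2[OF assms(3)]])
  also have "\<dots> = cnj a * l2inner X \<xi> (A' \<eta>) + cnj b * l2inner X \<xi> (B' \<eta>)"
    using assms(5,6) \<xi> \<eta> unfolding is_adjoint_def by simp
  also have "\<dots> = l2inner X \<xi> (op_lincomb (cnj a) A' (cnj b) B' \<eta>)"
    unfolding op_lincomb_def
    using l2inner_lincomb_right[OF \<xi> bounded_op_ell2[OF assms(2)] bounded_op_ell2[OF assms(4)]] by simp
  finally show "l2inner X (op_lincomb a A b B \<xi>) \<eta> = l2inner X \<xi> (op_lincomb (cnj a) A' (cnj b) B' \<eta>)" .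
qed

lemma adjoint_id: "is_adjoint X (op_id X) (op_id X)"
  unfolding is_adjoint_def op_id_def by simp

lemma adjoint_zero: "is_adjoint X op_zero op_zero"
  unfolding is_adjoint_def op_zero_def l2inner_def by simp

lemma adjoint_real_sum:
  assumes "finite I" "\<And>i. i \<in> I \<Longrightarrow> A i \<in> cstar_qr \<and> is_adjoint TmodF (A i) (A i)"
  shows "is_adjoint TmodF (op_sum I (\<lambda>_. of_real r) A) (op_sum I (\<lambda>_. of_real r) A)"
  using assms
proof (induction I rule: finite_induct)
  case (insert i I)
  then have "op_sum I (\<lambda>_. of_real r) A \<in> cstar_qr" by (intro cstar_sum) auto
  then show ?case
    using insert adjoint_lincomb[of TmodF "A i" "A i" "op_sum I (\<lambda>_. of_real r) A" "op_sum I (\<lambda>_. of_real r) A" "of_real r" 1]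
    by (simp add: op_sum_insert cstar_bounded)
qed (simp add: op_sum_empty adjoint_zero)

section \<open>The averaging operator, its norm, and the inverse of the sum of Laplacians\<close>

definition displacement :: "(real \<Rightarrow> real) \<Rightarrow> (real \<Rightarrow> real) set op" where
  "displacement g = op_lincomb 1 (op_id TmodF) (-1) (quasireg g)"

text \<open>Equal to the product of the adjoint of 1 - g with 1 - g
  (\<open>displacement_comp_inv\<close>). The form as a sum of two displacements suits linear
  functionals and conjugation, the product form suits positivity.\<close>

definition laplace :: "(real \<Rightarrow> real) \<Rightarrow> (real \<Rightarrow> real) set op" where
  "laplace g = op_lincomb 1 (displacement g) 1 (displacement (inv g))"

lemma displacement_cstar: "g \<in> thompsonT \<Longrightarrow> displacement g \<in> cstar_qr"
  unfolding displacement_def by (intro cstar_lincomb op_id_cstar quasireg_cstar)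

lemma laplace_cstar: "g \<in> thompsonT \<Longrightarrow> laplace g \<in> cstar_qr"
  unfolding laplace_def by (intro cstar_lincomb displacement_cstar thompsonT_inv)

lemma displacement_adjoint:
  assumes g: "g \<in> thompsonT"
  shows "is_adjoint TmodF (displacement g) (displacement (inv g))"
proof -
  have "is_adjoint TmodF (op_lincomb 1 (op_id TmodF) (-1) (quasireg g))
      (op_lincomb (cnj 1) (op_id TmodF) (cnj (-1)) (quasireg (inv g)))"
    by (intro adjoint_lincomb bounded_op_id quasireg_bounded g thompsonT_inv adjoint_id quasireg_adjoint)
  then show ?thesis unfolding displacement_def by simp
qed

lemma op_lincomb_commute: "op_lincomb a A b B = op_lincomb b B a A"
  unfolding op_lincomb_def by (simp add: add.commute)

lemma laplace_adjoint:
  assumes g: "g \<in> thompsonT"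
  shows "is_adjoint TmodF (laplace g) (laplace g)"
proof -
  have "is_adjoint TmodF (op_lincomb 1 (displacement g) 1 (displacement (inv g)))
      (op_lincomb (cnj 1) (displacement (inv g)) (cnj 1) (displacement (inv (inv g))))"
    by (intro adjoint_lincomb cstar_bounded displacement_cstar displacement_adjoint g thompsonT_inv)
  then show ?thesis
    unfolding laplace_def thompsonT_inv_inv[OF g] by (simp add: op_lincomb_commute)
qed

lemma displacement_apply: "\<xi> \<in> ell2 TmodF \<Longrightarrow> displacement g \<xi> = (\<lambda>C. \<xi> C - quasireg g \<xi> C)"
  unfolding displacement_def op_lincomb_def op_id_def by (simp add: fun_eq_iff)

lemma displacement_comp_inv:
  assumes g: "g \<in> thompsonT"
  shows "displacement (inv g) \<circ> displacement g = laplace g"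
proof (rule bounded_op_eqI[of TmodF])
  show "bounded_op TmodF (displacement (inv g) \<circ> displacement g)" "bounded_op TmodF (laplace g)"
    using g by (auto intro!: cstar_bounded cstar_comp displacement_cstar laplace_cstar thompsonT_inv)
  fix \<xi> :: "(real \<Rightarrow> real) set \<Rightarrow> complex" assume \<xi>: "\<xi> \<in> ell2 TmodF"
  have g\<xi>: "quasireg g \<xi> \<in> ell2 TmodF" using quasireg_ell2(1)[OF g \<xi>] .
  have "quasireg (inv g) (\<lambda>C. \<xi> C - quasireg g \<xi> C) = (\<lambda>C. quasireg (inv g) \<xi> C - quasireg (inv g) (quasireg g \<xi>) C)"
    by (rule bounded_op_diff_arg[OF quasireg_bounded[OF thompsonT_inv[OF g]] \<xi> g\<xi>])
  moreover have "quasireg (inv g) (quasireg g \<xi>) = \<xi>"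
    using quasireg_inv_comp(2)[OF g] \<xi> by (metis comp_apply op_id_def)
  ultimately show "(displacement (inv g) \<circ> displacement g) \<xi> = laplace g \<xi>"
    using \<xi> ell2_diff(1)[OF \<xi> g\<xi>] by (simp add: displacement_apply laplace_def op_lincomb_def)
qed

text \<open>The average over the four values of k of (2 + c_k + c_k^-1)/4, that is, the operator of
  a lazy random walk. Laziness prevents spectrum near -1, so a lower bound on displacements alone
  makes the norm smaller than 1.\<close>

definition mean :: "(real \<Rightarrow> real) set op" where
  "mean = op_lincomb 1 (op_id TmodF) (-1)
     (op_sum {..<4} (\<lambda>_. of_real (1/16)) (\<lambda>k. laplace (contr_rot k)))"

lemma mean_cstar: "mean \<in> cstar_qr"
  unfolding mean_def by (intro cstar_lincomb op_id_cstar cstar_sum laplace_cstar contr_rot_thompsonT) auto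

lemma mean_adjoint: "is_adjoint TmodF mean mean"
proof -
  have "is_adjoint TmodF mean (op_lincomb (cnj 1) (op_id TmodF) (cnj (-1))
      (op_sum {..<4} (\<lambda>_. of_real (1/16)) (\<lambda>k. laplace (contr_rot k))))"
    unfolding mean_def
    by (intro adjoint_lincomb bounded_op_id adjoint_id adjoint_real_sum conjI cstar_bounded cstar_sum
        laplace_cstar laplace_adjoint contr_rot_thompsonT) auto
  then show ?thesis unfolding mean_def by simp
qed

lemma id_minus_mean:
  "op_lincomb 1 (op_id TmodF) (-1) mean = op_sum {..<4} (\<lambda>_. of_real (1/16)) (\<lambda>k. laplace (contr_rot k))"
  unfolding mean_def op_lincomb_def by (simp add: fun_eq_iff)

text \<open>\<open>mean\<close> applied to \<xi> is a sum of eight vectors \<xi> + g \<xi> of norm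
  at most 2 n, each with weight 1/16. A displacement of at least n/16 shortens one of them by n/1024
  through the parallelogram law, which after weighting saves n/16384.\<close>

lemma mean_bound: "op_bound TmodF mean (1 - 1/16384)"
  unfolding op_bound_def
proof (intro conjI ballI)
  fix \<xi> :: "(real \<Rightarrow> real) set \<Rightarrow> complex" assume \<xi>: "\<xi> \<in> ell2 TmodF"
  define n where "n = l2norm TmodF \<xi>"
  have n0: "n \<ge> 0" unfolding n_def by simp
  define P where "P g = (\<lambda>C. \<xi> C + quasireg g \<xi> C)" for g
  have P: "P g \<in> ell2 TmodF" "l2norm TmodF (P g) \<le> 2 * n" if "g \<in> thompsonT" for g
    unfolding P_def n_def
    using ell2_add[OF \<xi> quasireg_ell2(1)[OF that \<xi>]] l2norm_add[OF \<xi> quasireg_ell2(1)[OF that \<xi>]]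
      quasireg_ell2(2)[OF that \<xi>] by auto
  define Q where "Q k = (\<lambda>C. (1/16) * P (contr_rot k) C + (1/16) * P (inv (contr_rot k)) C)" for k
  have T: "contr_rot k \<in> thompsonT" "inv (contr_rot k) \<in> thompsonT" for k
    using contr_rot_thompsonT thompsonT_inv by auto
  have Qe: "Q k \<in> ell2 TmodF" for k
    unfolding Q_def by (intro ell2_add ell2_scale P T)
  have Qn: "l2norm TmodF (Q k) \<le> (l2norm TmodF (P (contr_rot k)) + l2norm TmodF (P (inv (contr_rot k)))) / 16" for k
    unfolding Q_def using l2norm_add[OF ell2_scale[OF P(1)[OF T(1)[of k]]] ell2_scale[OF P(1)[OF T(2)[of k]]], of "1/16" "1/16"]
    by (simp only: l2norm_scale) simp
  have eq: "mean \<xi> = (\<lambda>C. \<Sum>k<4. Q k C)"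
  proof
    fix C
    have "laplace (contr_rot k) \<xi> C = 4 * \<xi> C - 16 * Q k C" for k
      unfolding laplace_def op_lincomb_def displacement_apply[OF \<xi>] Q_def P_def by (simp add: algebra_simps)
    then have "mean \<xi> C = \<xi> C - (\<Sum>k<4. (1/16) * (4 * \<xi> C - 16 * Q k C))"
      unfolding mean_def using \<xi> by (simp add: op_lincomb_def op_id_def op_sum_def)
    also have "\<dots> = (\<Sum>k<4. Q k C)"
      by (simp add: sum_subtractf right_diff_distrib)
    finally show "mean \<xi> C = (\<Sum>k<4. Q k C)" .
  qed
  obtain k where k: "k < 4" "n \<le> 16 * l2norm TmodF (\<lambda>C. \<xi> C - quasireg (contr_rot k) \<xi> C)"
    using contr_rot_displacement[OF \<xi>] unfolding n_def by blast
  define d where "d = l2norm TmodF (\<lambda>C. \<xi> C - quasireg (contr_rot k) \<xi> C)"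
  have "(l2norm TmodF (P (contr_rot k)))\<^sup>2 + d\<^sup>2 = 4 * n\<^sup>2"
    using l2norm_parallelogram[OF \<xi> quasireg_ell2(1)[OF T(1) \<xi>], of k] quasireg_ell2(2)[OF T(1) \<xi>, of k]
    unfolding P_def n_def d_def by simp
  moreover have "n\<^sup>2 \<le> (16 * d)\<^sup>2" using k(2) n0 unfolding d_def by (intro power_mono)
  ultimately have "(l2norm TmodF (P (contr_rot k)))\<^sup>2 \<le> 4 * n\<^sup>2 - n\<^sup>2 / 256" by (simp add: power_mult_distrib)
  \<comment> \<open>The two sides differ by the square of n/1024; this completes the square before
    the root is taken.\<close>
  also have "\<dots> \<le> (2 * n - n / 1024)\<^sup>2" by (simp add: power2_eq_square algebra_simps)
  finally have Pk: "l2norm TmodF (P (contr_rot k)) \<le> 2 * n - n / 1024"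
    by (rule power2_le_imp_le) (use n0 in simp)
  have Qk: "l2norm TmodF (Q j) \<le> (if j = k then n / 4 - n / 16384 else n / 4)" for j
    using Qn[of j] P(2)[OF T(1), of j] P(2)[OF T(2), of j] Pk by auto
  have "l2norm TmodF (mean \<xi>) \<le> (\<Sum>j<4. l2norm TmodF (Q j))"
    unfolding eq by (intro ell2_sum Qe) auto
  also have "\<dots> \<le> (\<Sum>j<4. if j = k then n / 4 - n / 16384 else n / 4)"
    using Qk by (intro sum_mono)
  also have "\<dots> = (\<Sum>j<4. n / 4 - (if j = k then n / 16384 else 0))" by (intro sum.cong) auto
  also have "\<dots> = (1 - 1/16384) * n" using k(1) by (simp add: sum_subtractf)
  finally show "l2norm TmodF (mean \<xi>) \<le> (1 - 1/16384) * l2norm TmodF \<xi>" unfolding n_def .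
qed simp

definition resolvent :: "(real \<Rightarrow> real) set op" where
  "resolvent = neumann TmodF mean"

lemma resolvent_cstar: "resolvent \<in> cstar_qr"
proof (rule cstar_limit)
  note M = cstar_bounded[OF mean_cstar] mean_bound
  show "bounded_op TmodF resolvent" unfolding resolvent_def using neumann_bounded[OF M] by simp
  fix \<epsilon> :: real assume "\<epsilon> > 0"
  have "(\<lambda>n. (1 - 1/16384) ^ n / (1 - (1 - 1/16384))) \<longlonglongrightarrow> 0 / (1 - (1 - 1/16384 :: real))"
    by (intro tendsto_divide LIMSEQ_power_zero tendsto_const) auto
  then have "\<forall>\<^sub>F n in sequentially. (1 - 1/16384) ^ n / (1 - (1 - 1/16384)) < \<epsilon>"
    using \<open>\<epsilon> > 0\<close> by (intro order_tendstoD(2)) auto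
  then obtain n where "(1 - 1/16384) ^ n / (1 - (1 - 1/16384)) < \<epsilon>"
    using eventually_happens'[OF sequentially_bot] by blast
  moreover have "op_bound TmodF (op_diff resolvent (neumann_partial TmodF mean n)) ((1 - 1/16384) ^ n / (1 - (1 - 1/16384)))"
    unfolding resolvent_def using neumann_approx[OF M] by simp
  moreover have "neumann_partial TmodF mean n \<in> cstar_qr"
    by (induction n) (auto intro!: op_zero_cstar cstar_lincomb op_id_cstar cstar_comp mean_cstar)
  ultimately show "\<exists>A\<in>cstar_qr. op_bound TmodF (op_diff resolvent A) \<epsilon>"
    by (meson less_imp_le op_bound_mono)
qed

lemma resolvent_adjoint: "is_adjoint TmodF resolvent resolvent"
  unfolding resolvent_def using neumann_self_adjoint[OF cstar_bounded[OF mean_cstar] mean_bound _ mean_adjoint] by simp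

lemma resolvent_inverse:
  "resolvent \<circ> op_sum {..<4} (\<lambda>_. of_real (1/16)) (\<lambda>k. laplace (contr_rot k)) = op_id TmodF"
  using neumann_inverse[OF cstar_bounded[OF mean_cstar] mean_bound]
  unfolding id_minus_mean resolvent_def by simp

section \<open>Tracial states\<close>

definition supported_in :: "real set \<Rightarrow> (real \<Rightarrow> real) \<Rightarrow> bool" where
  "supported_in K f \<longleftrightarrow> (\<forall>x\<in>{0..<1}. x \<notin> K \<longrightarrow> f x = x)"

lemma supported_in_conjugate:
  assumes u: "u \<in> thompsonT" and f: "supported_in K f"
    and K: "\<And>x. x \<in> {0..<1} \<Longrightarrow> x \<in> K \<Longrightarrow> u x \<in> L"
  shows "supported_in L (conjugate u f)"
  unfolding supported_in_def
proof (intro ballI impI)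
  fix x :: real assume x: "x \<in> {0..<1}" "x \<notin> L"
  have i: "inv u x \<in> {0..<1}" "u (inv u x) = x"
    using thompsonT_range[OF thompsonT_inv[OF u] x(1)] thompsonT_inv_cancel(4)[OF u] by auto
  then have "inv u x \<notin> K" using K[of "inv u x"] x by auto
  then have "f (inv u x) = inv u x" using f i unfolding supported_in_def by blast
  then show "conjugate u f x = x" unfolding conjugate_def using i by simp
qed

lemma supported_in_comp:
  assumes "supported_in K f" "supported_in L g" "K \<subseteq> N" "L \<subseteq> N"
  shows "supported_in N (f \<circ> g)"
  using assms unfolding supported_in_def by (simp add: subset_iff) metis

lemma lcoset_supported:
  assumes f: "f \<in> thompsonT" "supported_in K f" and C: "C \<in> TmodF" "pt C \<notin> K"
  shows "lcoset f C = C" "lcoset (inv f) C = C"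
proof -
  have "f (pt C) = pt C" using f C pt_range[OF C(1)] unfolding supported_in_def by auto
  then show eq: "lcoset f C = C"
    using TmodF_eqI[OF lcoset_TmodF[OF f(1) C(1)] C(1)] pt_lcoset[OF C(1)] by simp
  show "lcoset (inv f) C = C" using lcoset_inv_cancel(1)[OF f(1), of C] eq by simp
qed

text \<open>Every orbit point is moved by at most one of \<open>f\<close> and \<open>g\<close>, so 1
  - f g = (1 - f) + (1 - g) as operators. This comes from the action on points; it is not an
  identity of the abstract group algebra.\<close>

lemma quasireg_disjoint_supports:
  assumes f: "f \<in> thompsonT" "supported_in K f" and g: "g \<in> thompsonT" "supported_in L g"
    and KL: "K \<inter> L = {}"
  shows "displacement (f \<circ> g) = op_lincomb 1 (displacement f) 1 (displacement g)"
proof (rule bounded_op_eqI[of TmodF])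
  show "bounded_op TmodF (displacement (f \<circ> g))" "bounded_op TmodF (op_lincomb 1 (displacement f) 1 (displacement g))"
    using f g by (auto intro!: cstar_bounded cstar_lincomb displacement_cstar thompsonT_comp)
  fix \<xi> :: "(real \<Rightarrow> real) set \<Rightarrow> complex" assume \<xi>: "\<xi> \<in> ell2 TmodF"
  show "displacement (f \<circ> g) \<xi> = op_lincomb 1 (displacement f) 1 (displacement g) \<xi>"
  proof
    fix C
    show "displacement (f \<circ> g) \<xi> C = op_lincomb 1 (displacement f) 1 (displacement g) \<xi> C"
    proof (cases "C \<in> TmodF")
      case C: True
      have inv: "lcoset (inv (f \<circ> g)) C = lcoset (inv g) (lcoset (inv f) C)"
        using f g thompsonT_bij by (simp add: o_inv_distrib lcoset_comp)
      have "\<xi> C - \<xi> (lcoset (inv (f \<circ> g)) C) = (\<xi> C - \<xi> (lcoset (inv f) C)) + (\<xi> C - \<xi> (lcoset (inv g) C))"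
      proof (cases "pt C \<in> K")
        case False
        then show ?thesis unfolding inv using lcoset_supported(2)[OF f C] by simp
      next
        case True
        let ?D = "lcoset (inv f) C"
        have D: "?D \<in> TmodF" using C f thompsonT_inv lcoset_TmodF by blast
        have "pt ?D \<in> K"
        proof (rule ccontr)
          assume "pt ?D \<notin> K"
          then have "lcoset f ?D = ?D" using lcoset_supported(1)[OF f D] by blast
          then show False using \<open>pt ?D \<notin> K\<close> True lcoset_inv_cancel(2)[OF f(1)] by simp
        qed
        then have "lcoset (inv g) ?D = ?D" using lcoset_supported(2)[OF g D] KL by blast
        moreover have "lcoset (inv g) C = C" using lcoset_supported(2)[OF g C] KL True by blast
        ultimately show ?thesis unfolding inv by simp
      qed
      then show ?thesis
        using C \<xi> by (simp add: op_lincomb_def displacement_apply quasireg_apply)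
    next
      case False
      then have "\<xi> C = 0" using \<xi> unfolding ell2_def by blast
      then show ?thesis
        using False \<xi> by (simp add: op_lincomb_def displacement_apply quasireg_notin)
    qed
  qed
qed

text \<open>Fixes [0,1/4) and halves [1/4,3/4) onto [1/4,1/2). It brings the support [0,3/4) of
  \<open>contr\<close> into the interval on which \<open>contr\<close> halves; powers of
  \<open>contr\<close> alone map [0,3/4) onto itself.\<close>

definition squeeze :: "real \<Rightarrow> real" where
  "squeeze = conjugate rot contr"

lemma squeeze_thompsonT: "squeeze \<in> thompsonT"
  unfolding squeeze_def by (intro conjugate_thompsonT rot_thompsonT contr_thompsonT)

lemma squeeze_range:
  assumes "x \<in> {0..<3/4}"
  shows "squeeze x \<in> {0..<1/2}"
proof -
  define y where "y = inv rot x"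
  have y: "0 \<le> y" "y < 1" "rot y = x"
    using thompsonT_range[OF thompsonT_inv[OF rot_thompsonT], of x] assms
      thompsonT_inv_cancel(4)[OF rot_thompsonT] unfolding y_def by auto
  have "rot (contr y) \<in> {0..<1/2}"
    using y assms unfolding rot_def contr_def by (auto split: if_splits)
  then show ?thesis unfolding squeeze_def conjugate_def y_def by simp
qed

lemma contr_supported: "supported_in {0..<3/4} contr"
  unfolding supported_in_def contr_def by auto

section \<open>Consequences of a trace on the algebra\<close>

locale trace =
  fixes \<tau> :: "(real \<Rightarrow> real) set op \<Rightarrow> complex"
  assumes tracial: "tracial_state TmodF cstar_qr \<tau>"
begin

lemma lincomb: "A \<in> cstar_qr \<Longrightarrow> B \<in> cstar_qr \<Longrightarrow> \<tau> (op_lincomb a A b B) = a * \<tau> A + b * \<tau> B"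
  using tracial unfolding tracial_state_def by blast

lemma unit: "\<tau> (op_id TmodF) = 1"
  using tracial unfolding tracial_state_def by blast

lemma commute: "A \<in> cstar_qr \<Longrightarrow> B \<in> cstar_qr \<Longrightarrow> \<tau> (A \<circ> B) = \<tau> (B \<circ> A)"
  using tracial unfolding tracial_state_def by blast

lemma positive:
  assumes "A \<in> cstar_qr" "B \<in> cstar_qr" "is_adjoint TmodF A B"
  shows "Im (\<tau> (B \<circ> A)) = 0" "Re (\<tau> (B \<circ> A)) \<ge> 0"
  using tracial assms cstar_bounded[OF assms(2)] unfolding tracial_state_def by blast+

lemma sum:
  assumes "finite I" "\<And>i. i \<in> I \<Longrightarrow> A i \<in> cstar_qr"
  shows "\<tau> (op_sum I c A) = (\<Sum>i\<in>I. c i * \<tau> (A i))"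
  using assms
proof (induction I rule: finite_induct)
  case empty
  have "op_zero = op_lincomb 0 (op_id TmodF) 0 (op_id TmodF)"
    unfolding op_zero_def op_lincomb_def by simp
  then show ?case using lincomb[OF op_id_cstar op_id_cstar, of 0 0] by (simp add: op_sum_empty)
next
  case (insert i I)
  then have "op_sum I c A \<in> cstar_qr" by (intro cstar_sum) auto
  then show ?case using insert by (simp add: op_sum_insert lincomb)
qed

lemma displacement:
  assumes "g \<in> thompsonT" shows "\<tau> (displacement g) = 1 - \<tau> (quasireg g)"
  unfolding displacement_def using lincomb[OF op_id_cstar quasireg_cstar[OF assms]] unit by simp

lemma laplace:
  assumes g: "g \<in> thompsonT" shows "\<tau> (laplace g) = 2 - \<tau> (quasireg g) - \<tau> (quasireg (inv g))"
  unfolding laplace_def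
  using lincomb[OF displacement_cstar[OF g] displacement_cstar[OF thompsonT_inv[OF g]], of 1 1]
    displacement[OF g] displacement[OF thompsonT_inv[OF g]] by simp

lemma laplace_nonneg:
  assumes g: "g \<in> thompsonT" shows "Im (\<tau> (laplace g)) = 0" "Re (\<tau> (laplace g)) \<ge> 0"
  using positive[OF displacement_cstar[OF g] displacement_cstar[OF thompsonT_inv[OF g]] displacement_adjoint[OF g]]
  unfolding displacement_comp_inv[OF g] by auto

text \<open>4 - (2 - g - g^-1) is the product of the adjoint of 1 + g with 1 + g, hence has
  nonnegative trace. The bound is uniform in \<open>g\<close>, which is what repeated doubling
  contradicts.\<close>

lemma laplace_le:
  assumes g: "g \<in> thompsonT" shows "Re (\<tau> (laplace g)) \<le> 4"
proof -
  note gi = thompsonT_inv[OF g]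
  define A where "A = op_lincomb 1 (op_id TmodF) 1 (quasireg g)"
  define B where "B = op_lincomb 1 (op_id TmodF) 1 (quasireg (inv g))"
  have AB: "A \<in> cstar_qr" "B \<in> cstar_qr"
    unfolding A_def B_def by (intro cstar_lincomb op_id_cstar quasireg_cstar g gi)+
  have "is_adjoint TmodF A (op_lincomb (cnj 1) (op_id TmodF) (cnj 1) (quasireg (inv g)))"
    unfolding A_def
    by (intro adjoint_lincomb bounded_op_id quasireg_bounded g gi adjoint_id quasireg_adjoint)
  then have "is_adjoint TmodF A B" unfolding B_def by simp
  then have pos: "Re (\<tau> (B \<circ> A)) \<ge> 0" using positive(2) AB by blast
  have "B \<circ> A = op_lincomb 1 A 1 B"
  proof -
    have "op_id TmodF \<circ> A = A" by (rule op_id_comp(1)[OF cstar_bounded[OF AB(1)]])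
    moreover have "quasireg (inv g) \<circ> A = B"
    proof -
      have "quasireg (inv g) \<circ> A = op_lincomb 1 (quasireg (inv g) \<circ> op_id TmodF) 1 (quasireg (inv g) \<circ> quasireg g)"
      unfolding A_def by (rule comp_lincomb_right[OF quasireg_bounded[OF gi] bounded_op_id quasireg_bounded[OF g]])
    also have "\<dots> = B"
      unfolding B_def quasireg_inv_comp(2)[OF g] op_id_comp(2)[OF quasireg_bounded[OF gi]]
      by (rule op_lincomb_commute)
    finally show ?thesis .
    qed
    ultimately show ?thesis
      unfolding B_def comp_lincomb_left by simp
  qed
  then have "\<tau> (B \<circ> A) = 2 + \<tau> (quasireg g) + \<tau> (quasireg (inv g))"
    using lincomb[OF AB, of 1 1] lincomb[OF op_id_cstar quasireg_cstar[OF g], of 1 1]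
      lincomb[OF op_id_cstar quasireg_cstar[OF gi], of 1 1] unit unfolding A_def B_def by simp
  then show ?thesis using pos laplace[OF g] by simp
qed

lemma conjugate:
  assumes u: "u \<in> thompsonT" and f: "f \<in> thompsonT"
  shows "\<tau> (quasireg (conjugate u f)) = \<tau> (quasireg f)"
proof -
  have "\<tau> (quasireg u \<circ> quasireg f \<circ> quasireg (inv u)) = \<tau> (quasireg (inv u) \<circ> (quasireg u \<circ> quasireg f))"
    using u f by (intro commute cstar_comp quasireg_cstar thompsonT_inv)
  also have "quasireg (inv u) \<circ> (quasireg u \<circ> quasireg f) = quasireg f"
    using quasireg_inv_comp(2)[OF u] op_id_comp(1)[OF quasireg_bounded[OF f]] by (simp flip: comp_assoc)
  finally show ?thesis unfolding quasireg_conjugate[OF u f] .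
qed

lemma laplace_conjugate:
  assumes u: "u \<in> thompsonT" and f: "f \<in> thompsonT"
  shows "\<tau> (laplace (conjugate u f)) = \<tau> (laplace f)"
  using assms by (simp add: laplace conjugate_thompsonT inv_conjugate conjugate thompsonT_inv)

lemma laplace_disjoint_supports:
  assumes f: "f \<in> thompsonT" "supported_in K f" and g: "g \<in> thompsonT" "supported_in L g"
    and KL: "K \<inter> L = {}"
  shows "\<tau> (laplace (f \<circ> g)) = \<tau> (laplace f) + \<tau> (laplace g)"
proof -
  have sinv: "supported_in K (inv f)" if "f \<in> thompsonT" "supported_in K f" for K f
    using that thompsonT_inv_cancel(3) unfolding supported_in_def by metis
  have inv: "inv (f \<circ> g) = inv g \<circ> inv f" using f g thompsonT_bij by (simp add: o_inv_distrib)
  have d: "\<tau> (displacement (f \<circ> g)) = \<tau> (displacement f) + \<tau> (displacement g)"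
    if "f \<in> thompsonT" "supported_in K f" "g \<in> thompsonT" "supported_in L g" "K \<inter> L = {}" for f g K L
    using quasireg_disjoint_supports[OF that] lincomb[OF displacement_cstar[OF that(1)] displacement_cstar[OF that(3)], of 1 1]
    by simp
  have l: "\<tau> (laplace h) = \<tau> (displacement h) + \<tau> (displacement (inv h))" if "h \<in> thompsonT" for h
    unfolding laplace_def using lincomb[OF displacement_cstar[OF that] displacement_cstar[OF thompsonT_inv[OF that]], of 1 1] by simp
  show ?thesis
    using d[OF f g KL] d[OF thompsonT_inv[OF g(1)] sinv[OF g] thompsonT_inv[OF f(1)] sinv[OF f]] KL
      l[OF f(1)] l[OF g(1)] l[OF thompsonT_comp[OF f(1) g(1)]] unfolding inv by (simp add: Int_commute)
qed

text \<open>Two conjugates of \<open>f\<close> sit in the disjoint quarters [0,1/4) and [1/4,1/2)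
  and contribute equally. Their product is again supported in [0,3/4), so the construction can be
  iterated.\<close>

lemma laplace_doubling:
  assumes f: "f \<in> thompsonT" "supported_in {0..<3/4} f"
  shows "\<exists>h\<in>thompsonT. supported_in {0..<3/4} h \<and> \<tau> (laplace h) = 2 * \<tau> (laplace f)"
proof -
  \<comment> \<open>\<open>squeeze\<close> brings the arc into the first half, \<open>contr\<close>
    from there into the first quarter, and \<open>rot\<close> moves that on to the second
    quarter.\<close>
  define u where "u = contr \<circ> squeeze"
  define v where "v = rot \<circ> u"
  have T: "u \<in> thompsonT" "v \<in> thompsonT"
    unfolding u_def v_def by (intro thompsonT_comp contr_thompsonT rot_thompsonT squeeze_thompsonT)+
  have ur: "u x \<in> {0..<1/4}" if "x \<in> {0..<3/4}" for x
    using squeeze_range[OF that] unfolding u_def contr_def by auto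
  then have vr: "v x \<in> {1/4..<1/2}" if "x \<in> {0..<3/4}" for x
    using that unfolding v_def rot_def by force
  have s: "supported_in {0..<1/4} (conjugate u f)" "supported_in {1/4..<1/2} (conjugate v f)"
    using supported_in_conjugate[OF T(1) f(2)] supported_in_conjugate[OF T(2) f(2)] ur vr by auto
  have c: "conjugate u f \<in> thompsonT" "conjugate v f \<in> thompsonT"
    using T f by (auto intro: conjugate_thompsonT)
  have "\<tau> (laplace (conjugate u f \<circ> conjugate v f)) = 2 * \<tau> (laplace f)"
    using laplace_disjoint_supports[OF c(1) s(1) c(2) s(2)] laplace_conjugate[OF T(1) f(1)]
      laplace_conjugate[OF T(2) f(1)] by auto
  moreover have "supported_in {0..<3/4} (conjugate u f \<circ> conjugate v f)"
    using s by (rule supported_in_comp) auto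
  ultimately show ?thesis using thompsonT_comp[OF c] by blast
qed

lemma laplace_supported_zero:
  assumes f: "f \<in> thompsonT" "supported_in {0..<3/4} f"
  shows "\<tau> (laplace f) = 0"
proof -
  have "\<exists>h\<in>thompsonT. supported_in {0..<3/4} h \<and> \<tau> (laplace h) = 2 ^ n * \<tau> (laplace f)" for n
  proof (induction n)
    case (Suc n)
    then obtain h where h: "h \<in> thompsonT" "supported_in {0..<3/4} h" "\<tau> (laplace h) = 2 ^ n * \<tau> (laplace f)" by blast
    then show ?case using laplace_doubling[OF h(1,2)] by (simp add: mult.assoc)
  qed (use f in auto)
  then have "Re (2 ^ n * \<tau> (laplace f)) \<le> 4" for n using laplace_le by metis
  moreover have "Re (2 ^ n * \<tau> (laplace f)) = 2 ^ n * Re (\<tau> (laplace f))" for n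
  proof -
    have "Re (complex_of_real r * z) = r * Re z" for r z by simp
    from this[of "2 ^ n"] show ?thesis by simp
  qed
  ultimately have le: "2 ^ n * Re (\<tau> (laplace f)) \<le> 4" for n by metis
  have "Re (\<tau> (laplace f)) = 0"
  proof (rule ccontr)
    assume "Re (\<tau> (laplace f)) \<noteq> 0"
    then have pos: "Re (\<tau> (laplace f)) > 0" using laplace_nonneg(2)[OF f(1)] by simp
    obtain n where "4 / Re (\<tau> (laplace f)) < 2 ^ n" using real_arch_pow[of 2] by fastforce
    then have "4 < 2 ^ n * Re (\<tau> (laplace f))" using pos by (simp add: field_simps)
    then show False using le[of n] by simp
  qed
  then show ?thesis using laplace_nonneg(1)[OF f(1)] by (simp add: complex_eq_iff)
qed

text \<open>Cauchy--Schwarz for the form \<open>\<tau>(B\<^sup>* A)\<close>, in the degenerate case: a null vector is orthogonal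
  to everything.\<close>
lemma null_displacement:
  assumes g: "g \<in> thompsonT" and null: "\<tau> (laplace g) = 0"
    and R: "R \<in> cstar_qr" "is_adjoint TmodF R R"
  shows "\<tau> (R \<circ> displacement g) = 0"
proof -
  note gi = thompsonT_inv[OF g]
  define z where "z = displacement g"
  define z' where "z' = displacement (inv g)"
  have z: "z \<in> cstar_qr" "z' \<in> cstar_qr" "is_adjoint TmodF z z'"
    unfolding z_def z'_def using displacement_cstar displacement_adjoint g gi by auto
  note b = cstar_bounded[OF z(1)] cstar_bounded[OF z(2)] cstar_bounded[OF R(1)]
  define p q s where "p = \<tau> (z' \<circ> R)" and "q = \<tau> (R \<circ> z)" and "s = \<tau> (R \<circ> R)"
  have s: "Im s = 0" "Re s \<ge> 0" using positive[OF R(1) R] unfolding s_def by auto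
  \<comment> \<open>Positivity of the product of the adjoint of \<open>z + c R\<close> with
    \<open>z + c R\<close>: the term free of \<open>c\<close> vanishes by \<open>null\<close>, so a
    linear part and the quadratic part with coefficient \<open>s\<close> remain.\<close>
  have form: "Im (c * p + cnj c * q) = 0" "Re (c * p + cnj c * q) \<ge> - (cmod c)\<^sup>2 * Re s" for c
  proof -
    define A where "A = op_lincomb 1 z c R"
    define B where "B = op_lincomb 1 z' (cnj c) R"
    have AB: "A \<in> cstar_qr" "B \<in> cstar_qr" unfolding A_def B_def using z R by (auto intro: cstar_lincomb)
    have "is_adjoint TmodF A (op_lincomb (cnj 1) z' (cnj c) R)"
      unfolding A_def using z R b by (intro adjoint_lincomb)
    then have pos: "Im (\<tau> (B \<circ> A)) = 0" "Re (\<tau> (B \<circ> A)) \<ge> 0"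
      using positive[OF AB] unfolding B_def by auto
    have 1: "\<tau> (B \<circ> A) = \<tau> (z' \<circ> A) + cnj c * \<tau> (R \<circ> A)"
      unfolding B_def comp_lincomb_left using lincomb[OF cstar_comp[OF z(2) AB(1)] cstar_comp[OF R(1) AB(1)], of 1 "cnj c"] by simp
    have 2: "\<tau> (z' \<circ> A) = \<tau> (z' \<circ> z) + c * p"
      unfolding A_def comp_lincomb_right[OF b(2,1,3)] p_def
      using lincomb[OF cstar_comp[OF z(2,1)] cstar_comp[OF z(2) R(1)], of 1 c] by simp
    have 3: "z' \<circ> z = laplace g" unfolding z_def z'_def by (rule displacement_comp_inv[OF g])
    have 4: "\<tau> (R \<circ> A) = q + c * s"
      unfolding A_def comp_lincomb_right[OF b(3,1,3)] q_def s_def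
      using lincomb[OF cstar_comp[OF R(1) z(1)] cstar_comp[OF R(1) R(1)], of 1 c] by simp
    have eq: "\<tau> (B \<circ> A) = (c * p + cnj c * q) + (cnj c * c) * s"
      unfolding 1 2 3 4 null by (simp add: algebra_simps)
    have cc: "cnj c * c = complex_of_real ((cmod c)\<^sup>2)"
      by (simp add: complex_norm_square mult.commute del: of_real_power)
    show "Im (c * p + cnj c * q) = 0" "Re (c * p + cnj c * q) \<ge> - (cmod c)\<^sup>2 * Re s"
      using pos s unfolding eq cc by auto
  qed
  have nonneg: "Re (c * p + cnj c * q) \<ge> 0" for c
  proof (rule ccontr)
    assume neg: "\<not> 0 \<le> Re (c * p + cnj c * q)"
    define F where "F = Re (c * p + cnj c * q)"
    have F: "F < 0" using neg unfolding F_def by simp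
    \<comment> \<open>The added 1 keeps \<open>K\<close> positive when the quadratic coefficient is
      0. At \<open>t = - F / K\<close> the negative linear term outweighs the quadratic one.\<close>
    define K where "K = (cmod c)\<^sup>2 * Re s + 1"
    have K: "K > 0" unfolding K_def using s by (simp add: add_nonneg_pos)
    define t where "t = - F / K"
    have t: "t > 0" unfolding t_def using F K by (simp add: divide_neg_pos)
    have "Re (of_real t * c * p + cnj (of_real t * c) * q) = t * F"
      unfolding F_def by (simp add: algebra_simps)
    moreover have "(cmod (of_real t * c))\<^sup>2 = t\<^sup>2 * (cmod c)\<^sup>2" by (simp add: norm_mult power_mult_distrib)
    ultimately have "t * F \<ge> - (t\<^sup>2 * (cmod c)\<^sup>2) * Re s" using form(2)[of "of_real t * c"] by simp
    then have "t * (- F) \<le> t * (t * ((cmod c)\<^sup>2 * Re s))" by (simp add: power2_eq_square algebra_simps)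
    then have "- F \<le> t * ((cmod c)\<^sup>2 * Re s)" using t by (rule mult_left_le_imp_le)
    also have "\<dots> < t * K" unfolding K_def using t by simp
    also have "\<dots> = - F" unfolding t_def using K by simp
    finally show False by simp
  qed
  have zero: "c * p + cnj c * q = 0" for c
    using nonneg[of c] nonneg[of "- c"] form(1)[of c] by (simp add: complex_eq_iff)
  \<comment> \<open>Two phases are enough: \<open>c = 1\<close> gives p = - q and
    \<open>c = \<i>\<close> gives p = q.\<close>
  have "p + q = 0" using zero[of 1] by simp
  moreover have "p = q" using zero[of \<i>] by simp
  ultimately show ?thesis unfolding q_def z_def by simp
qed

lemma absurd: False
proof -
  have null: "\<tau> (laplace (contr_rot k)) = 0" for k
    unfolding contr_rot_def
    using laplace_conjugate[OF thompsonT_inv[OF rot_pow_thompsonT] contr_thompsonT]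
      laplace_supported_zero[OF contr_thompsonT contr_supported] by simp
  have R: "\<tau> (resolvent \<circ> laplace (contr_rot k)) = 0" for k
  proof -
    let ?g = "contr_rot k"
    have T: "?g \<in> thompsonT" "inv ?g \<in> thompsonT" using contr_rot_thompsonT thompsonT_inv by auto
    \<comment> \<open>\<open>laplace\<close> is symmetric in the element and its inverse, so the
      orthogonality of null vectors applies to both displacements that make it up.\<close>
    have "laplace (inv ?g) = laplace ?g"
      unfolding laplace_def thompsonT_inv_inv[OF T(1)] by (rule op_lincomb_commute)
    then have "\<tau> (resolvent \<circ> displacement (inv ?g)) = 0" "\<tau> (resolvent \<circ> displacement ?g) = 0"
      using null_displacement[OF T(2) _ resolvent_cstar resolvent_adjoint]
        null_displacement[OF T(1) _ resolvent_cstar resolvent_adjoint] null[of k] by auto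
    moreover have "resolvent \<circ> laplace ?g = op_lincomb 1 (resolvent \<circ> displacement ?g) 1 (resolvent \<circ> displacement (inv ?g))"
      unfolding laplace_def
      by (rule comp_lincomb_right[OF cstar_bounded[OF resolvent_cstar]
            cstar_bounded[OF displacement_cstar[OF T(1)]] cstar_bounded[OF displacement_cstar[OF T(2)]]])
    ultimately show ?thesis
      using lincomb[OF cstar_comp[OF resolvent_cstar displacement_cstar[OF T(1)]] cstar_comp[OF resolvent_cstar displacement_cstar[OF T(2)]], of 1 1]
      by simp
  qed
  have "op_id TmodF = op_sum {..<4} (\<lambda>_. of_real (1/16)) (\<lambda>k. resolvent \<circ> laplace (contr_rot k))"
    unfolding resolvent_inverse[symmetric]
    by (rule comp_op_sum[of TmodF])
      (auto intro: cstar_bounded resolvent_cstar laplace_cstar contr_rot_thompsonT)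
  then have "1 = \<tau> (op_sum {..<4} (\<lambda>_. of_real (1/16)) (\<lambda>k. resolvent \<circ> laplace (contr_rot k)))"
    using unit by simp
  also have "\<dots> = 0"
    using R by (subst sum) (auto intro!: cstar_comp resolvent_cstar laplace_cstar contr_rot_thompsonT)
  finally show False by simp
qed

end

lemma no_tracial_state: "\<not> tracial_state TmodF cstar_qr \<tau>"
  using trace.absurd trace.intro by blast

section \<open>Compression to small arcs\<close>

text \<open>Vectors in the range of \<open>displacement (inv p)\<close> vanish off \<open>K\<close>,
  and \<open>f\<close> acts trivially on such vectors. What remains is (1 - p)(1 - p^-1) = 2 - p -
  p^-1.\<close>

lemma compress_fixing:
  assumes f: "f \<in> thompsonT" and p: "p \<in> thompsonT" "supported_in K p"
    and fix_K: "\<And>y. y \<in> {0..<1} \<Longrightarrow> y \<in> K \<Longrightarrow> f y = y"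
  shows "displacement p \<circ> quasireg f \<circ> displacement (inv p) = laplace p"
proof -
  note pinv = thompsonT_inv[OF p(1)]
  have inv_inv: "inv (inv p) = p" by (rule thompsonT_inv_inv[OF p(1)])
  have bd: "bounded_op TmodF (displacement p)" "bounded_op TmodF (displacement (inv p))" "bounded_op TmodF (quasireg f)"
    using p pinv f by (auto intro: cstar_bounded displacement_cstar quasireg_bounded)
  have "quasireg f \<circ> displacement (inv p) = displacement (inv p)"
  proof (rule bounded_op_eqI[OF bounded_op_comp[OF bd(3,2)] bd(2)])
    fix \<xi> :: "(real \<Rightarrow> real) set \<Rightarrow> complex" assume \<xi>: "\<xi> \<in> ell2 TmodF"
    define w where "w = displacement (inv p) \<xi>"
    have w: "w \<in> ell2 TmodF" unfolding w_def using bounded_op_ell2[OF bd(2)] .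
    have w0: "w C = 0" if "C \<in> TmodF" "pt C \<notin> K" for C
      using lcoset_supported(1)[OF p that] that \<xi>
      unfolding w_def by (simp add: displacement_apply quasireg_apply inv_inv)
    have "quasireg f w C = w C" for C
    proof (cases "C \<in> TmodF")
      case C: True
      let ?D = "lcoset (inv f) C"
      have D: "?D \<in> TmodF" using lcoset_TmodF[OF thompsonT_inv[OF f] C] .
      have fD: "f (pt ?D) = pt C" using pt_lcoset[OF D, of f] lcoset_inv_cancel(2)[OF f] by simp
      have "w ?D = w C"
      proof (cases "pt ?D \<in> K")
        case True
        then have "pt ?D = pt C" using fix_K[of "pt ?D"] pt_range[OF D] fD by simp
        then show ?thesis using TmodF_eqI[OF D C] by simp
      next
        case False
        have "pt C \<notin> K"
        proof
          assume "pt C \<in> K"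
          then have "f (pt C) = f (pt ?D)" using fix_K[of "pt C"] pt_range[OF C] fD by simp
          then have "pt C = pt ?D" using thompsonT_inv_cancel(3)[OF f] by metis
          then show False using False \<open>pt C \<in> K\<close> by simp
        qed
        then show ?thesis using w0[OF D False] w0[OF C] by simp
      qed
      then show ?thesis using quasireg_apply[OF w C] by simp
    next
      case False
      then show ?thesis using w quasireg_notin unfolding ell2_def by auto
    qed
    then show "(quasireg f \<circ> displacement (inv p)) \<xi> = displacement (inv p) \<xi>"
      unfolding w_def by (simp add: fun_eq_iff)
  qed
  then have "displacement p \<circ> quasireg f \<circ> displacement (inv p) = displacement p \<circ> displacement (inv p)"
    by (simp add: comp_assoc)
  also have "\<dots> = laplace p"
    using displacement_comp_inv[OF pinv] unfolding inv_inv laplace_def by (simp add: op_lincomb_commute)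
  finally show ?thesis .
qed

text \<open>Once \<open>f\<close> has moved the arc away, the vector vanishes on \<open>K\<close>;
  and 1 - p annihilates every vector that vanishes on \<open>K\<close>, because \<open>p\<close>
  preserves \<open>K\<close> and fixes the other points.\<close>

lemma compress_moving:
  assumes f: "f \<in> thompsonT" and p: "p \<in> thompsonT" "supported_in K p"
    and move_K: "\<And>y. y \<in> {0..<1} \<Longrightarrow> y \<in> K \<Longrightarrow> f y \<notin> K"
  shows "displacement p \<circ> quasireg f \<circ> displacement (inv p) = op_zero"
proof -
  note pinv = thompsonT_inv[OF p(1)]
  have inv_inv: "inv (inv p) = p" by (rule thompsonT_inv_inv[OF p(1)])
  have bd: "bounded_op TmodF (displacement p)" "bounded_op TmodF (displacement (inv p))" "bounded_op TmodF (quasireg f)"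
    using p pinv f by (auto intro: cstar_bounded displacement_cstar quasireg_bounded)
  show ?thesis
  proof (rule bounded_op_eqI[OF bounded_op_comp[OF bounded_op_comp[OF bd(1,3)] bd(2)] bounded_op_zero])
    fix \<xi> :: "(real \<Rightarrow> real) set \<Rightarrow> complex" assume \<xi>: "\<xi> \<in> ell2 TmodF"
    define w where "w = displacement (inv p) \<xi>"
    have w: "w \<in> ell2 TmodF" unfolding w_def using bounded_op_ell2[OF bd(2)] .
    have w0: "w C = 0" if "C \<in> TmodF" "pt C \<notin> K" for C
      using lcoset_supported(1)[OF p that] that \<xi>
      unfolding w_def by (simp add: displacement_apply quasireg_apply inv_inv)
    define v where "v = quasireg f w"
    have v: "v \<in> ell2 TmodF" unfolding v_def using bounded_op_ell2[OF bd(3)] .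
    have v0: "v C = 0" if C: "C \<in> TmodF" and K: "pt C \<in> K" for C
    proof -
      let ?D = "lcoset (inv f) C"
      have D: "?D \<in> TmodF" using lcoset_TmodF[OF thompsonT_inv[OF f] C] .
      have "f (pt ?D) = pt C" using pt_lcoset[OF D, of f] lcoset_inv_cancel(2)[OF f] by simp
      then have "pt ?D \<notin> K" using move_K[of "pt ?D"] pt_range[OF D] K by auto
      then show ?thesis using w0[OF D] quasireg_apply[OF w C] unfolding v_def by simp
    qed
    have "displacement p v C = 0" for C
    proof (cases "C \<in> TmodF")
      case C: True
      let ?D = "lcoset (inv p) C"
      have D: "?D \<in> TmodF" using lcoset_TmodF[OF pinv C] .
      have "v C = v ?D"
      proof (cases "pt C \<in> K")
        case True
        have "pt ?D \<in> K"
        proof (rule ccontr)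
          assume "pt ?D \<notin> K"
          then have "lcoset p ?D = ?D" using lcoset_supported(1)[OF p D] by blast
          then show False using \<open>pt ?D \<notin> K\<close> True lcoset_inv_cancel(2)[OF p(1)] by simp
        qed
        then show ?thesis using v0[OF C True] v0[OF D] by simp
      next
        case False
        then show ?thesis using lcoset_supported(2)[OF p C] by simp
      qed
      then show ?thesis using v C by (simp add: displacement_apply quasireg_apply)
    next
      case False
      then show ?thesis using bounded_op_ell2[OF bd(1), of v] unfolding ell2_def by blast
    qed
    then show "(displacement p \<circ> quasireg f \<circ> displacement (inv p)) \<xi> = op_zero \<xi>"
      unfolding v_def w_def op_zero_def by (simp add: fun_eq_iff)
  qed
qed

lemma op_sum_comp: "op_sum I c A \<circ> B = op_sum I c (\<lambda>i. A i \<circ> B)"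
  unfolding op_sum_def by (simp add: fun_eq_iff)

text \<open>\<open>P\<close> picks out the terms which \<open>h\<close> brings back to the identity
  on \<open>K\<close>; all others are killed. In the application the surviving coefficients add up
  to a single matrix coefficient.\<close>

lemma compress_group_alg:
  assumes S: "finite S" "S \<subseteq> thompsonT" and h: "h \<in> thompsonT" and p: "p \<in> thompsonT" "supported_in K p"
    and fix_K: "\<And>g y. g \<in> S \<Longrightarrow> P g \<Longrightarrow> y \<in> {0..<1} \<Longrightarrow> y \<in> K \<Longrightarrow> h (g y) = y"
    and move_K: "\<And>g y. g \<in> S \<Longrightarrow> \<not> P g \<Longrightarrow> y \<in> {0..<1} \<Longrightarrow> y \<in> K \<Longrightarrow> h (g y) \<notin> K"
  shows "displacement p \<circ> (quasireg h \<circ> op_sum S c quasireg) \<circ> displacement (inv p) =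
    (\<lambda>\<xi> C. (\<Sum>g\<in>{g\<in>S. P g}. c g) * laplace p \<xi> C)"
proof -
  have bq: "bounded_op TmodF (quasireg g)" if "g \<in> S" for g using S that quasireg_bounded by blast
  have bh: "bounded_op TmodF (quasireg h)" using h by (rule quasireg_bounded)
  have bp: "bounded_op TmodF (displacement p)" using p by (intro cstar_bounded displacement_cstar)
  have "quasireg h \<circ> op_sum S c quasireg = op_sum S c (\<lambda>g. quasireg h \<circ> quasireg g)"
    using bh S(1) bq by (rule comp_op_sum)
  then have "displacement p \<circ> (quasireg h \<circ> op_sum S c quasireg) =
      op_sum S c (\<lambda>g. displacement p \<circ> (quasireg h \<circ> quasireg g))"
    using comp_op_sum[OF bp S(1), of "\<lambda>g. quasireg h \<circ> quasireg g" c] bounded_op_comp[OF bh bq] by simp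
  then have eq: "displacement p \<circ> (quasireg h \<circ> op_sum S c quasireg) \<circ> displacement (inv p) =
      op_sum S c (\<lambda>g. displacement p \<circ> (quasireg h \<circ> quasireg g) \<circ> displacement (inv p))"
    by (simp add: op_sum_comp)
  have g: "displacement p \<circ> (quasireg h \<circ> quasireg g) \<circ> displacement (inv p) = (if P g then laplace p else op_zero)"
    if "g \<in> S" for g
  proof -
    have gT: "g \<in> thompsonT" using that S by blast
    have "displacement p \<circ> quasireg (h \<circ> g) \<circ> displacement (inv p) = (if P g then laplace p else op_zero)"
    proof (cases "P g")
      case True
      then show ?thesis
        using compress_fixing[OF thompsonT_comp[OF h gT] p] fix_K[OF that] by simp
    next
      case False
      then show ?thesis
        using compress_moving[OF thompsonT_comp[OF h gT] p] move_K[OF that] by simp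
    qed
    then show ?thesis unfolding quasireg_comp[OF h gT] .
  qed
  show ?thesis
  proof (intro ext)
    fix \<xi> C
    have "op_sum S c (\<lambda>g. displacement p \<circ> (quasireg h \<circ> quasireg g) \<circ> displacement (inv p)) \<xi> C =
      (\<Sum>g\<in>S. c g * (if P g then laplace p else op_zero) \<xi> C)"
      unfolding op_sum_def by (intro sum.cong refl arg_cong2[where f = "(*)"]) (simp add: g del: comp_apply)
    also have "\<dots> = (\<Sum>g\<in>{g\<in>S. P g}. c g * laplace p \<xi> C)"
      using S(1) by (intro sum.mono_neutral_cong_right) (auto simp: op_zero_def)
    finally show "(displacement p \<circ> (quasireg h \<circ> op_sum S c quasireg) \<circ> displacement (inv p)) \<xi> C =
        (\<Sum>g\<in>{g\<in>S. P g}. c g) * laplace p \<xi> C"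
      unfolding eq by (simp add: sum_distrib_right)
  qed
qed

text \<open>Only right-hand arcs are usable, since \<open>f\<close> may jump at \<open>b\<close>; on
  such an arc it is increasing and affine. If f b < b, the slope limits how long the image stays
  below b; if f b > b, the image starts at f b and the arc has to end before that.\<close>

lemma moving_neighbourhood:
  assumes f: "f \<in> thompsonT" and b: "b \<in> {0..<1}" and "f b \<noteq> b"
  shows "\<exists>d>0. \<forall>y. b \<le> y \<longrightarrow> y < b + d \<longrightarrow> f y \<notin> {b..<b + d}"
proof -
  obtain k :: int and r where r: "r > 0" "\<And>y. b \<le> y \<Longrightarrow> y < b + r \<Longrightarrow> f y = f b + 2 powi k * (y - b)"
    using thompsonT_right_affine[OF f b] by metis
  show ?thesis
  proof (cases "f b < b")
    case True
    define d where "d = min r ((b - f b) / 2 powi k)"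
    have "d > 0" unfolding d_def using r(1) True by simp
    moreover have "f y < b" if "b \<le> y" "y < b + d" for y
    proof -
      have "y - b < (b - f b) / 2 powi k" using that unfolding d_def by simp
      then have "2 powi k * (y - b) < b - f b" by (simp add: field_simps)
      then show ?thesis using r(2)[of y] that unfolding d_def by simp
    qed
    ultimately show ?thesis by force
  next
    case False
    define d where "d = min r (f b - b)"
    have "d > 0" unfolding d_def using r(1) False assms(3) by simp
    moreover have "b + d \<le> f y" if "b \<le> y" "y < b + d" for y
    proof -
      have "2 powi k * (y - b) \<ge> 0" using that by simp
      moreover have "f y = f b + 2 powi k * (y - b)" using r(2)[of y] that unfolding d_def by simp
      moreover have "b + d \<le> f b" unfolding d_def by simp
      ultimately show ?thesis by linarith
    qed
    ultimately show ?thesis by force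
  qed
qed

lemma finite_uniform_radius:
  fixes Q :: "'a \<Rightarrow> real \<Rightarrow> bool"
  assumes "finite S" "\<And>g. g \<in> S \<Longrightarrow> \<exists>d>0. Q g d"
    and "\<And>g d d'. g \<in> S \<Longrightarrow> Q g d \<Longrightarrow> 0 < d' \<Longrightarrow> d' \<le> d \<Longrightarrow> Q g d'"
  shows "\<exists>d>0. \<forall>g\<in>S. Q g d"
  using assms
proof (induction S rule: finite_induct)
  case empty
  show ?case by (intro exI[of _ 1]) simp
next
  case (insert g S)
  then obtain d where d: "d > 0" "\<forall>g\<in>S. Q g d" by (metis insertCI)
  obtain e where e: "e > 0" "Q g e" using insert.prems(1) by blast
  have "\<forall>g'\<in>insert g S. Q g' (min d e)"
    using d e insert.prems(2)[of g e "min d e"] insert.prems(2)[of _ d "min d e"] by auto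
  then show ?case using d e by (intro exI[of _ "min d e"]) simp
qed

text \<open>A representative for the orbit point 2 powi (- n - 2): \<open>rot\<close> sends 0 to
  1/4, which \<open>contr\<close> then halves n times. On these points a map fixing 0 with slope 2
  powi k acts as a shift of the index.\<close>

definition near :: "nat \<Rightarrow> real \<Rightarrow> real" where
  "near n = contr ^^ n \<circ> rot"

lemma contr_pow_thompsonT: "contr ^^ n \<in> thompsonT"
proof (induction n)
  case (Suc n)
  then show ?case unfolding funpow.simps by (intro thompsonT_comp contr_thompsonT)
qed (simp add: thompsonT_id[unfolded id_def] thompsonT_id)

lemma near_thompsonT: "near n \<in> thompsonT"
  unfolding near_def by (intro thompsonT_comp contr_pow_thompsonT rot_thompsonT)

lemma contr_pow: "0 \<le> x \<Longrightarrow> x < 1/2 \<Longrightarrow> (contr ^^ n) x = x / 2 ^ n"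
proof (induction n)
  case (Suc n)
  define y where "y = x / 2 ^ n"
  have "y \<le> x" unfolding y_def using Suc.prems by (simp add: divide_le_eq mult_le_cancel_left1)
  moreover have "0 \<le> y" unfolding y_def using Suc.prems by simp
  ultimately have "contr y = y / 2" using Suc.prems by (simp add: contr_def)
  then show ?case using Suc unfolding y_def by simp
qed simp

lemma near_0: "near n 0 = 1 / (4 * 2 ^ n)"
  unfolding near_def using contr_pow[of "1/4" n] by (simp add: rot_def)

lemma near_0_powi: "near n 0 = 2 powi (- int n - 2)"
proof -
  have "(2::real) powi (- int n - 2) = inverse (2 ^ n) * inverse (2 ^ 2)"
    using power_int_add[of "2::real" "- int n" "-2"] by (simp add: power_int_minus)
  then show ?thesis by (simp add: near_0 field_simps)
qed

lemma near_small: "\<epsilon> > 0 \<Longrightarrow> \<exists>N. \<forall>n\<ge>N. near n 0 < \<epsilon>"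
proof -
  assume "\<epsilon> > 0"
  have "(\<lambda>n. (1/4) * (1/2) ^ n) \<longlonglongrightarrow> (1/4) * (0::real)"
    by (intro tendsto_mult tendsto_const LIMSEQ_power_zero) auto
  then have "\<forall>\<^sub>F n in sequentially. (1/4) * (1/2) ^ n < \<epsilon>"
    using \<open>\<epsilon> > 0\<close> by (intro order_tendstoD(2)) auto
  then show ?thesis unfolding near_0 eventually_sequentially by (simp add: power_one_over field_simps)
qed

text \<open>\<open>squeeze\<close> brings the support of \<open>contr\<close> into the first half,
  powers of \<open>contr\<close> shrink it towards 0, and \<open>t\<close> carries the result to the
  right of \<open>t 0\<close>. Conjugating \<open>contr\<close> by \<open>v\<close> then gives an
  element supported in a prescribed short arc.\<close>

lemma shrinking_element:
  assumes t: "t \<in> thompsonT" and "d > 0"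
  shows "\<exists>v\<in>thompsonT. \<forall>x\<in>{0..<3/4}. v x \<in> {t 0..<t 0 + d}"
proof -
  obtain k :: int and r where r: "r > 0" "\<And>y. 0 \<le> y \<Longrightarrow> y < r \<Longrightarrow> t y = t 0 + 2 powi k * y"
    using thompsonT_right_affine[OF t, of 0] by (metis add.left_neutral atLeastLessThan_iff diff_zero order_refl zero_less_one)
  define e where "e = min r (d / 2 powi k)"
  have "e > 0" unfolding e_def using r \<open>d > 0\<close> by simp
  then obtain n where n: "1 / e < 2 ^ n" using real_arch_pow[of 2 "1 / e"] by auto
  define v where "v = t \<circ> (contr ^^ n \<circ> squeeze)"
  have "v \<in> thompsonT" unfolding v_def by (intro thompsonT_comp t contr_pow_thompsonT squeeze_thompsonT)
  moreover have "v x \<in> {t 0..<t 0 + d}" if "x \<in> {0..<3/4}" for x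
  proof -
    define y where "y = squeeze x / 2 ^ n"
    have s: "squeeze x \<in> {0..<1/2}" by (rule squeeze_range[OF that])
    then have y: "(contr ^^ n) (squeeze x) = y" unfolding y_def by (intro contr_pow) auto
    have "1 < e * 2 ^ n" using n \<open>e > 0\<close> by (simp add: field_simps)
    then have y0: "0 \<le> y" "y < e" using s unfolding y_def by (auto simp: divide_less_eq)
    then have "y < d / 2 powi k" "y < r" unfolding e_def by auto
    then have "2 powi k * y < d" by (simp add: field_simps)
    moreover have "2 powi k * y \<ge> 0" using y0 by simp
    moreover have "v x = t 0 + 2 powi k * y" unfolding v_def using y r(2)[OF y0(1) \<open>y < r\<close>] by simp
    ultimately show ?thesis by simp
  qed
  ultimately show ?thesis by blast
qed

text \<open>One radius and one threshold for finitely many elements. Elements not fixing 0 send the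
  neighbourhood of 0 beyond all late points \<open>near n 0\<close>, so only those fixing 0 can map
  one such point to another.\<close>

lemma germs_at_zero:
  assumes S: "finite S" "S \<subseteq> thompsonT"
  obtains k :: "(real \<Rightarrow> real) \<Rightarrow> int" and d N where "d > 0" "d \<le> 1"
    "\<And>g y. g \<in> S \<Longrightarrow> 0 \<le> y \<Longrightarrow> y < d \<Longrightarrow> g y = g 0 + 2 powi (k g) * y"
    "\<And>n. N \<le> n \<Longrightarrow> near n 0 < d"
    "\<And>g n. g \<in> S \<Longrightarrow> g 0 \<noteq> 0 \<Longrightarrow> N \<le> n \<Longrightarrow> near n 0 < g 0"
proof -
  have "\<exists>k::int. \<exists>d>0. \<forall>y. 0 \<le> y \<longrightarrow> y < d \<longrightarrow> g y = g 0 + 2 powi k * y" if g: "g \<in> S" for g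
  proof -
    have "g \<in> thompsonT" "(0::real) \<in> {0..<1}" using g S by auto
    then obtain k :: int and d where d: "d > 0" "\<And>y. 0 \<le> y \<Longrightarrow> y < 0 + d \<Longrightarrow> g y = g 0 + 2 powi k * (y - 0)"
      using thompsonT_right_affine by metis
    show ?thesis
    proof (intro exI conjI allI impI)
      show "d > 0" by (rule d(1))
      show "g y = g 0 + 2 powi k * y" if "0 \<le> y" "y < d" for y
        using d(2)[of y] that by simp
    qed
  qed
  then obtain k :: "(real \<Rightarrow> real) \<Rightarrow> int" where
    k: "\<And>g. g \<in> S \<Longrightarrow> \<exists>d>0. \<forall>y. 0 \<le> y \<longrightarrow> y < d \<longrightarrow> g y = g 0 + 2 powi k g * y" by metis
  have ex: "\<exists>d>0. (d \<le> 1 \<and> (g 0 \<noteq> 0 \<longrightarrow> d \<le> g 0)) \<and> (\<forall>y. 0 \<le> y \<longrightarrow> y < d \<longrightarrow> g y = g 0 + 2 powi k g * y)" if "g \<in> S" for g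
  proof -
    obtain d where d: "d > 0" "\<forall>y. 0 \<le> y \<longrightarrow> y < d \<longrightarrow> g y = g 0 + 2 powi k g * y" using k[OF \<open>g \<in> S\<close>] by blast
    have g0: "g 0 \<ge> 0" using thompsonT_range[of g 0] S \<open>g \<in> S\<close> by auto
    define e where "e = min (min d 1) (if g 0 = 0 then 1 else g 0)"
    have "e > 0" "e \<le> d" "e \<le> 1" "g 0 \<noteq> 0 \<longrightarrow> e \<le> g 0" unfolding e_def using d(1) g0 by auto
    moreover from \<open>e \<le> d\<close> have "\<forall>y. 0 \<le> y \<longrightarrow> y < e \<longrightarrow> g y = g 0 + 2 powi k g * y"
      using d(2) order_less_le_trans by blast
    ultimately show ?thesis by blast
  qed
  have "\<exists>d>0. \<forall>g\<in>S. (d \<le> 1 \<and> (g 0 \<noteq> 0 \<longrightarrow> d \<le> g 0)) \<and>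
      (\<forall>y. 0 \<le> y \<longrightarrow> y < d \<longrightarrow> g y = g 0 + 2 powi k g * y)"
  proof (rule finite_uniform_radius[OF S(1) ex])
    fix g and r r' :: real
    assume "(r \<le> 1 \<and> (g 0 \<noteq> 0 \<longrightarrow> r \<le> g 0)) \<and> (\<forall>y. 0 \<le> y \<longrightarrow> y < r \<longrightarrow> g y = g 0 + 2 powi k g * y)"
      and "r' \<le> r"
    then show "(r' \<le> 1 \<and> (g 0 \<noteq> 0 \<longrightarrow> r' \<le> g 0)) \<and> (\<forall>y. 0 \<le> y \<longrightarrow> y < r' \<longrightarrow> g y = g 0 + 2 powi k g * y)"
      by (meson order_less_le_trans order_trans)
  qed blast+
  then obtain d where d: "d > 0" "\<forall>g\<in>S. (d \<le> 1 \<and> (g 0 \<noteq> 0 \<longrightarrow> d \<le> g 0)) \<and>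
      (\<forall>y. 0 \<le> y \<longrightarrow> y < d \<longrightarrow> g y = g 0 + 2 powi k g * y)"
    by blast
  have dA: "d \<le> g 0" if "g \<in> S" "g 0 \<noteq> 0" for g using d(2) that by blast
  have dB: "g y = g 0 + 2 powi k g * y" if "g \<in> S" "0 \<le> y" "y < d" for g y using d(2) that by blast
  define e where "e = min d 1"
  obtain N where N: "\<And>n. N \<le> n \<Longrightarrow> near n 0 < e" using near_small[of e] d(1) unfolding e_def by auto
  show ?thesis
  proof (rule that[of e k N])
    show "e > 0" "e \<le> 1" unfolding e_def using d(1) by auto
    show "g y = g 0 + 2 powi (k g) * y" if "g \<in> S" "0 \<le> y" "y < e" for g y
      using dB[OF that(1,2)] that(3) unfolding e_def by simp
    show "near n 0 < e" if "N \<le> n" for n using N[OF that] .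
    show "near n 0 < g 0" if "g \<in> S" "g 0 \<noteq> 0" "N \<le> n" for g n
      using N[OF that(3)] dA[OF that(1,2)] unfolding e_def by simp
  qed
qed

section \<open>Toeplitz averaging at the base point\<close>

lemma group_alg_op_sum:
  assumes "B \<in> group_alg_qr"
  obtains S c where "finite S" "S \<subseteq> thompsonT" "B = op_sum S c quasireg"
  using assms unfolding group_alg_qr_def op_sum_def by blast

lemma op_sum_quasireg_delta:
  assumes "S \<subseteq> thompsonT" "C \<in> TmodF"
  shows "op_sum S c quasireg (delta C) D = (\<Sum>g\<in>S. c g * (if D = lcoset g C then 1 else 0))"
  unfolding op_sum_def
proof (rule sum.cong[OF refl])
  fix g assume "g \<in> S"
  then have "quasireg g (delta C) = delta (lcoset g C)" using assms by (intro quasireg_delta) auto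
  then show "c g * quasireg g (delta C) D = c g * (if D = lcoset g C then 1 else 0)"
    by (simp add: delta_def)
qed

lemma op_bound_coefficient:
  assumes "bounded_op X A" "op_bound X A c" "a \<in> X"
  shows "cmod (A (delta a) b) \<le> c"
proof -
  have "cmod (A (delta a) b) \<le> l2norm X (A (delta a))" using assms(1) by (intro ell2_coordinate bounded_op_ell2)
  also have "\<dots> \<le> c * l2norm X (delta a)" using assms(2,3) by (intro op_boundD delta_ell2)
  finally show ?thesis using assms(3) by (simp add: l2norm_delta)
qed

text \<open>The block sum pairs A 1 with 1, where 1 is the indicator vector of the n chosen points.
  Its squared norm is n, so the bound is linear in n although the block has n^2 entries.\<close>

lemma block_sum_bound:
  assumes A: "bounded_op X A" "op_bound X A c" and e: "inj e" "range e \<subseteq> X"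
  shows "cmod (\<Sum>i<n. \<Sum>j<n. A (delta (e i)) (e j)) \<le> c * real n"
proof -
  define \<xi> where "\<xi> = (\<lambda>x. \<Sum>i<n. 1 * delta (e i) x)"
  have d: "delta (e i) \<in> ell2 X" for i using e by (intro delta_ell2) auto
  have \<xi>: "\<xi> \<in> ell2 X" unfolding \<xi>_def by (intro ell2_sum ell2_scale d) auto
  have A\<xi>: "A \<xi> = (\<lambda>x. \<Sum>i<n. 1 * A (delta (e i)) x)"
    unfolding \<xi>_def using A(1) d by (intro bounded_op_sum_arg) auto
  have \<xi>e: "\<xi> x = (if x \<in> e ` {..<n} then 1 else 0)" for x
  proof (cases "x \<in> e ` {..<n}")
    case True
    then obtain j where j: "j < n" "x = e j" by auto
    then have "\<xi> x = (\<Sum>i<n. if i = j then 1 else 0)"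
      unfolding \<xi>_def delta_def using e(1) by (intro sum.cong) (auto dest: injD)
    then show ?thesis using j by simp
  next
    case False
    then show ?thesis unfolding \<xi>_def delta_def by (auto intro!: sum.neutral)
  qed
  have card: "card (e ` {..<n}) = n" using e(1) by (simp add: card_image inj_on_subset)
  have "(l2norm X \<xi>)\<^sup>2 = (\<Sum>x\<in>e ` {..<n}. (cmod (\<xi> x))\<^sup>2)"
    using e(2) \<xi>e by (intro ell2_finite_support(2)) auto
  also have "\<dots> = real n" using card \<xi>e by simp
  finally have n: "l2norm X \<xi> = sqrt (real n)" by (metis l2norm_nonneg real_sqrt_unique)
  have "(\<Sum>i<n. \<Sum>j<n. A (delta (e i)) (e j)) = (\<Sum>j<n. A \<xi> (e j))"
    unfolding A\<xi> by (subst sum.swap) simp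
  also have "\<dots> = (\<Sum>x\<in>e ` {..<n}. A \<xi> x)"
    using e(1) by (subst sum.reindex) (auto intro: inj_on_subset)
  finally have "cmod (\<Sum>i<n. \<Sum>j<n. A (delta (e i)) (e j)) \<le> (\<Sum>x\<in>e ` {..<n}. \<bar>cmod (A \<xi> x)\<bar> * \<bar>1\<bar>)"
    by (simp add: norm_sum)
  also have "\<dots> \<le> L2_set (\<lambda>x. cmod (A \<xi> x)) (e ` {..<n}) * L2_set (\<lambda>_. 1) (e ` {..<n})"
    by (rule L2_set_mult_ineq)
  also have "L2_set (\<lambda>_. 1) (e ` {..<n}) = sqrt (real n)" using card by (simp add: L2_set_constant)
  also have "L2_set (\<lambda>x. cmod (A \<xi> x)) (e ` {..<n}) * sqrt (real n) \<le> (c * sqrt (real n)) * sqrt (real n)"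
  proof (rule mult_right_mono)
    have "L2_set (\<lambda>x. cmod (A \<xi> x)) (e ` {..<n}) \<le> l2norm X (A \<xi>)"
      using e(2) by (intro L2_set_le_l2norm ell2_square_summable bounded_op_ell2[OF A(1)]) auto
    also have "\<dots> \<le> c * sqrt (real n)" using op_boundD[OF A(2) \<xi>] n by simp
    finally show "L2_set (\<lambda>x. cmod (A \<xi> x)) (e ` {..<n}) \<le> c * sqrt (real n)" .
  qed simp
  finally show ?thesis by (simp add: mult.assoc)
qed

text \<open>A shifted diagonal leaves the block only within distance |k| of either end, so the loss
  does not grow with n.\<close>

lemma shifted_diagonal_count:
  fixes k :: int
  shows "\<bar>(\<Sum>i<n. \<Sum>j<n. if int j = int i - k then 1 else 0) - real n\<bar> \<le> 2 * \<bar>real_of_int k\<bar>"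
proof -
  define G where "G = {i\<in>{..<n}. 0 \<le> int i - k \<and> int i - k < int n}"
  have inner: "(\<Sum>j<n. if int j = int i - k then 1 else 0 :: real) = (if i \<in> G then 1 else 0)" if "i < n" for i
  proof (cases "i \<in> G")
    case True
    then have "int j = int i - k \<longleftrightarrow> j = nat (int i - k)" for j unfolding G_def by auto
    moreover have "nat (int i - k) < n" using True unfolding G_def by auto
    ultimately show ?thesis using True by simp
  next
    case False
    then have "int j \<noteq> int i - k" if "j < n" for j using that \<open>i < n\<close> unfolding G_def by auto
    then show ?thesis using False by (auto intro!: sum.neutral)
  qed
  have GN: "G \<subseteq> {..<n}" unfolding G_def by auto
  have "(\<Sum>i<n. \<Sum>j<n. if int j = int i - k then 1 else 0 :: real) = (\<Sum>i<n. if i \<in> G then 1 else 0)"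
    using inner by (intro sum.cong) auto
  also have "\<dots> = real (card G)" using GN by (simp add: sum.If_cases Int_absorb1)
  finally have eq: "(\<Sum>i<n. \<Sum>j<n. if int j = int i - k then 1 else 0 :: real) = real (card G)" .
  have "{..<n} - G \<subseteq> {..<nat \<bar>k\<bar>} \<union> {n - nat \<bar>k\<bar>..<n}" unfolding G_def by auto
  then have "card ({..<n} - G) \<le> card ({..<nat \<bar>k\<bar>} \<union> {n - nat \<bar>k\<bar>..<n})" by (intro card_mono) auto
  also have "\<dots> \<le> nat \<bar>k\<bar> + nat \<bar>k\<bar>"
    by (rule order_trans[OF card_Un_le]) (simp, arith)
  finally have "card ({..<n} - G) \<le> 2 * nat \<bar>k\<bar>" by simp
  moreover have "card ({..<n} - G) = n - card G" using GN by (simp add: card_Diff_subset finite_subset)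
  moreover have "card G \<le> n" using card_mono[OF _ GN] by simp
  ultimately have "real n - real (card G) \<le> 2 * \<bar>real_of_int k\<bar>" "real (card G) \<le> real n" by linarith+
  then show ?thesis unfolding eq by simp
qed

text \<open>If \<open>g\<close> fixes 0, it sends 2 powi (- i - 2) to 2 powi (k - i - 2), and
  comparing exponents gives j = i - k. Otherwise the image lies above \<open>g 0\<close>, which
  exceeds \<open>near j 0\<close> by assumption.\<close>

lemma near_coset_eq_iff:
  assumes g: "g \<in> thompsonT" and aff: "\<And>y. 0 \<le> y \<Longrightarrow> y < d \<Longrightarrow> g y = g 0 + 2 powi k * y"
    and i: "near i 0 < d" and j: "g 0 \<noteq> 0 \<Longrightarrow> near j 0 < g 0"
  shows "coset (near j) = lcoset g (coset (near i)) \<longleftrightarrow> g 0 = 0 \<and> int j = int i - k"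
proof -
  have pos: "near n 0 > 0" for n by (simp add: near_0)
  have gi: "g (near i 0) = g 0 + 2 powi k * near i 0" using aff[of "near i 0"] pos[of i] i by simp
  have "coset (near j) = lcoset g (coset (near i)) \<longleftrightarrow> near j 0 = g (near i 0)"
  proof
    assume "coset (near j) = lcoset g (coset (near i))"
    then have "pt (coset (near j)) = pt (lcoset g (coset (near i)))" by simp
    then show "near j 0 = g (near i 0)" by (simp add: lcoset_coset)
  next
    assume "near j 0 = g (near i 0)"
    then show "coset (near j) = lcoset g (coset (near i))"
      unfolding lcoset_coset by (intro coset_eqI near_thompsonT thompsonT_comp g) simp
  qed
  also have "\<dots> \<longleftrightarrow> g 0 = 0 \<and> int j = int i - k"
  proof (cases "g 0 = 0")
    case True
    have "near j 0 = g (near i 0) \<longleftrightarrow> (2::real) powi (- int j - 2) = 2 powi (k + (- int i - 2))"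
      unfolding gi using True by (simp add: near_0_powi power_int_add)
    also have "\<dots> \<longleftrightarrow> - int j - 2 = k + (- int i - 2)"
    proof
      assume eq: "(2::real) powi (- int j - 2) = 2 powi (k + (- int i - 2))"
      show "- int j - 2 = k + (- int i - 2)"
      proof (rule linorder_cases)
        assume "- int j - 2 < k + (- int i - 2)"
        then show ?thesis using power_int_strict_increasing[of "- int j - 2" "k + (- int i - 2)" "2::real"] eq by simp
      next
        assume "k + (- int i - 2) < - int j - 2"
        then show ?thesis using power_int_strict_increasing[of "k + (- int i - 2)" "- int j - 2" "2::real"] eq by simp
      qed
    next
      assume "- int j - 2 = k + (- int i - 2)"
      then show "(2::real) powi (- int j - 2) = 2 powi (k + (- int i - 2))" by (simp only:)
    qed
    finally show ?thesis using True by auto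
  next
    case False
    have "2 powi k * near i 0 > 0" using pos[of i] by simp
    then have "near j 0 < g (near i 0)" unfolding gi using j[OF False] by linarith
    then show ?thesis using False by simp
  qed
  finally show ?thesis .
qed

lemma base_coset_eq_iff:
  assumes "g \<in> thompsonT"
  shows "coset id = lcoset g (coset id) \<longleftrightarrow> g 0 = 0"
proof
  assume "coset id = lcoset g (coset id)"
  then have "pt (coset id) = pt (lcoset g (coset id))" by simp
  then show "g 0 = 0" by (simp add: lcoset_coset)
next
  assume "g 0 = 0"
  then show "coset id = lcoset g (coset id)"
    unfolding lcoset_coset by (intro coset_eqI thompsonT_id thompsonT_comp assms) simp
qed

lemma coset_near_TmodF: "coset (near n) \<in> TmodF"
  by (intro coset_TmodF near_thompsonT)

lemma coset_near_inj: "inj (\<lambda>i. coset (near (N + i)))"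
proof (rule injI)
  fix i j assume "coset (near (N + i)) = coset (near (N + j))"
  then have "pt (coset (near (N + i))) = pt (coset (near (N + j)))" by simp
  then show "i = j" by (simp add: near_0)
qed

text \<open>Near the base point an element of the group algebra acts on the points \<open>near n 0\<close> like a
  Toeplitz matrix.\<close>
lemma toeplitz_block_average:
  assumes S: "finite S" "S \<subseteq> thompsonT"
  shows "\<exists>Q N0. \<forall>N\<ge>N0. \<forall>n. cmod ((\<Sum>i<n. \<Sum>j<n. op_sum S c quasireg (delta (coset (near (N + i)))) (coset (near (N + j))))
      - of_nat n * op_sum S c quasireg (delta (coset id)) (coset id)) \<le> Q"
proof -
  obtain k :: "(real \<Rightarrow> real) \<Rightarrow> int" and d N0 where germ: "d > 0" "d \<le> 1"
    "\<And>g y. g \<in> S \<Longrightarrow> 0 \<le> y \<Longrightarrow> y < d \<Longrightarrow> g y = g 0 + 2 powi (k g) * y"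
    "\<And>n. N0 \<le> n \<Longrightarrow> near n 0 < d"
    "\<And>g n. g \<in> S \<Longrightarrow> g 0 \<noteq> 0 \<Longrightarrow> N0 \<le> n \<Longrightarrow> near n 0 < g 0"
    using germs_at_zero[OF S] by metis
  \<comment> \<open>Total boundary loss of the shifted diagonals. It depends on the coefficients and
    slopes only, neither on the size of the block nor on its position.\<close>
  define Q where "Q = (\<Sum>g\<in>S. cmod (c g) * (2 * \<bar>real_of_int (k g)\<bar>))"
  have "cmod ((\<Sum>i<n. \<Sum>j<n. op_sum S c quasireg (delta (coset (near (N + i)))) (coset (near (N + j))))
      - of_nat n * op_sum S c quasireg (delta (coset id)) (coset id)) \<le> Q" if N: "N0 \<le> N" for N n
  proof -
    define m where "m g = (\<Sum>i<n. \<Sum>j<n. if int j = int i - k g then 1 else 0 :: real)" for g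
    have entry: "op_sum S c quasireg (delta (coset (near (N + i)))) (coset (near (N + j))) =
        (\<Sum>g\<in>S. c g * (if g 0 = 0 \<and> int j = int i - k g then 1 else 0))" for i j
    proof -
      have "coset (near (N + j)) = lcoset g (coset (near (N + i))) \<longleftrightarrow> g 0 = 0 \<and> int j = int i - k g" if g: "g \<in> S" for g
      proof -
        have "coset (near (N + j)) = lcoset g (coset (near (N + i))) \<longleftrightarrow> g 0 = 0 \<and> int (N + j) = int (N + i) - k g"
        proof (rule near_coset_eq_iff[where d = d])
          show "g \<in> thompsonT" using g S by blast
          show "g y = g 0 + 2 powi k g * y" if "0 \<le> y" "y < d" for y using germ(3)[OF g that] .
          show "near (N + i) 0 < d" using N by (intro germ(4)) simp
          show "near (N + j) 0 < g 0" if "g 0 \<noteq> 0" using N by (intro germ(5)[OF g that]) simp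
        qed
        then show ?thesis by auto
      qed
      then show ?thesis
        unfolding op_sum_quasireg_delta[OF S(2) coset_near_TmodF] by (intro sum.cong refl) simp
    qed
    have "(\<Sum>i<n. \<Sum>j<n. op_sum S c quasireg (delta (coset (near (N + i)))) (coset (near (N + j)))) =
        (\<Sum>g\<in>S. \<Sum>i<n. \<Sum>j<n. c g * (if g 0 = 0 \<and> int j = int i - k g then 1 else 0))"
      unfolding entry by (subst (2) sum.swap, subst sum.swap) simp
    also have "\<dots> = (\<Sum>g\<in>S. c g * (if g 0 = 0 then of_real (m g) else 0))"
    proof (rule sum.cong[OF refl])
      fix g
      show "(\<Sum>i<n. \<Sum>j<n. c g * (if g 0 = 0 \<and> int j = int i - k g then 1 else 0)) = c g * (if g 0 = 0 then of_real (m g) else 0)"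
        unfolding m_def by (cases "g 0 = 0") (simp_all flip: sum_distrib_left, simp add: if_distrib cong: if_cong)
    qed
    finally have 1: "(\<Sum>i<n. \<Sum>j<n. op_sum S c quasireg (delta (coset (near (N + i)))) (coset (near (N + j)))) =
        (\<Sum>g\<in>S. c g * (if g 0 = 0 then of_real (m g) else 0))" .
    \<comment> \<open>At the base coset each \<open>g\<close> fixing 0 counts once, whatever its
      slope; in the block it counts \<open>m g\<close> times, which is n up to the boundary
      loss.\<close>
    have 2: "op_sum S c quasireg (delta (coset id)) (coset id) = (\<Sum>g\<in>S. c g * (if g 0 = 0 then 1 else 0))"
      unfolding op_sum_quasireg_delta[OF S(2) coset_TmodF[OF thompsonT_id]]
      using base_coset_eq_iff S(2) by (intro sum.cong refl) (simp add: subset_iff)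
    have "(\<Sum>g\<in>S. c g * (if g 0 = 0 then of_real (m g) else 0)) - of_nat n * (\<Sum>g\<in>S. c g * (if g 0 = 0 then 1 else 0)) =
        (\<Sum>g\<in>S. c g * (if g 0 = 0 then of_real (m g - real n) else 0))"
      unfolding sum_distrib_left sum_subtractf[symmetric] by (intro sum.cong refl) (simp add: algebra_simps)
    also have "cmod \<dots> \<le> Q"
      unfolding Q_def
    proof (rule sum_norm_le)
      fix g assume "g \<in> S"
      have "\<bar>m g - real n\<bar> \<le> 2 * \<bar>real_of_int (k g)\<bar>" unfolding m_def by (rule shifted_diagonal_count)
      then have "cmod (if g 0 = 0 then of_real (m g - real n) else 0) \<le> 2 * \<bar>real_of_int (k g)\<bar>"
        by (simp del: of_real_diff)
      then show "cmod (c g * (if g 0 = 0 then of_real (m g - real n) else 0)) \<le> cmod (c g) * (2 * \<bar>real_of_int (k g)\<bar>)"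
        unfolding norm_mult by (intro mult_left_mono) auto
    qed
    finally show ?thesis unfolding 1 2 .
  qed
  then show ?thesis by blast
qed

text \<open>The order of quantifiers is the point: \<eta> and n come from one coarse approximant,
  but the conclusion speaks of \<open>A\<close> itself and of every block far enough out. A finer
  approximant, with its own threshold, can therefore be chosen afterwards.\<close>

lemma persistent_coefficient:
  assumes A: "A \<in> cstar_qr" and nz: "A (delta (coset id)) (coset id) \<noteq> 0"
  shows "\<exists>\<eta>>0. \<exists>n N0. \<forall>N\<ge>N0. \<exists>i<n. \<exists>j<n. \<eta> \<le> cmod (A (delta (coset (near (N + i)))) (coset (near (N + j))))"
proof -
  define a where "a = cmod (A (delta (coset id)) (coset id))"
  have a: "a > 0" unfolding a_def using nz by simp
  obtain B where B: "B \<in> group_alg_qr" "op_bound TmodF (op_diff A B) (a / 4)"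
    using A a unfolding cstar_qr_iff by (metis zero_less_divide_iff zero_less_numeral)
  obtain S c where S: "finite S" "S \<subseteq> thompsonT" "B = op_sum S c quasireg"
    using group_alg_op_sum[OF B(1)] by metis
  obtain Q N0 where Q: "\<And>N n. N0 \<le> N \<Longrightarrow> cmod ((\<Sum>i<n. \<Sum>j<n. B (delta (coset (near (N + i)))) (coset (near (N + j))))
      - of_nat n * B (delta (coset id)) (coset id)) \<le> Q"
    using toeplitz_block_average[OF S(1,2), of c] unfolding S(3) by blast
  have bd: "bounded_op TmodF (op_diff A B)" by (intro bounded_op_diff cstar_bounded A group_alg_bounded B)
  \<comment> \<open>Large enough that the boundary loss \<open>Q\<close> is at most n a / 4, and
    positive because of the successor.\<close>
  define n where "n = Suc (nat \<lceil>4 * Q / a\<rceil>)"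
  have n: "n > 0" "Q \<le> real n * a / 4"
  proof -
    have "4 * Q / a \<le> real n" unfolding n_def by linarith
    then show "Q \<le> real n * a / 4" using a by (simp add: field_simps)
  qed (simp add: n_def)
  \<comment> \<open>If all n^2 entries were at most a / (8 n), the block sum would be at most n a /
    8. Together with three errors of n a / 4 this stays below n a, a contradiction.\<close>
  define \<eta> where "\<eta> = a / (8 * real n)"
  have "\<eta> > 0" unfolding \<eta>_def using a n by simp
  have "\<exists>i<n. \<exists>j<n. \<eta> \<le> cmod (A (delta (coset (near (N + i)))) (coset (near (N + j))))" if N: "N0 \<le> N" for N
  proof (rule ccontr)
    assume "\<not> ?thesis"
    then have small: "cmod (A (delta (coset (near (N + i)))) (coset (near (N + j)))) \<le> \<eta>" if "i < n" "j < n" for i j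
      using that by (meson less_imp_le not_le)
    define e where "e i = coset (near (N + i))" for i
    have e: "inj e" "range e \<subseteq> TmodF" unfolding e_def using coset_near_inj coset_near_TmodF by auto
    define TA where "TA = (\<Sum>i<n. \<Sum>j<n. A (delta (e i)) (e j))"
    define TB where "TB = (\<Sum>i<n. \<Sum>j<n. B (delta (e i)) (e j))"
    have "TA - TB = (\<Sum>i<n. \<Sum>j<n. op_diff A B (delta (e i)) (e j))"
      unfolding TA_def TB_def op_diff_def by (simp add: sum_subtractf)
    then have 1: "cmod (TA - TB) \<le> a / 4 * real n" using block_sum_bound[OF bd B(2) e, of n] by simp
    have 2: "cmod (TB - of_nat n * B (delta (coset id)) (coset id)) \<le> real n * a / 4"
      using Q[OF N, of n] n(2) unfolding TB_def e_def by simp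
    have "cmod (op_diff A B (delta (coset id)) (coset id)) \<le> a / 4"
      by (rule op_bound_coefficient[OF bd B(2) coset_TmodF[OF thompsonT_id]])
    then have 3: "cmod (A (delta (coset id)) (coset id) - B (delta (coset id)) (coset id)) \<le> a / 4"
      unfolding op_diff_def .
    have 4: "cmod TA \<le> real n * a / 8"
    proof -
      have "cmod TA \<le> (\<Sum>i<n. \<Sum>j<n. \<eta>)"
        unfolding TA_def e_def using small by (intro sum_norm_le) auto
      also have "\<dots> = real n * a / 8" unfolding \<eta>_def using n(1) by (simp add: field_simps)
      finally show ?thesis .
    qed
    let ?A = "A (delta (coset id)) (coset id)" and ?B = "B (delta (coset id)) (coset id)"
    have "real n * a = cmod (of_nat n * ?A)" unfolding a_def by (simp add: norm_mult)
    also have "of_nat n * ?A = of_nat n * (?A - ?B) - (TB - of_nat n * ?B) - (TA - TB) + TA"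
      by (simp add: algebra_simps)
    also have "cmod \<dots> \<le> cmod (of_nat n * (?A - ?B)) + cmod (TB - of_nat n * ?B) + cmod (TA - TB) + cmod TA"
      by (intro order_trans[OF norm_triangle_ineq] add_right_mono order_trans[OF norm_triangle_ineq4] order_refl)
    also have "cmod (of_nat n * (?A - ?B)) \<le> real n * (a / 4)"
      unfolding norm_mult norm_of_nat using 3 by (intro mult_left_mono) auto
    finally have "real n * a \<le> real n * (a / 4) + real n * a / 4 + a / 4 * real n + real n * a / 8"
      using 1 2 4 by linarith
    then show False using a n(1) by (simp add: field_simps)
  qed
  then show ?thesis using \<open>\<eta> > 0\<close> by blast
qed

section \<open>Closed ideals\<close>

lemma finite_support_approximation:
  assumes \<xi>: "\<xi> \<in> ell2 X" and "e > 0"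
  obtains F where "finite F" "F \<subseteq> X" "l2norm X (\<lambda>x. \<xi> x - (if x \<in> F then \<xi> x else 0)) \<le> e"
proof -
  obtain F where F: "finite F" "F \<subseteq> X"
    "dist (\<Sum>x\<in>F. (cmod (\<xi> x))\<^sup>2) (infsum (\<lambda>x. (cmod (\<xi> x))\<^sup>2) X) \<le> e\<^sup>2"
    using infsum_finite_approximation[OF ell2_square_summable[OF \<xi>], of "e\<^sup>2"] \<open>e > 0\<close> by auto
  have "(l2norm (F \<union> (X - F)) \<xi>)\<^sup>2 = (l2norm F \<xi>)\<^sup>2 + (l2norm (X - F) \<xi>)\<^sup>2"
    using F(2) by (intro l2norm_sq_Un[OF \<xi>]) auto
  moreover have "F \<union> (X - F) = X" using F(2) by blast
  ultimately have "(l2norm (X - F) \<xi>)\<^sup>2 \<le> e\<^sup>2"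
    using F(1,3) by (simp add: l2norm_sq dist_real_def)
  then have "l2norm (X - F) \<xi> \<le> e" by (rule power2_le_imp_le) (use \<open>e > 0\<close> in simp)
  moreover have "infsum (\<lambda>x. (cmod (\<xi> x - (if x \<in> F then \<xi> x else 0)))\<^sup>2) X = infsum (\<lambda>x. (cmod (\<xi> x))\<^sup>2) (X - F)"
    by (intro infsum_cong_neutral) auto
  ultimately show ?thesis using that[OF F(1,2)] unfolding l2norm_def by simp
qed

text \<open>The point masses have dense span, and the operator is bounded.\<close>

lemma nonzero_coefficient:
  assumes A: "bounded_op X A" and nz: "A \<noteq> op_zero"
  shows "\<exists>a\<in>X. \<exists>b\<in>X. A (delta a) b \<noteq> 0"
proof (rule ccontr)
  assume "\<not> ?thesis"
  then have "A (delta a) b = 0" if "a \<in> X" for a b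
    using that bounded_op_ell2[OF A, of "delta a"] unfolding ell2_def by blast
  then have z: "A (delta a) = (\<lambda>_. 0)" if "a \<in> X" for a using that by blast
  obtain c where c: "op_bound X A c" using bounded_op_bound[OF A] by blast
  have c0: "0 \<le> c" using c by (rule op_bound_nonneg)
  have "A = op_zero"
  proof (rule bounded_op_eqI[OF A bounded_op_zero])
    fix \<xi> assume \<xi>: "\<xi> \<in> ell2 X"
    have "l2norm X (A \<xi>) \<le> 0 + e" if "e > 0" for e
    proof -
      have "e / (c + 1) > 0" using \<open>e > 0\<close> c0 by simp
      then obtain F where F: "finite F" "F \<subseteq> X" "l2norm X (\<lambda>x. \<xi> x - (if x \<in> F then \<xi> x else 0)) \<le> e / (c + 1)"
        by (rule finite_support_approximation[OF \<xi>])
      define \<zeta> where "\<zeta> = (\<lambda>x. if x \<in> F then \<xi> x else 0)"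
      have \<zeta>: "\<zeta> \<in> ell2 X" using ell2_finite_support(1)[OF F(1,2), of \<zeta>] unfolding \<zeta>_def by simp
      have "\<zeta> = (\<lambda>x. \<Sum>a\<in>F. \<xi> a * delta a x)"
        unfolding \<zeta>_def delta_def using F(1) by (auto simp: if_distrib cong: if_cong)
      moreover have "A (\<lambda>x. \<Sum>a\<in>F. \<xi> a * delta a x) = (\<lambda>x. \<Sum>a\<in>F. \<xi> a * A (delta a) x)"
      proof (rule bounded_op_sum_arg[OF A F(1), where \<xi> = delta and c = \<xi>])
        show "delta i \<in> ell2 X" if "i \<in> F" for i using F(2) that by (intro delta_ell2) blast
      qed
      ultimately have "A \<zeta> = (\<lambda>x. \<Sum>a\<in>F. \<xi> a * A (delta a) x)" by (simp only:)
      also have "\<dots> = (\<lambda>x. 0)" using z F(2) by (intro ext sum.neutral) (simp add: subset_iff)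
      finally have "A \<xi> = A (\<lambda>x. \<xi> x - \<zeta> x)" using bounded_op_diff_arg[OF A \<xi> \<zeta>] by simp
      then have "l2norm X (A \<xi>) \<le> c * (e / (c + 1))"
        using op_boundD[OF c ell2_diff(1)[OF \<xi> \<zeta>]] mult_left_mono[OF F(3) c0] unfolding \<zeta>_def by simp
      also have "\<dots> \<le> e" using c0 \<open>e > 0\<close> by (simp add: field_simps)
      finally show ?thesis by simp
    qed
    then have "l2norm X (A \<xi>) \<le> 0" by (rule field_le_epsilon)
    then have "l2norm X (A \<xi>) = 0" using l2norm_nonneg[of X "A \<xi>"] by linarith
    then show "A \<xi> = op_zero \<xi>" using ell2_eq_zero_iff[OF bounded_op_ell2[OF A]] unfolding op_zero_def by blast
  qed
  then show False using nz by blast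
qed

text \<open>Since \<open>S\<close> is finite there is a common arc to the right of
  \<open>t 0\<close>: elements agreeing with \<open>g0\<close> at this point agree with it on the
  arc by \<open>germ\<close>, and \<open>inv g0\<close> composed with any other element moves the
  arc off itself. A conjugate of \<open>contr\<close> fits into the arc.\<close>

lemma compression_witness:
  assumes S: "finite S" "S \<subseteq> thompsonT" and t: "t \<in> thompsonT" and g0: "g0 \<in> S"
    and germ: "\<And>g. g \<in> S \<Longrightarrow> g (t 0) = g0 (t 0) \<Longrightarrow> \<exists>d>0. \<forall>y. t 0 \<le> y \<longrightarrow> y < t 0 + d \<longrightarrow> g y = g0 y"
  shows "\<exists>v\<in>thompsonT. displacement (conjugate v contr) \<circ> (quasireg (inv g0) \<circ> op_sum S c quasireg) \<circ>
      displacement (inv (conjugate v contr)) =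
    (\<lambda>\<xi> C. (\<Sum>g\<in>{g\<in>S. g (t 0) = g0 (t 0)}. c g) * laplace (conjugate v contr) \<xi> C)"
proof -
  define b where "b = t 0"
  have b: "b \<in> {0..<1}" unfolding b_def using thompsonT_range[OF t, of 0] by simp
  have g0T: "g0 \<in> thompsonT" using g0 S by blast
  define Q where "Q g d \<longleftrightarrow> (\<forall>y. b \<le> y \<longrightarrow> y < b + d \<longrightarrow>
      (if g b = g0 b then inv g0 (g y) = y else inv g0 (g y) \<notin> {b..<b + d}))" for g :: "real \<Rightarrow> real" and d
  have "\<exists>d>0. \<forall>g\<in>S. Q g d"
  proof (rule finite_uniform_radius[OF S(1)])
    fix g assume g: "g \<in> S"
    show "\<exists>d>0. Q g d"
    proof (cases "g b = g0 b")
      case True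
      then obtain d where d: "d > 0" "\<forall>y. b \<le> y \<longrightarrow> y < b + d \<longrightarrow> g y = g0 y"
        using germ[OF g] unfolding b_def by blast
      have "Q g d" unfolding Q_def using d(2) True thompsonT_inv_cancel(3)[OF g0T] by metis
      then show ?thesis using d(1) by blast
    next
      case False
      have "(inv g0 \<circ> g) b \<noteq> b"
        using False thompsonT_inv_cancel(4)[OF g0T, of "g b"] by auto
      then obtain d where "d > 0" "\<forall>y. b \<le> y \<longrightarrow> y < b + d \<longrightarrow> (inv g0 \<circ> g) y \<notin> {b..<b + d}"
        using moving_neighbourhood[OF thompsonT_comp[OF thompsonT_inv[OF g0T]] b] g S by blast
      then show ?thesis using False unfolding Q_def by auto
    qed
  next
    fix g and d d' :: real assume "Q g d" "d' \<le> d"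
    then show "Q g d'" unfolding Q_def by force
  qed
  then obtain d where d: "d > 0" "\<And>g. g \<in> S \<Longrightarrow> Q g d" by blast
  obtain v where v: "v \<in> thompsonT" "\<And>x. x \<in> {0..<3/4} \<Longrightarrow> v x \<in> {b..<b + d}"
    using shrinking_element[OF t d(1)] unfolding b_def by blast
  define p where "p = conjugate v contr"
  have p: "p \<in> thompsonT" "supported_in {b..<b + d} p"
    unfolding p_def using v by (auto intro!: conjugate_thompsonT contr_thompsonT supported_in_conjugate[OF v(1) contr_supported])
  have "displacement p \<circ> (quasireg (inv g0) \<circ> op_sum S c quasireg) \<circ> displacement (inv p) =
    (\<lambda>\<xi> C. (\<Sum>g\<in>{g\<in>S. g b = g0 b}. c g) * laplace p \<xi> C)"
  proof (rule compress_group_alg[OF S thompsonT_inv[OF g0T] p])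
    fix g y assume g: "g \<in> S" and y: "y \<in> {b..<b + d}"
    show "inv g0 (g y) = y" if "g b = g0 b" using d(2)[OF g] y that unfolding Q_def by auto
    show "inv g0 (g y) \<notin> {b..<b + d}" if "g b \<noteq> g0 b" using d(2)[OF g] y that unfolding Q_def by auto
  qed
  then show ?thesis using v(1) unfolding p_def b_def by blast
qed

lemma laplace_conjugate_quasireg:
  assumes u: "u \<in> thompsonT" and f: "f \<in> thompsonT"
  shows "quasireg u \<circ> laplace f \<circ> quasireg (inv u) = laplace (conjugate u f)"
proof (rule bounded_op_eqI[of TmodF])
  show "bounded_op TmodF (quasireg u \<circ> laplace f \<circ> quasireg (inv u))" "bounded_op TmodF (laplace (conjugate u f))"
    by (intro bounded_op_comp quasireg_bounded cstar_bounded[OF laplace_cstar] thompsonT_inv conjugate_thompsonT u f)+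
  fix \<xi> :: "(real \<Rightarrow> real) set \<Rightarrow> complex" assume \<xi>: "\<xi> \<in> ell2 TmodF"
  note ui = thompsonT_inv[OF u]
  have qu: "bounded_op TmodF (quasireg u)" using u by (rule quasireg_bounded)
  define w where "w = quasireg (inv u) \<xi>"
  have w: "w \<in> ell2 TmodF" unfolding w_def using quasireg_ell2(1)[OF ui \<xi>] .
  have uw: "quasireg u w = \<xi>"
    unfolding w_def using quasireg_inv_comp(1)[OF u] \<xi> by (metis comp_apply op_id_def)
  have disp: "quasireg u (displacement f w) = displacement (conjugate u f) \<xi>" if f: "f \<in> thompsonT" for f
    using bounded_op_diff_arg[OF qu w quasireg_ell2(1)[OF f w]] uw
    unfolding displacement_apply[OF w] displacement_apply[OF \<xi>] quasireg_conjugate[OF u f]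
    by (simp add: w_def)
  have "quasireg u (laplace f w) =
      (\<lambda>C. 1 * quasireg u (displacement f w) C + 1 * quasireg u (displacement (inv f) w) C)"
    unfolding laplace_def op_lincomb_def
    using f by (intro bounded_op_lincomb_arg[OF qu] bounded_op_ell2[OF cstar_bounded[OF displacement_cstar]] thompsonT_inv)
  then show "(quasireg u \<circ> laplace f \<circ> quasireg (inv u)) \<xi> = laplace (conjugate u f) \<xi>"
    using disp[OF f] disp[OF thompsonT_inv[OF f]]
    by (simp add: w_def[symmetric] laplace_def op_lincomb_def inv_conjugate[OF u f])
qed

lemma conjugate_conjugate:
  assumes "u \<in> thompsonT" "v \<in> thompsonT"
  shows "conjugate u (conjugate v f) = conjugate (u \<circ> v) f"
  unfolding conjugate_def using assms thompsonT_bij by (simp add: o_inv_distrib comp_assoc)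

section \<open>From one nonzero element of a closed ideal to the whole algebra\<close>

locale closed_cstar_ideal =
  fixes I :: "(real \<Rightarrow> real) set op set"
  assumes closed_ideal: "closed_ideal TmodF cstar_qr I"
begin

lemma subset: "A \<in> I \<Longrightarrow> A \<in> cstar_qr"
  using closed_ideal unfolding closed_ideal_def by blast

lemma zero: "op_zero \<in> I"
  using closed_ideal unfolding closed_ideal_def by blast

lemma lincomb: "A \<in> I \<Longrightarrow> B \<in> I \<Longrightarrow> op_lincomb a A b B \<in> I"
  using closed_ideal unfolding closed_ideal_def by blast

lemma comp_left: "A \<in> cstar_qr \<Longrightarrow> J \<in> I \<Longrightarrow> A \<circ> J \<in> I"
  using closed_ideal unfolding closed_ideal_def by blast

lemma comp_right: "A \<in> cstar_qr \<Longrightarrow> J \<in> I \<Longrightarrow> J \<circ> A \<in> I"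
  using closed_ideal unfolding closed_ideal_def by blast

lemma limit:
  assumes "A \<in> cstar_qr" "\<And>\<epsilon>. \<epsilon> > 0 \<Longrightarrow> \<exists>J\<in>I. op_bound TmodF (op_diff A J) \<epsilon>"
  shows "A \<in> I"
proof -
  have "\<exists>J\<in>I. opnorm TmodF (op_diff A J) < \<epsilon>" if \<epsilon>: "\<epsilon> > 0" for \<epsilon>
  proof -
    obtain J where "J \<in> I" "op_bound TmodF (op_diff A J) (\<epsilon> / 2)" using assms(2)[of "\<epsilon> / 2"] \<epsilon> by auto
    then show ?thesis using opnorm_le[of TmodF "op_diff A J" "\<epsilon> / 2"] \<epsilon> by force
  qed
  then show ?thesis using closed_ideal assms(1) unfolding closed_ideal_def by blast
qed

lemma sum:
  assumes "finite J" "\<And>i. i \<in> J \<Longrightarrow> A i \<in> I"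
  shows "op_sum J c A \<in> I"
  using assms by (induction J rule: finite_induct) (auto simp: op_sum_empty op_sum_insert intro: zero lincomb)

text \<open>With D = 1 - w, the recursion 1 - D^(n+1) = (1 - D^n) + w D^n keeps 1 - D^n inside the
  ideal. As D^n tends to 0, closedness puts the identity there, without an inverse of
  \<open>w\<close>.\<close>

lemma near_unit:
  assumes w: "w \<in> I" and r: "op_bound TmodF (op_diff (op_id TmodF) w) r" "r < 1"
  shows "I = cstar_qr"
proof -
  define D where "D = op_diff (op_id TmodF) w"
  have D: "D \<in> cstar_qr" unfolding D_def op_diff_lincomb using w subset by (intro cstar_lincomb op_id_cstar)
  define P where "P n = ((\<lambda>A. D \<circ> A) ^^ n) (op_id TmodF)" for n
  have P0: "P 0 = op_id TmodF" and PS: "P (Suc n) = D \<circ> P n" for n unfolding P_def by simp_all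
  have P: "P n \<in> cstar_qr" for n
  proof (induction n)
    case (Suc n)
    then show ?case unfolding PS by (intro cstar_comp D)
  qed (simp add: P0 op_id_cstar)
  have bound: "op_bound TmodF (P n) (r ^ n)" for n
    using op_bound_comp[OF cstar_bounded[OF P] r(1)[folded D_def]]
    by (induction n) (auto simp: P0 PS op_bound_id)
  have mem: "op_diff (op_id TmodF) (P n) \<in> I" for n
  proof (induction n)
    case 0
    have "op_diff (op_id TmodF) (P 0) = op_zero" unfolding P0 op_diff_def op_zero_def by simp
    then show ?case using zero by simp
  next
    case (Suc n)
    have "D \<circ> P n = op_diff (P n) (w \<circ> P n)"
      using bounded_op_ell2[OF cstar_bounded[OF P[of n]]] unfolding D_def op_diff_def op_id_def by (simp add: fun_eq_iff)
    then have "op_diff (op_id TmodF) (P (Suc n)) = op_lincomb 1 (op_diff (op_id TmodF) (P n)) 1 (w \<circ> P n)"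
      unfolding PS op_diff_def op_lincomb_def by (simp add: fun_eq_iff)
    then show ?case using Suc comp_right[OF P w] lincomb by simp
  qed
  have "op_id TmodF \<in> I"
  proof (rule limit[OF op_id_cstar])
    fix \<epsilon> :: real assume "\<epsilon> > 0"
    have "(\<lambda>n. r ^ n) \<longlonglongrightarrow> 0" using r op_bound_nonneg[OF r(1)] by (intro LIMSEQ_power_zero) auto
    then obtain n where "r ^ n < \<epsilon>"
      using order_tendstoD(2)[OF _ \<open>\<epsilon> > 0\<close>] eventually_happens'[OF sequentially_bot] by blast
    moreover have "op_diff (op_id TmodF) (op_diff (op_id TmodF) (P n)) = P n" unfolding op_diff_def by simp
    ultimately have "op_bound TmodF (op_diff (op_id TmodF) (op_diff (op_id TmodF) (P n))) \<epsilon>"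
      using op_bound_mono[OF bound[of n]] by simp
    then show "\<exists>J\<in>I. op_bound TmodF (op_diff (op_id TmodF) J) \<epsilon>" using mem by blast
  qed
  then have "A \<in> I" if "A \<in> cstar_qr" for A
    using comp_left[OF that] op_id_comp(2)[OF cstar_bounded[OF that]] by metis
  then show ?thesis using subset by blast
qed

text \<open>T acts transitively on the cosets, so multiplication by group elements on both sides
  brings any matrix coefficient to the base coset.\<close>

lemma exists_base_coefficient:
  assumes A: "A \<in> I" "A \<noteq> op_zero"
  shows "\<exists>B\<in>I. B (delta (coset id)) (coset id) \<noteq> 0"
proof -
  obtain C D where CD: "C \<in> TmodF" "D \<in> TmodF" "A (delta C) D \<noteq> 0"
    using nonzero_coefficient[OF cstar_bounded[OF subset[OF A(1)]] A(2)] by blast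
  obtain g h where gh: "g \<in> thompsonT" "C = coset g" "h \<in> thompsonT" "D = coset h"
    using CD(1,2) TmodF_E by metis
  define B where "B = quasireg (inv h) \<circ> A \<circ> quasireg g"
  have "B \<in> I" unfolding B_def using gh A by (intro comp_left comp_right quasireg_cstar thompsonT_inv)
  moreover have "B (delta (coset id)) (coset id) = A (delta C) D"
  proof -
    have "quasireg g (delta (coset id)) = delta C"
      using quasireg_delta[OF gh(1) coset_TmodF[OF thompsonT_id]] gh(2) by (simp add: lcoset_coset)
    moreover have "quasireg (inv h) (A (delta C)) (coset id) = A (delta C) D"
      using quasireg_apply[OF bounded_op_ell2[OF cstar_bounded[OF subset[OF A(1)]]] coset_TmodF[OF thompsonT_id], of "inv h" "delta C"]
        thompsonT_inv_inv[OF gh(3)] gh(4) by (simp add: lcoset_coset)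
    ultimately show ?thesis unfolding B_def by simp
  qed
  ultimately show ?thesis using CD(3) by metis
qed

text \<open>The elements of \<open>S\<close> carrying \<open>C\<close> to \<open>D\<close> fix 0
  with one common slope, so they coincide near \<open>b\<close>, and compression turns
  \<open>B\<close> into \<open>s\<close> times a Laplacian, \<open>s\<close> being the coefficient
  of \<open>B\<close> from \<open>C\<close> to \<open>D\<close>. Since |s| \<ge> \<eta>/2, dividing
  by \<open>s\<close> turns the error 4 \<epsilon> into 8 \<epsilon> / \<eta>.\<close>

lemma laplace_approximation:
  assumes A: "A \<in> I" and \<eta>: "\<eta> > 0"
    and coef: "\<And>N. N0 \<le> N \<Longrightarrow> \<exists>i<n. \<exists>j<n. \<eta> \<le> cmod (A (delta (coset (near (N + i)))) (coset (near (N + j))))"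
    and \<epsilon>: "0 < \<epsilon>" "\<epsilon> \<le> \<eta> / 2"
  shows "\<exists>v\<in>thompsonT. \<exists>J\<in>I. op_bound TmodF (op_diff (laplace (conjugate v contr)) J) (8 * \<epsilon> / \<eta>)"
proof -
  have Ac: "A \<in> cstar_qr" using A by (rule subset)
  obtain B where B: "B \<in> group_alg_qr" "op_bound TmodF (op_diff A B) \<epsilon>"
    using Ac \<epsilon>(1) unfolding cstar_qr_iff by blast
  obtain S c where S: "finite S" "S \<subseteq> thompsonT" "B = op_sum S c quasireg"
    using group_alg_op_sum[OF B(1)] by metis
  obtain k :: "(real \<Rightarrow> real) \<Rightarrow> int" and d N1 where germ: "d > 0" "d \<le> 1"
    "\<And>g y. g \<in> S \<Longrightarrow> 0 \<le> y \<Longrightarrow> y < d \<Longrightarrow> g y = g 0 + 2 powi (k g) * y"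
    "\<And>n. N1 \<le> n \<Longrightarrow> near n 0 < d"
    "\<And>g n. g \<in> S \<Longrightarrow> g 0 \<noteq> 0 \<Longrightarrow> N1 \<le> n \<Longrightarrow> near n 0 < g 0"
    using germs_at_zero[OF S(1,2)] by metis
  \<comment> \<open>Beyond \<open>N0\<close> the block contains a large coefficient of
    \<open>A\<close>; beyond \<open>N1\<close> the germs of the approximant are under
    control.\<close>
  define N where "N = max N0 N1"
  obtain i j where ij: "i < n" "j < n" "\<eta> \<le> cmod (A (delta (coset (near (N + i)))) (coset (near (N + j))))"
    using coef[of N] unfolding N_def by auto
  define C where "C = coset (near (N + i))"
  define D where "D = coset (near (N + j))"
  define b where "b = near (N + i) 0"
  have bd: "bounded_op TmodF (op_diff A B)" by (intro bounded_op_diff cstar_bounded Ac group_alg_bounded B)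
  have "b > 0" unfolding b_def by (simp add: near_0)
  moreover have "b < d" unfolding b_def N_def by (rule germ(4)) simp
  ultimately have b: "b > 0" "b < d" by blast+
  have moved: "D = lcoset g C \<longleftrightarrow> g 0 = 0 \<and> int (N + j) = int (N + i) - k g" if g: "g \<in> S" for g
    unfolding C_def D_def
  proof (rule near_coset_eq_iff[where d = d])
    show "g \<in> thompsonT" using g S by blast
    show "g y = g 0 + 2 powi k g * y" if "0 \<le> y" "y < d" for y using germ(3)[OF g that] .
    show "near (N + i) 0 < d" using b unfolding b_def by simp
    show "near (N + j) 0 < g 0" if "g 0 \<noteq> 0" unfolding N_def by (intro germ(5)[OF g that]) simp
  qed
  define s where "s = (\<Sum>g\<in>{g\<in>S. D = lcoset g C}. c g)"
  have "B (delta C) D = (\<Sum>g\<in>S. c g * (if D = lcoset g C then 1 else 0))"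
    unfolding S(3) C_def by (rule op_sum_quasireg_delta[OF S(2) coset_near_TmodF])
  also have "\<dots> = s" unfolding s_def using S(1) by (intro sum.mono_neutral_cong_right) auto
  finally have "B (delta C) D = s" .
  moreover have "cmod (op_diff A B (delta C) D) \<le> \<epsilon>"
    unfolding C_def by (rule op_bound_coefficient[OF bd B(2) coset_near_TmodF])
  ultimately have "cmod (A (delta C) D - s) \<le> \<epsilon>" unfolding op_diff_def by simp
  then have s: "cmod s \<ge> \<eta> / 2"
    using ij(3) \<epsilon>(2) norm_triangle_sub[of "A (delta C) D" s] unfolding C_def D_def by linarith
  then have "s \<noteq> 0" using \<eta> by auto
  then obtain g0 where g0: "g0 \<in> S" "D = lcoset g0 C"
    unfolding s_def by (metis (mono_tags, lifting) mem_Collect_eq sum.not_neutral_contains_not_neutral)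
  have g0T: "g0 \<in> thompsonT" using g0 S by blast
  have same: "D = lcoset g C \<longleftrightarrow> g b = g0 b" if g: "g \<in> S" for g
  proof -
    have "pt D = g0 b" unfolding g0(2) C_def b_def by (simp add: lcoset_coset)
    moreover have "pt (lcoset g C) = g b" unfolding C_def b_def by (simp add: lcoset_coset)
    moreover have "D \<in> TmodF" "lcoset g C \<in> TmodF"
      unfolding D_def C_def using g S lcoset_TmodF coset_near_TmodF by blast+
    ultimately show ?thesis using TmodF_eqI by metis
  qed
  have "\<exists>e>0. \<forall>y. b \<le> y \<longrightarrow> y < b + e \<longrightarrow> g y = g0 y" if g: "g \<in> S" "g b = g0 b" for g
  proof -
    \<comment> \<open>For elements fixing 0, the two indices of source and target determine the
      exponent of the slope.\<close>
    have "g 0 = 0" "g0 0 = 0" "k g = k g0" using moved[OF g(1)] moved[OF g0(1)] same[OF g(1)] g g0 by auto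
    then have "g y = g0 y" if "b \<le> y" "y < b + (d - b)" for y
      using germ(3)[OF g(1), of y] germ(3)[OF g0(1), of y] that b by simp
    then show ?thesis using b by (intro exI[of _ "d - b"]) simp
  qed
  then obtain v where v: "v \<in> thompsonT"
    "displacement (conjugate v contr) \<circ> (quasireg (inv g0) \<circ> op_sum S c quasireg) \<circ> displacement (inv (conjugate v contr)) =
      (\<lambda>\<xi> C. (\<Sum>g\<in>{g\<in>S. g b = g0 b}. c g) * laplace (conjugate v contr) \<xi> C)"
    using compression_witness[OF S(1,2) near_thompsonT[of "N + i"] g0(1)] unfolding b_def by blast
  define p where "p = conjugate v contr"
  have p: "p \<in> thompsonT" unfolding p_def using v(1) by (intro conjugate_thompsonT contr_thompsonT)
  have "{g\<in>S. g b = g0 b} = {g\<in>S. D = lcoset g C}" using same by blast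
  then have eq: "displacement p \<circ> (quasireg (inv g0) \<circ> B) \<circ> displacement (inv p) = (\<lambda>\<xi> C. s * laplace p \<xi> C)"
    using v(2) unfolding p_def S(3) s_def by simp
  define Z where "Z = displacement p \<circ> (quasireg (inv g0) \<circ> A) \<circ> displacement (inv p)"
  have dc: "displacement p \<in> cstar_qr" "displacement (inv p) \<in> cstar_qr" "quasireg (inv g0) \<in> cstar_qr"
    using p g0T by (auto intro: displacement_cstar quasireg_cstar thompsonT_inv)
  have Z: "Z \<in> I" unfolding Z_def using dc A by (intro comp_left comp_right)
  have db: "op_bound TmodF (displacement g) 2" if "g \<in> thompsonT" for g
    using op_bound_lincomb[OF bounded_op_id quasireg_bounded[OF that] op_bound_id quasireg_bound[OF that], of 1 "-1"]
    unfolding displacement_def by simp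
  have "op_diff Z (\<lambda>\<xi> C. s * laplace p \<xi> C) = displacement p \<circ> (quasireg (inv g0) \<circ> op_diff A B) \<circ> displacement (inv p)"
  proof -
    note ba = cstar_bounded[OF dc(1)] cstar_bounded[OF dc(3)] cstar_bounded[OF Ac] group_alg_bounded[OF B(1)]
    have "quasireg (inv g0) \<circ> op_diff A B = op_diff (quasireg (inv g0) \<circ> A) (quasireg (inv g0) \<circ> B)"
      unfolding op_diff_lincomb by (rule comp_lincomb_right[OF ba(2,3,4)])
    moreover have "displacement p \<circ> op_diff (quasireg (inv g0) \<circ> A) (quasireg (inv g0) \<circ> B) =
        op_diff (displacement p \<circ> (quasireg (inv g0) \<circ> A)) (displacement p \<circ> (quasireg (inv g0) \<circ> B))"
      unfolding op_diff_lincomb by (rule comp_lincomb_right[OF ba(1) bounded_op_comp[OF ba(2,3)] bounded_op_comp[OF ba(2,4)]])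
    ultimately show ?thesis unfolding Z_def eq[symmetric] op_diff_lincomb by (simp only: comp_lincomb_left)
  qed
  \<comment> \<open>Each of the two displacements contributes a factor 2, and the group element
    between them is isometric.\<close>
  moreover have "op_bound TmodF (displacement p \<circ> (quasireg (inv g0) \<circ> op_diff A B) \<circ> displacement (inv p)) (2 * (1 * \<epsilon>) * 2)"
    by (intro op_bound_comp db quasireg_bound thompsonT_inv bounded_op_comp quasireg_bounded
        bd B(2) p g0T cstar_bounded[OF dc(2)])
  ultimately have Zb: "op_bound TmodF (op_diff Z (\<lambda>\<xi> C. s * laplace p \<xi> C)) (4 * \<epsilon>)" by simp
  define J where "J = op_lincomb (1 / s) Z 0 Z"
  have "J \<in> I" unfolding J_def using Z by (intro lincomb)
  moreover have "op_bound TmodF (op_diff (laplace p) J) (8 * \<epsilon> / \<eta>)"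
  proof -
    have lc: "bounded_op TmodF (op_diff Z (\<lambda>\<xi> C. s * laplace p \<xi> C))"
    proof -
      have "(\<lambda>\<xi> C. s * laplace p \<xi> C) = op_lincomb s (laplace p) 0 (laplace p)" unfolding op_lincomb_def by simp
      then show ?thesis using bounded_op_diff[OF cstar_bounded[OF subset[OF Z]]] bounded_op_lincomb cstar_bounded[OF laplace_cstar[OF p]] by metis
    qed
    have "op_diff (laplace p) J = op_lincomb (- (1 / s)) (op_diff Z (\<lambda>\<xi> C. s * laplace p \<xi> C)) 0 (op_diff Z (\<lambda>\<xi> C. s * laplace p \<xi> C))"
      unfolding J_def op_diff_def op_lincomb_def using \<open>s \<noteq> 0\<close> by (simp add: fun_eq_iff field_simps)
    moreover have "op_bound TmodF (op_lincomb (- (1 / s)) (op_diff Z (\<lambda>\<xi> C. s * laplace p \<xi> C)) 0 (op_diff Z (\<lambda>\<xi> C. s * laplace p \<xi> C)))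
        (cmod (- (1 / s)) * (4 * \<epsilon>) + cmod 0 * (4 * \<epsilon>))"
      by (rule op_bound_lincomb[OF lc lc Zb Zb])
    moreover have "cmod (- (1 / s)) * (4 * \<epsilon>) + cmod 0 * (4 * \<epsilon>) \<le> 8 * \<epsilon> / \<eta>"
    proof -
      have "1 / cmod s \<le> 2 / \<eta>" using s \<eta> \<open>s \<noteq> 0\<close> by (simp add: field_simps)
      then have "1 / cmod s * (4 * \<epsilon>) \<le> 2 / \<eta> * (4 * \<epsilon>)" using \<epsilon>(1) by (intro mult_right_mono) auto
      then show ?thesis by (simp add: norm_divide)
    qed
    ultimately show ?thesis using op_bound_mono by metis
  qed
  ultimately show ?thesis using v(1) unfolding p_def by blast
qed

text \<open>Any two conjugates of \<open>contr\<close> are conjugate to each other, here by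
  \<open>u \<circ> inv v\<close>. Conjugation preserves the ideal and the norm, so the tolerance
  stays the same.\<close>

lemma laplace_approximation_all:
  assumes v: "v \<in> thompsonT" and J: "J \<in> I" "op_bound TmodF (op_diff (laplace (conjugate v contr)) J) e"
    and u: "u \<in> thompsonT"
  shows "\<exists>J\<in>I. op_bound TmodF (op_diff (laplace (conjugate u contr)) J) e"
proof -
  define t where "t = u \<circ> inv v"
  have t: "t \<in> thompsonT" unfolding t_def using u v by (intro thompsonT_comp thompsonT_inv)
  note ti = thompsonT_inv[OF t]
  have p: "conjugate v contr \<in> thompsonT" using v by (intro conjugate_thompsonT contr_thompsonT)
  have "t \<circ> v = u" unfolding t_def using thompsonT_inv_cancel(1)[OF v] by (simp add: comp_assoc)
  then have "conjugate t (conjugate v contr) = conjugate u contr" using conjugate_conjugate[OF t v] by simp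
  then have l: "quasireg t \<circ> laplace (conjugate v contr) \<circ> quasireg (inv t) = laplace (conjugate u contr)"
    using laplace_conjugate_quasireg[OF t p] by simp
  define K where "K = quasireg t \<circ> J \<circ> quasireg (inv t)"
  have bd: "bounded_op TmodF (laplace (conjugate v contr))" "bounded_op TmodF J"
    using p J subset by (auto intro: cstar_bounded laplace_cstar)
  have "K \<in> I" unfolding K_def using J t ti by (intro comp_left comp_right quasireg_cstar)
  moreover have "op_diff (laplace (conjugate u contr)) K = quasireg t \<circ> op_diff (laplace (conjugate v contr)) J \<circ> quasireg (inv t)"
    unfolding l[symmetric] K_def op_diff_lincomb comp_lincomb_right[OF quasireg_bounded[OF t] bd] comp_lincomb_left ..
  moreover have "op_bound TmodF (quasireg t \<circ> op_diff (laplace (conjugate v contr)) J \<circ> quasireg (inv t)) (1 * e * 1)"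
    using t ti bd J(2) by (intro op_bound_comp quasireg_bound quasireg_bounded bounded_op_diff)
  ultimately show ?thesis by (metis mult_1 mult.right_neutral)
qed

lemma trivial: "I = {op_zero} \<or> I = cstar_qr"
proof (cases "I = {op_zero}")
  case False
  then obtain A where "A \<in> I" "A \<noteq> op_zero" using zero by blast
  then obtain B where B: "B \<in> I" "B (delta (coset id)) (coset id) \<noteq> 0" using exists_base_coefficient by blast
  obtain \<eta> n N0 where \<eta>: "\<eta> > 0"
    "\<And>N. N0 \<le> N \<Longrightarrow> \<exists>i<n. \<exists>j<n. \<eta> \<le> cmod (B (delta (coset (near (N + i)))) (coset (near (N + j))))"
    using persistent_coefficient[OF subset[OF B(1)] B(2)] by blast
  \<comment> \<open>Makes the tolerance of each Laplacian 1/8192. Four such errors with weight 1/16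
    amount to 1/32768, half of the gap in \<open>mean_bound\<close>.\<close>
  define \<epsilon> where "\<epsilon> = \<eta> / 65536"
  have \<epsilon>: "0 < \<epsilon>" "\<epsilon> \<le> \<eta> / 2" "8 * \<epsilon> / \<eta> = 1 / 8192" unfolding \<epsilon>_def using \<eta>(1) by auto
  obtain v J where v: "v \<in> thompsonT" "J \<in> I" "op_bound TmodF (op_diff (laplace (conjugate v contr)) J) (1 / 8192)"
    using laplace_approximation[OF B(1) \<eta> \<epsilon>(1,2)] unfolding \<epsilon>(3) by blast
  have "\<exists>J\<in>I. op_bound TmodF (op_diff (laplace (contr_rot k)) J) (1 / 8192)" for k
    unfolding contr_rot_def using laplace_approximation_all[OF v] thompsonT_inv[OF rot_pow_thompsonT] by blast
  then obtain L where L: "\<And>k. L k \<in> I" "\<And>k. op_bound TmodF (op_diff (laplace (contr_rot k)) (L k)) (1 / 8192)" by metis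
  have Lc: "L k \<in> cstar_qr" for k using L(1) subset by blast
  define w where "w = op_sum {..<4::nat} (\<lambda>_. of_real (1/16)) L"
  have w: "w \<in> I" unfolding w_def using L(1) by (intro sum) auto
  have lap: "laplace (contr_rot k) \<in> cstar_qr" for k by (intro laplace_cstar contr_rot_thompsonT)
  define E where "E = op_sum {..<4::nat} (\<lambda>_. of_real (1/16)) (\<lambda>k. op_diff (laplace (contr_rot k)) (L k))"
  have E: "bounded_op TmodF E"
    unfolding E_def by (intro cstar_bounded cstar_sum) (auto simp: op_diff_lincomb intro!: cstar_lincomb lap Lc)
  have Eb: "op_bound TmodF E (1 / 32768)"
    unfolding op_bound_def
  proof (intro conjI ballI)
    fix \<xi> :: "(real \<Rightarrow> real) set \<Rightarrow> complex" assume \<xi>: "\<xi> \<in> ell2 TmodF"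
    have bk: "bounded_op TmodF (op_diff (laplace (contr_rot k)) (L k))" for k
      by (intro bounded_op_diff cstar_bounded lap Lc)
    have "l2norm TmodF (E \<xi>) \<le> (\<Sum>k<4. l2norm TmodF (\<lambda>C. of_real (1/16) * op_diff (laplace (contr_rot k)) (L k) \<xi> C))"
      unfolding E_def op_sum_def by (intro ell2_sum(2) ell2_scale bounded_op_ell2[OF bk]) auto
    also have "\<dots> \<le> (\<Sum>k<4::nat. 1/16 * (1 / 8192 * l2norm TmodF \<xi>))"
      using op_boundD[OF L(2) \<xi>] by (intro sum_mono) (simp only: l2norm_scale, simp add: mult.commute)
    finally show "l2norm TmodF (E \<xi>) \<le> 1 / 32768 * l2norm TmodF \<xi>" by simp
  qed simp
  \<comment> \<open>The identity minus \<open>w\<close> is the contraction \<open>mean\<close>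
    perturbed by \<open>E\<close>, so its norm is still below 1.\<close>
  have "op_diff (op_id TmodF) w = op_lincomb 1 mean 1 E"
    unfolding w_def E_def mean_def op_diff_def op_lincomb_def op_sum_def
    by (simp add: fun_eq_iff sum_subtractf right_diff_distrib)
  then have "op_bound TmodF (op_diff (op_id TmodF) w) (cmod 1 * (1 - 1/16384) + cmod 1 * (1 / 32768))"
    using op_bound_lincomb[OF cstar_bounded[OF mean_cstar] E mean_bound Eb, of 1 1] by simp
  then have "I = cstar_qr" using w by (intro near_unit) auto
  then show ?thesis ..
qed simp

end

theorem mainTheorem7:
  shows "\<not> (\<exists>\<tau>. tracial_state TmodF cstar_qr \<tau>) \<and> simple_op_alg TmodF cstar_qr"
proof
  show "\<not> (\<exists>\<tau>. tracial_state TmodF cstar_qr \<tau>)" using no_tracial_state by blast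
  show "simple_op_alg TmodF cstar_qr"
    unfolding simple_op_alg_def
    using closed_cstar_ideal.trivial closed_cstar_ideal.intro by blast
qed

end
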